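(* Let $u(y)=\sum_{n=1}^{\infty}a_n\sin(3^ny)$, where $a_n\in\mathbb{R}$, $n^{-\alpha}\le|a_n|\le C_0n^{-\alpha}$ for all $n\ge1$ for some constants $\alpha\in(1,2)$, $C_0>1$, and $1\le|a_n|/|a_{n+1}|\le 3$ for all $n\ge 1$. Then there exist positive constants $\varepsilon,C$ (independent of $\nu$, $k$, $t$) such that for every $\nu>0$ and every integer $k\neq0$ satisfying $\nu|k|^{-1}\le1/2$, $$\|S_\nu(t)P_k\|_{L^2\to L^2}\le Ce^{-\varepsilon\widetilde{\lambda}_{\nu,k}t},\qquad \|R_\nu(t)P_k\|_{L^2\to L^2}\le Ce^{-\varepsilon\widetilde{\lambda}_{\nu,k}t},\qquad\forall\,t\ge0,$$ where $\widetilde{\lambda}_{\nu,k}=|k|\,(\ln(|k|/\nu))^{-\alpha}$.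
   Context: $\mathbb{T}=\mathbb{R}/2\pi\mathbb{Z}$; functions on $\mathbb{T}$ are identified with $2\pi$-periodic functions on $\mathbb{R}$. For $\nu>0$, $S_\nu(t):L^2(\mathbb{T}^2)\to L^2(\mathbb{T}^2)$, $t\ge0$, is the linear evolution semigroup generated by the drift-diffusion equation $\partial_tf-\nu\Delta f+u(y)\partial_xf=0$, $(x,y)\in\mathbb{T}^2$, $t>0$ (so $S_\nu(t)f_0$ is the solution at time $t$ with initial datum $f_0$), and $R_\nu(t):L^2(\mathbb{T}^2)\to L^2(\mathbb{T}^2)$ is the semigroup generated by $\partial_tf-\nu\partial_y^2f+u(y)\partial_xf=0$. $P_k$ denotes the projection onto the $k$-th Fourier mode in $x$. On the $k$-th mode, $S_\nu(t)P_k$ and $R_\nu(t)P_k$ correspond to the semigroups $e^{-tL_{k,\nu}}$ and $e^{-tR_{k,\nu}}$ on $L^2(\mathbb{T})$ (in $y$), with $L_{k,\nu}=iku-\nu(\partial_y^2-|k|^2)$ and $R_{k,\nu}=iku-\nu\partial_y^2$, both with domain $H^2(\mathbb{T})$. *)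

theory Defs
  imports "HOL-Analysis.Analysis"
begin

section \<open>Square-integrable functions on the torus\<close>

text \<open>Functions on the two-dimensional torus are functions on the plane that are
  \<open>2 * pi\<close>-periodic in each variable. Elements of \<open>L2_T2\<close> are representatives, so
  \<open>L2_norm\<close> is a seminorm on them, and identities in \<open>L\<^sup>2\<close> are stated almost everywhere.\<close>

definition periodic2 :: "(real \<times> real \<Rightarrow> complex) \<Rightarrow> bool" where
  "periodic2 f \<longleftrightarrow> (\<forall>x y. f (x + 2 * pi, y) = f (x, y) \<and> f (x, y + 2 * pi) = f (x, y))"

definition cell :: "(real \<times> real) set" where
  "cell = {0..2 * pi} \<times> {0..2 * pi}"

definition L2_T2 :: "(real \<times> real \<Rightarrow> complex) set" where
  "L2_T2 = {f. f \<in> borel_measurable borel \<and> periodic2 f \<and>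
               set_integrable lborel cell (\<lambda>z. (cmod (f z))\<^sup>2)}"

definition L2_norm :: "(real \<times> real \<Rightarrow> complex) \<Rightarrow> real" where
  "L2_norm f = sqrt (LINT z:cell|lborel. (cmod (f z))\<^sup>2)"

definition ae_eq :: "(real \<times> real \<Rightarrow> complex) \<Rightarrow> (real \<times> real \<Rightarrow> complex) \<Rightarrow> bool" where
  "ae_eq f g \<longleftrightarrow> (AE z in lborel. f z = g z)"

type_synonym L2_op = "(real \<times> real \<Rightarrow> complex) \<Rightarrow> (real \<times> real \<Rightarrow> complex)"

definition bounded_L2_op :: "L2_op \<Rightarrow> bool" where
  "bounded_L2_op T \<longleftrightarrow>
     (\<forall>f\<in>L2_T2. T f \<in> L2_T2) \<and>
     (\<forall>f\<in>L2_T2. \<forall>g\<in>L2_T2. \<forall>c d.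
        ae_eq (T (\<lambda>z. c * f z + d * g z)) (\<lambda>z. c * T f z + d * T g z)) \<and>
     (\<exists>M. \<forall>f\<in>L2_T2. L2_norm (T f) \<le> M * L2_norm f)"

definition L2_opnorm :: "L2_op \<Rightarrow> ereal" where
  "L2_opnorm T = (SUP f\<in>{f \<in> L2_T2. L2_norm f \<le> 1}. ereal (L2_norm (T f)))"

definition fourier_proj :: "int \<Rightarrow> L2_op" where
  "fourier_proj k f = (\<lambda>(x, y).
     (1 / (2 * pi)) * (LINT s:{0..2 * pi}|lborel. f (s, y) * cis (- (of_int k * s)))
       * cis (of_int k * x))"

section \<open>Strongly continuous semigroups and their generators\<close>

definition C0_semigroup :: "(real \<Rightarrow> L2_op) \<Rightarrow> bool" where
  "C0_semigroup S \<longleftrightarrow>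
     (\<forall>t\<ge>0. bounded_L2_op (S t)) \<and>
     (\<forall>f\<in>L2_T2. ae_eq (S 0 f) f) \<and>
     (\<forall>s\<ge>0. \<forall>t\<ge>0. \<forall>f\<in>L2_T2. ae_eq (S (s + t) f) (S s (S t f))) \<and>
     (\<forall>f\<in>L2_T2. ((\<lambda>t. L2_norm (\<lambda>z. S t f z - f z)) \<longlongrightarrow> 0) (at_right 0))"

text \<open>The graph of the infinitesimal generator: \<open>f\<close> lies in its domain iff such a \<open>g\<close> exists.\<close>

definition semigroup_generator ::
  "(real \<Rightarrow> L2_op) \<Rightarrow> (real \<times> real \<Rightarrow> complex) \<Rightarrow> (real \<times> real \<Rightarrow> complex) \<Rightarrow> bool" where
  "semigroup_generator S f g \<longleftrightarrow> f \<in> L2_T2 \<and> g \<in> L2_T2 \<and>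
     ((\<lambda>h. L2_norm (\<lambda>z. (S h f z - f z) / of_real h - g z)) \<longlongrightarrow> 0) (at_right 0)"

section \<open>The drift-diffusion operators\<close>

definition dx :: "(real \<times> real \<Rightarrow> complex) \<Rightarrow> (real \<times> real \<Rightarrow> complex)" where
  "dx f = (\<lambda>(x, y). vector_derivative (\<lambda>s. f (s, y)) (at x))"

definition dy :: "(real \<times> real \<Rightarrow> complex) \<Rightarrow> (real \<times> real \<Rightarrow> complex)" where
  "dy f = (\<lambda>(x, y). vector_derivative (\<lambda>s. f (x, s)) (at y))"

text \<open>Infinitely differentiable functions on the torus. It suffices to take the partial
  derivatives in one order, since by Schwarz's theorem they then commute.\<close>

definition test_function :: "(real \<times> real \<Rightarrow> complex) \<Rightarrow> bool" where
  "test_function \<phi> \<longleftrightarrow> periodic2 \<phi> \<and>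
     (\<forall>i j. ((dx ^^ i) ((dy ^^ j) \<phi>)) differentiable_on UNIV)"

text \<open>The graph of \<open>A = \<mu> \<partial>\<^sub>x\<^sup>2 + \<nu> \<partial>\<^sub>y\<^sup>2 - u(y) \<partial>\<^sub>x\<close> on \<open>L\<^sup>2\<close>, in the sense of distributions and with
  its maximal domain: \<open>A f = g\<close> as distributions, where the derivatives have been moved to the test
  function. For bounded continuous \<open>u\<close>, \<open>\<nu> > 0\<close> and \<open>\<mu> = \<nu>\<close>, elliptic regularity identifies
  this domain with \<open>H\<^sup>2\<close> of the torus. For \<open>\<mu> \<in> {0, \<nu>}\<close>, on a function of the form
  \<open>F(y) exp(i k x)\<close> membership in the domain means that \<open>F\<close> is in \<open>H\<^sup>2\<close> of the circle, and \<open>A\<close>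
  acts on \<open>F\<close> as \<open>\<nu> \<partial>\<^sub>y\<^sup>2 - \<mu> k\<^sup>2 - i k u\<close>.\<close>

definition drift_diffusion_op ::
  "real \<Rightarrow> real \<Rightarrow> (real \<Rightarrow> real) \<Rightarrow>
   (real \<times> real \<Rightarrow> complex) \<Rightarrow> (real \<times> real \<Rightarrow> complex) \<Rightarrow> bool" where
  "drift_diffusion_op \<mu> \<nu> u f g \<longleftrightarrow> f \<in> L2_T2 \<and> g \<in> L2_T2 \<and>
     (\<forall>\<phi>. test_function \<phi> \<longrightarrow>
        (LINT z:cell|lborel. g z * \<phi> z) =
        (LINT z:cell|lborel. f z *
           (of_real \<mu> * dx (dx \<phi>) z + of_real \<nu> * dy (dy \<phi>) z + of_real (u (snd z)) * dx \<phi> z)))"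

definition semigroup_generated_by ::
  "(real \<Rightarrow> L2_op) \<Rightarrow>
   ((real \<times> real \<Rightarrow> complex) \<Rightarrow> (real \<times> real \<Rightarrow> complex) \<Rightarrow> bool) \<Rightarrow> bool" where
  "semigroup_generated_by S A \<longleftrightarrow>
     C0_semigroup S \<and> (\<forall>f g. semigroup_generator S f g \<longleftrightarrow> A f g)"

text \<open>\<open>S\<close> solves \<open>\<partial>\<^sub>t f - \<nu> (\<partial>\<^sub>x\<^sup>2 + \<partial>\<^sub>y\<^sup>2) f + u(y) \<partial>\<^sub>x f = 0\<close>, and \<open>R\<close> solves
  \<open>\<partial>\<^sub>t f - \<nu> \<partial>\<^sub>y\<^sup>2 f + u(y) \<partial>\<^sub>x f = 0\<close>.\<close>

definition is_S_semigroup :: "(real \<Rightarrow> real) \<Rightarrow> real \<Rightarrow> (real \<Rightarrow> L2_op) \<Rightarrow> bool" where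
  "is_S_semigroup u \<nu> S \<longleftrightarrow> semigroup_generated_by S (drift_diffusion_op \<nu> \<nu> u)"

definition is_R_semigroup :: "(real \<Rightarrow> real) \<Rightarrow> real \<Rightarrow> (real \<Rightarrow> L2_op) \<Rightarrow> bool" where
  "is_R_semigroup u \<nu> R \<longleftrightarrow> semigroup_generated_by R (drift_diffusion_op 0 \<nu> u)"

definition lambda_rate :: "real \<Rightarrow> real \<Rightarrow> int \<Rightarrow> real" where
  "lambda_rate \<alpha> \<nu> k = \<bar>of_int k\<bar> * (ln (\<bar>of_int k\<bar> / \<nu>)) powr (- \<alpha>)"

end

theory Submission
  imports Defs
begin

text \<open>
  On the \<open>k\<close>-th Fourier mode the generator becomes \<open>\<nu> \<partial>\<^sub>y\<^sup>2 - \<mu> k\<^sup>2 - i k u\<close>, and the theorem follows from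
  the resolvent bound \<open>c |k| L\<^sup>-\<^sup>\<alpha> \<parallel>F\<parallel> \<le> \<parallel>(A - z) F\<parallel>\<close> for \<open>Re z \<ge> 0\<close>, where \<open>L = ln (|k| / \<nu>)\<close>.
  For this bound the circle is cut into \<open>3\<^sup>j\<close> equal intervals. On each of them the mean-zero
  antiderivative of \<open>u - \<lambda>\<close> is large in \<open>L\<^sup>2\<close> for every real \<open>\<lambda>\<close>: integrating \<open>u - \<lambda>\<close> against
  \<open>sin (3\<^sup>n y)\<close>, where \<open>n = j + K\<close>, all finer modes are orthogonal, and a fixed \<open>K\<close> makes the coarser
  ones negligible. A function \<open>F\<close> with \<open>(A - z) F\<close> small has a small derivative by the energy
  identity, so it is nearly constant on these intervals, which contradicts the oscillation of
  \<open>u\<close>. The scale \<open>9\<^sup>-\<^sup>j \<approx> (\<nu> / |k|) L\<^sup>\<alpha>\<close> balances the two effects.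

  The resolvent bound is turned into decay by cutting off an orbit in time, sampling it at the times
  \<open>j \<tau>\<close> and taking the discrete Fourier transform in \<open>j\<close>; Parseval's identity and the
  contraction property then halve the norm in a time of order \<open>1 / (c |k| L\<^sup>-\<^sup>\<alpha>)\<close>.
\<close>

section \<open>Square-integrable functions\<close>

text \<open>The semigroups are given only through the graphs of their generators. Neither a
  contraction property nor commutation with the projections onto modes is among the hypotheses. Both
  come from reading a sampled orbit as an implicit Euler scheme with a small local error: the mode
  operator is dissipative, so in the limit of small steps no Fourier coefficient can grow, and a
  mode that is absent at time 0 never appears. The local errors vanish only if the operators are
  bounded uniformly on compact time intervals; strong continuity at 0 yields this through the
  uniform boundedness principle, whence the gliding hump. Sampling also replaces vector-valued
  transforms in time by finite sums, for which Parseval's identity is pure algebra. Decay is first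
  shown for data in the domain of the generator. Exponentials lie in it and trigonometric
  polynomials in y are dense in every mode, so the operator norm is reached by approximation. The
  power \<alpha> in the rate stems from the coefficients: at scale 3^-j the oscillation of
  \<open>u\<close> is at least of order j^-\<alpha>, and the balance of scales keeps j at most of
  order ln (|k| / \<nu>).\<close>

definition sq :: "'a measure \<Rightarrow> ('a \<Rightarrow> complex) set" where
  "sq M = {f \<in> borel_measurable M. integrable M (\<lambda>x. (cmod (f x))\<^sup>2)}"

definition nrm :: "'a measure \<Rightarrow> ('a \<Rightarrow> complex) \<Rightarrow> real" where
  "nrm M f = sqrt (\<integral>x. (cmod (f x))\<^sup>2 \<partial>M)"

lemma sq_meas [measurable_dest]: "f \<in> sq M \<Longrightarrow> f \<in> borel_measurable M"
  by (simp add: sq_def)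

lemma sqI: "f \<in> borel_measurable M \<Longrightarrow> integrable M (\<lambda>x. (cmod (f x))\<^sup>2) \<Longrightarrow> f \<in> sq M"
  by (simp add: sq_def)

lemma sq_integrable: "f \<in> sq M \<Longrightarrow> integrable M (\<lambda>x. (cmod (f x))\<^sup>2)"
  by (simp add: sq_def)

lemma nrm_nonneg [simp]: "0 \<le> nrm M f"
  by (simp add: nrm_def)

lemma nrm_power2: "(nrm M f)\<^sup>2 = (\<integral>x. (cmod (f x))\<^sup>2 \<partial>M)"
  by (simp add: nrm_def)

lemma cmod_add_sq_le: "(cmod (a + b))\<^sup>2 \<le> 2 * (cmod a)\<^sup>2 + 2 * (cmod b)\<^sup>2"
proof -
  have "(cmod (a + b))\<^sup>2 \<le> (cmod a + cmod b)\<^sup>2"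
    by (intro power_mono norm_triangle_ineq norm_ge_zero)
  also have "\<dots> \<le> 2 * (cmod a)\<^sup>2 + 2 * (cmod b)\<^sup>2"
    using sum_squares_bound[of "cmod a" "cmod b"] by (simp add: power2_sum)
  finally show ?thesis .
qed

lemma sq_zero [simp]: "(\<lambda>x. 0) \<in> sq M"
  by (simp add: sq_def)

lemma sq_add [intro]:
  assumes "f \<in> sq M" "g \<in> sq M" shows "(\<lambda>x. f x + g x) \<in> sq M"
proof (rule sqI)
  note [measurable] = assms[THEN sq_meas]
  show "(\<lambda>x. f x + g x) \<in> borel_measurable M" by measurable
  show "integrable M (\<lambda>x. (cmod (f x + g x))\<^sup>2)"
  proof (rule Bochner_Integration.integrable_bound)
    show "integrable M (\<lambda>x. 2 * (cmod (f x))\<^sup>2 + 2 * (cmod (g x))\<^sup>2)"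
      using assms[THEN sq_integrable] by auto
  qed (use cmod_add_sq_le in auto)
qed

lemma sq_cmult [intro]:
  assumes "f \<in> sq M" shows "(\<lambda>x. c * f x) \<in> sq M"
  using assms by (auto simp: sq_def norm_mult power_mult_distrib)

lemma sq_diff [intro]:
  assumes "f \<in> sq M" "g \<in> sq M" shows "(\<lambda>x. f x - g x) \<in> sq M"
  using sq_add[OF assms(1) sq_cmult[OF assms(2), of "-1"]] by simp

lemma sq_sum [intro]:
  assumes "\<And>i. i \<in> A \<Longrightarrow> f i \<in> sq M" shows "(\<lambda>x. \<Sum>i\<in>A. f i x) \<in> sq M"
  using assms by (induction A rule: infinite_finite_induct) auto

lemma sq_cong_AE:
  assumes "f \<in> sq M" "g \<in> borel_measurable M" "AE x in M. f x = g x" shows "g \<in> sq M"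
proof (rule sqI)
  note [measurable] = assms(1)[THEN sq_meas] assms(2)
  show "integrable M (\<lambda>x. (cmod (g x))\<^sup>2)"
    by (rule integrable_cong_AE_imp[OF sq_integrable[OF assms(1)]]) (use assms(3) in auto)
qed fact

lemma nrm_cong_AE:
  assumes "f \<in> borel_measurable M" "g \<in> borel_measurable M" "AE x in M. f x = g x"
  shows "nrm M f = nrm M g"
proof -
  note [measurable] = assms(1,2)
  have "(\<integral>x. (cmod (f x))\<^sup>2 \<partial>M) = (\<integral>x. (cmod (g x))\<^sup>2 \<partial>M)"
    by (rule integral_cong_AE) (use assms(3) in auto)
  then show ?thesis by (simp add: nrm_def)
qed

lemma nrm_cmult: "nrm M (\<lambda>x. c * f x) = cmod c * nrm M f"
  by (simp add: nrm_def norm_mult power_mult_distrib real_sqrt_mult)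

lemma nrm_bound:
  assumes "integrable M (\<lambda>x. (cmod (f x))\<^sup>2)" "0 \<le> B" "(\<integral>x. (cmod (f x))\<^sup>2 \<partial>M) \<le> B\<^sup>2"
  shows "nrm M f \<le> B"
  unfolding nrm_def using assms by (meson real_sqrt_le_iff real_le_lsqrt)

lemma sq_prod_integrable:
  assumes "f \<in> sq M" "g \<in> sq M"
  shows "integrable M (\<lambda>x. f x * g x)"
proof (rule Bochner_Integration.integrable_bound)
  note [measurable] = assms[THEN sq_meas]
  show "integrable M (\<lambda>x. (cmod (f x))\<^sup>2 + (cmod (g x))\<^sup>2)"
    using assms[THEN sq_integrable] by auto
  have "cmod (f x) * cmod (g x) \<le> (cmod (f x))\<^sup>2 + (cmod (g x))\<^sup>2" for x
    using sum_squares_bound[of "cmod (f x)" "cmod (g x)"] mult_nonneg_nonneg[of "cmod (f x)" "cmod (g x)", OF norm_ge_zero norm_ge_zero]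
    unfolding mult.assoc by linarith
  then show "AE x in M. norm (f x * g x) \<le> norm ((cmod (f x))\<^sup>2 + (cmod (g x))\<^sup>2)"
    by (auto simp: norm_mult)
qed (use assms[THEN sq_meas] in measurable)

lemma sq_prod_norm_integrable:
  assumes "f \<in> sq M" "g \<in> sq M"
  shows "integrable M (\<lambda>x. cmod (f x) * cmod (g x))"
  using integrable_norm[OF sq_prod_integrable[OF assms]] by (simp add: norm_mult)

lemma Cauchy_Schwarz_nrm:
  assumes "f \<in> sq M" "g \<in> sq M"
  shows "(\<integral>x. cmod (f x) * cmod (g x) \<partial>M) \<le> nrm M f * nrm M g"
proof -
  note [simp] = assms[THEN sq_integrable] sq_prod_norm_integrable[OF assms]
  let ?A = "(nrm M f)\<^sup>2" and ?B = "(nrm M g)\<^sup>2" and ?C = "\<integral>x. cmod (f x) * cmod (g x) \<partial>M"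
  have "0 \<le> s\<^sup>2 * ?A - 2 * s * t * ?C + t\<^sup>2 * ?B" for s t :: real
  proof -
    have "0 \<le> (\<integral>x. (s * cmod (f x) - t * cmod (g x))\<^sup>2 \<partial>M)" by simp
    also have "\<dots> = (\<integral>x. s\<^sup>2 * (cmod (f x))\<^sup>2 - 2 * s * t * (cmod (f x) * cmod (g x)) + t\<^sup>2 * (cmod (g x))\<^sup>2 \<partial>M)"
      by (intro Bochner_Integration.integral_cong) (auto simp: power2_eq_square algebra_simps)
    also have "\<dots> = s\<^sup>2 * ?A - 2 * s * t * ?C + t\<^sup>2 * ?B"
      by (simp add: nrm_power2)
    finally show ?thesis .
  qed
  note * = this
  have C0: "0 \<le> ?C" by (intro integral_nonneg_AE) auto
  have "?C\<^sup>2 \<le> ?A * ?B"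
  proof (cases "?A = 0")
    case True
    have "?C = 0"
    proof (rule ccontr)
      assume "?C \<noteq> 0"
      then have "?C > 0" using C0 by linarith
      \<comment> \<open>This \<open>s\<close> makes the quadratic form equal to -1.\<close>
      then show False using *[of "(?B + 1) / (2 * ?C)" 1] True by simp
    qed
    then show ?thesis by simp
  next
    case False
    then have A: "?A > 0" by simp
    \<comment> \<open>The ratio \<open>s : t\<close> that minimises the form.\<close>
    have "0 \<le> ?C\<^sup>2 * ?A - 2 * ?C * ?A * ?C + ?A\<^sup>2 * ?B" by (rule *)
    also have "\<dots> = ?A * (?A * ?B - ?C\<^sup>2)" by (simp add: power2_eq_square algebra_simps)
    finally show ?thesis using A by (simp add: zero_le_mult_iff)
  qed
  then show ?thesis
    using C0 by (simp add: power_mult_distrib[symmetric] power2_le_iff_abs_le)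
qed

lemma cmod_integral_mult_le:
  assumes "f \<in> sq M" "g \<in> sq M"
  shows "cmod (\<integral>x. f x * g x \<partial>M) \<le> nrm M f * nrm M g"
proof -
  have "cmod (\<integral>x. f x * g x \<partial>M) \<le> (\<integral>x. cmod (f x * g x) \<partial>M)" by (rule integral_norm_bound)
  then show ?thesis using Cauchy_Schwarz_nrm[OF assms] by (simp add: norm_mult)
qed

lemma nrm_triangle:
  assumes "f \<in> sq M" "g \<in> sq M"
  shows "nrm M (\<lambda>x. f x + g x) \<le> nrm M f + nrm M g"
proof (rule nrm_bound)
  note [simp] = assms[THEN sq_integrable] sq_prod_norm_integrable[OF assms]
  show "integrable M (\<lambda>x. (cmod (f x + g x))\<^sup>2)" using sq_add[OF assms] by (rule sq_integrable)
  have "(\<integral>x. (cmod (f x + g x))\<^sup>2 \<partial>M) \<le>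
     (\<integral>x. (cmod (f x))\<^sup>2 + 2 * (cmod (f x) * cmod (g x)) + (cmod (g x))\<^sup>2 \<partial>M)"
  proof (rule integral_mono)
    show "integrable M (\<lambda>x. (cmod (f x + g x))\<^sup>2)" by fact
    have "(cmod (f x + g x))\<^sup>2 \<le> (cmod (f x) + cmod (g x))\<^sup>2" for x
      by (intro power_mono norm_triangle_ineq norm_ge_zero)
    then show "(cmod (f x + g x))\<^sup>2 \<le> (cmod (f x))\<^sup>2 + 2 * (cmod (f x) * cmod (g x)) + (cmod (g x))\<^sup>2" for x
      by (simp add: power2_sum algebra_simps)
  qed auto
  also have "\<dots> = (nrm M f)\<^sup>2 + 2 * (\<integral>x. cmod (f x) * cmod (g x) \<partial>M) + (nrm M g)\<^sup>2"
    by (simp add: nrm_power2)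
  also have "\<dots> \<le> (nrm M f + nrm M g)\<^sup>2"
    using Cauchy_Schwarz_nrm[OF assms] by (simp add: power2_sum)
  finally show "(\<integral>x. (cmod (f x + g x))\<^sup>2 \<partial>M) \<le> (nrm M f + nrm M g)\<^sup>2" .
qed auto

lemma nrm_uminus: "nrm M (\<lambda>x. - f x) = nrm M f"
  by (simp add: nrm_def)

lemma nrm_minus_commute: "nrm M (\<lambda>x. f x - g x) = nrm M (\<lambda>x. g x - f x)"
  by (simp add: nrm_def norm_minus_commute)

lemma nrm_triangle_diff:
  assumes "f \<in> sq M" "g \<in> sq M"
  shows "nrm M (\<lambda>x. f x - g x) \<le> nrm M f + nrm M g"
  using nrm_triangle[OF assms(1) sq_cmult[OF assms(2), of "-1"]] by (simp add: nrm_uminus)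

lemma nrm_le_add_diff:
  assumes "f \<in> sq M" "g \<in> sq M"
  shows "nrm M f \<le> nrm M g + nrm M (\<lambda>x. f x - g x)"
  using nrm_triangle[OF assms(2) sq_diff[OF assms]] by simp

lemma sq_conj [intro]: "f \<in> sq M \<Longrightarrow> (\<lambda>x. cnj (f x)) \<in> sq M"
  by (auto simp: sq_def intro!: measurable_compose[OF _ borel_measurable_continuous_onI[of cnj]] continuous_intros)

lemma nrm_conj: "nrm M (\<lambda>x. cnj (f x)) = nrm M f"
  by (simp add: nrm_def)

lemma nrm_eq_0:
  assumes "f \<in> sq M" "nrm M f = 0" shows "AE x in M. f x = 0"
proof -
  have "(\<integral>x. (cmod (f x))\<^sup>2 \<partial>M) = 0" using assms(2) by (simp add: nrm_def)
  then have "AE x in M. (cmod (f x))\<^sup>2 = 0"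
    by (subst (asm) integral_nonneg_eq_0_iff_AE) (use sq_integrable[OF assms(1)] in auto)
  then show ?thesis by simp
qed

lemma sq_integrable1:
  assumes "finite_measure M" "f \<in> sq M" shows "integrable M f"
proof -
  interpret finite_measure M by fact
  have "(\<lambda>x. 1) \<in> sq M" by (simp add: sq_def)
  from sq_prod_integrable[OF assms(2) this] show ?thesis by simp
qed

lemma sq_bounded:
  assumes "finite_measure M" "f \<in> borel_measurable M" "\<And>x. cmod (f x) \<le> B"
  shows "f \<in> sq M"
proof (rule sqI)
  interpret finite_measure M by fact
  note [measurable] = assms(2)
  show "integrable M (\<lambda>x. (cmod (f x))\<^sup>2)"
  proof (rule integrable_const_bound[where B="B\<^sup>2"])
    show "AE x in M. norm ((cmod (f x))\<^sup>2) \<le> B\<^sup>2"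
      using assms(3) by (auto intro!: power_mono)
  qed measurable
qed fact

text \<open>An absolutely convergent series in \<open>L\<^sup>2\<close> converges: the Cauchy--Schwarz weights \<open>3\<^sup>i\<close> turn the
  square of the tail of the series into a series of integrable functions.\<close>

lemma sq_series:
  assumes s: "\<And>i. s i \<in> sq M" and b: "\<And>i. nrm M (s i) \<le> (1/3) ^ i"
  shows "(\<lambda>x. \<Sum>i. s i x) \<in> sq M"
    and "nrm M (\<lambda>x. (\<Sum>i. s i x) - (\<Sum>i<n. s i x)) \<le> 3/2 * (1/3) ^ n"
proof -
  note [measurable] = s[THEN sq_meas]
  define h where "h n x = (\<Sum>i. 3 ^ (i + n) * (cmod (s (i + n) x))\<^sup>2)" for n x
  have int: "integrable M (\<lambda>x. 3 ^ i * (cmod (s i x))\<^sup>2)" for i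
    using sq_integrable[OF s] by auto
  have ib: "(\<integral>x. 3 ^ i * (cmod (s i x))\<^sup>2 \<partial>M) \<le> (1/3) ^ i" for i
  proof -
    have "(nrm M (s i))\<^sup>2 \<le> ((1/3) ^ i)\<^sup>2" by (intro power_mono b) auto
    then have "3 ^ i * (nrm M (s i))\<^sup>2 \<le> 3 ^ i * ((1/3) ^ i)\<^sup>2" by simp
    also have "\<dots> = (1/3) ^ i" by (simp add: power2_eq_square power_one_over)
    finally show ?thesis by (simp add: nrm_power2)
  qed
  have sm: "summable (\<lambda>i. \<integral>x. norm (3 ^ (i + n) * (cmod (s (i + n) x))\<^sup>2) \<partial>M)" for n
  proof (rule summable_comparison_test')
    show "summable (\<lambda>i. (1/3::real) ^ (i + n))" by (simp add: power_add summable_mult2)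
    show "norm (\<integral>x. norm (3 ^ (i + n) * (cmod (s (i + n) x))\<^sup>2) \<partial>M) \<le> (1/3) ^ (i + n)" for i
      using ib[of "i+n"] by simp
  qed
  \<comment> \<open>The integrals of the weighted squares are summable, so by monotone convergence
    the weighted squares themselves are summable almost everywhere.\<close>
  have ae: "AE x in M. summable (\<lambda>i. 3 ^ i * (cmod (s i x))\<^sup>2)"
  proof -
    have "(\<integral>\<^sup>+x. (\<Sum>i. ennreal (3 ^ i * (cmod (s i x))\<^sup>2)) \<partial>M) = (\<Sum>i. \<integral>\<^sup>+x. ennreal (3 ^ i * (cmod (s i x))\<^sup>2) \<partial>M)"
      by (rule nn_integral_suminf) measurable
    also have "\<dots> = (\<Sum>i. ennreal (\<integral>x. 3 ^ i * (cmod (s i x))\<^sup>2 \<partial>M))"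
      using nn_integral_eq_integral[OF int] by simp
    also have "\<dots> = ennreal (\<Sum>i. \<integral>x. 3 ^ i * (cmod (s i x))\<^sup>2 \<partial>M)"
      using sm[of 0] by (intro suminf_ennreal2) auto
    also have "\<dots> \<noteq> \<infinity>" by simp
    finally have "AE x in M. (\<Sum>i. ennreal (3 ^ i * (cmod (s i x))\<^sup>2)) \<noteq> \<infinity>"
      by (intro nn_integral_noteq_infinite) auto
    then show ?thesis
      by eventually_elim (auto intro!: summable_suminf_not_top)
  qed
  have ae': "AE x in M. summable (\<lambda>i. norm (3 ^ (i + n) * (cmod (s (i + n) x))\<^sup>2))" for n
    using ae
  proof eventually_elim
    case (elim x)
    then show ?case using summable_ignore_initial_segment[OF elim, of n] by simp
  qed
  have hint: "integrable M (h n)" for n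
    unfolding h_def using int by (intro integrable_suminf ae' sm) auto
  have hval: "(\<integral>x. h n x \<partial>M) \<le> 3/2 * (1/3) ^ n" for n
  proof -
    have "(\<integral>x. h n x \<partial>M) = (\<Sum>i. \<integral>x. 3 ^ (i + n) * (cmod (s (i + n) x))\<^sup>2 \<partial>M)"
      unfolding h_def using int by (intro integral_suminf ae' sm) auto
    also have "\<dots> \<le> (\<Sum>i. (1/3) ^ (i + n))"
    proof (rule suminf_le)
      show "(\<integral>x. 3 ^ (i + n) * (cmod (s (i + n) x))\<^sup>2 \<partial>M) \<le> (1/3) ^ (i + n)" for i
        by (rule ib)
      show "summable (\<lambda>i. (1/3::real) ^ (i + n))" by (simp add: power_add summable_mult2)
      show "summable (\<lambda>i. \<integral>x. 3 ^ (i + n) * (cmod (s (i + n) x))\<^sup>2 \<partial>M)"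
        using sm[of n] by simp
    qed
    also have "\<dots> = 3/2 * (1/3) ^ n"
      by (simp add: power_add suminf_mult2[symmetric] suminf_geometric)
    finally show ?thesis .
  qed
  have tail: "AE x in M. (cmod ((\<Sum>i. s i x) - (\<Sum>i<n. s i x)))\<^sup>2 \<le> 3/2 * (1/3) ^ n * h n x" for n
    using ae
  proof eventually_elim
    fix x assume su: "summable (\<lambda>i. 3 ^ i * (cmod (s i x))\<^sup>2)"
    have sg: "summable (\<lambda>i. (1/3::real) ^ i)" by simp
    have "summable (\<lambda>i. norm (s i x))"
    proof (rule summable_comparison_test')
      show "summable (\<lambda>i. (1/3) ^ i + 3 ^ i * (cmod (s i x))\<^sup>2)"
        by (intro summable_add sg su)
      fix i
      \<comment> \<open>The inequality 2ab \<le> a^2 + b^2 with weight \<open>3 ^ i\<close> bounds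
        each term by a geometric term plus a weighted square; hence the series converges
        absolutely.\<close>
      have "2 * (1 * cmod (s i x)) * 3 ^ i \<le> 1 + (3 ^ i * cmod (s i x))\<^sup>2"
        using sum_squares_bound[of 1 "3 ^ i * cmod (s i x)"] by (simp add: algebra_simps)
      then have "2 * (1 * cmod (s i x)) * 3 ^ i / 3 ^ i \<le> (1 + (3 ^ i * cmod (s i x))\<^sup>2) / 3 ^ i"
        by (intro divide_right_mono) auto
      also have "\<dots> = (1/3) ^ i + 3 ^ i * (cmod (s i x))\<^sup>2"
        by (simp add: power2_eq_square field_simps power_one_over)
      finally have "2 * cmod (s i x) \<le> (1/3) ^ i + 3 ^ i * (cmod (s i x))\<^sup>2" by simp
      moreover have "0 \<le> cmod (s i x)" by (rule norm_ge_zero)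
      ultimately have "cmod (s i x) \<le> (1/3) ^ i + 3 ^ i * (cmod (s i x))\<^sup>2" by linarith
      then show "norm (norm (s i x)) \<le> (1/3) ^ i + 3 ^ i * (cmod (s i x))\<^sup>2" by simp
    qed
    note sn = this
    have sn': "summable (\<lambda>i. norm (s (i + n) x))"
      using summable_ignore_initial_segment[OF sn, of n] by simp
    have su': "summable (\<lambda>i. 3 ^ (i + n) * (cmod (s (i + n) x))\<^sup>2)"
      using summable_ignore_initial_segment[OF su, of n] by simp
    have sg': "summable (\<lambda>i. (1/3::real) ^ (i + n))" by (simp add: power_add summable_mult2)
    have sgv: "(\<Sum>i. (1/3::real) ^ (i + n)) = 3/2 * (1/3) ^ n"
      by (simp add: power_add suminf_mult2[symmetric] suminf_geometric)
    have "(\<Sum>i. s i x) - (\<Sum>i<n. s i x) = (\<Sum>i. s (i + n) x)"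
      using suminf_minus_initial_segment[OF summable_norm_cancel[OF sn], of n] by simp
    then have "cmod ((\<Sum>i. s i x) - (\<Sum>i<n. s i x)) \<le> (\<Sum>i. norm (s (i + n) x))"
      using summable_norm[OF sn'] by simp
    moreover have "(\<Sum>i. norm (s (i + n) x))\<^sup>2 \<le> (3/2 * (1/3) ^ n) * h n x"
    proof (rule LIMSEQ_le_const2)
      show "(\<lambda>m. (\<Sum>i<m. norm (s (i + n) x))\<^sup>2) \<longlonglongrightarrow> (\<Sum>i. norm (s (i + n) x))\<^sup>2"
        by (intro tendsto_power summable_LIMSEQ sn')
      have "(\<Sum>i<m. norm (s (i + n) x))\<^sup>2 \<le> 3/2 * (1/3) ^ n * h n x" for m
      proof -
        have "(\<Sum>i<m. norm (s (i + n) x))\<^sup>2 = (\<Sum>i<m. sqrt ((1/3) ^ (i + n)) * (sqrt (3 ^ (i + n)) * norm (s (i + n) x)))\<^sup>2"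
          by (simp add: mult.assoc[symmetric] real_sqrt_mult[symmetric] power_mult_distrib[symmetric])
        also have "\<dots> \<le> (\<Sum>i<m. (sqrt ((1/3) ^ (i + n)))\<^sup>2) * (\<Sum>i<m. (sqrt (3 ^ (i + n)) * norm (s (i + n) x))\<^sup>2)"
          by (rule Cauchy_Schwarz_ineq_sum)
        also have "\<dots> = (\<Sum>i<m. (1/3) ^ (i + n)) * (\<Sum>i<m. 3 ^ (i + n) * (cmod (s (i + n) x))\<^sup>2)"
          by (simp add: power_mult_distrib)
        also have "\<dots> \<le> (\<Sum>i. (1/3) ^ (i + n)) * h n x"
          unfolding h_def by (intro mult_mono sum_le_suminf sg' su' suminf_nonneg sum_nonneg) auto
        finally show ?thesis by (simp add: sgv)
      qed
      then show "\<exists>N. \<forall>m\<ge>N. (\<Sum>i<m. norm (s (i + n) x))\<^sup>2 \<le> 3/2 * (1/3) ^ n * h n x" by blast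
    qed
    ultimately show "(cmod ((\<Sum>i. s i x) - (\<Sum>i<n. s i x)))\<^sup>2 \<le> 3/2 * (1/3) ^ n * h n x"
      by (meson norm_ge_zero order_trans power_mono)
  qed
  have ti: "integrable M (\<lambda>x. (cmod ((\<Sum>i. s i x) - (\<Sum>i<n. s i x)))\<^sup>2)" for n
  proof (rule Bochner_Integration.integrable_bound)
    show "integrable M (\<lambda>x. 3/2 * (1/3) ^ n * h n x)" using hint by auto
    show "AE x in M. norm ((cmod ((\<Sum>i. s i x) - (\<Sum>i<n. s i x)))\<^sup>2) \<le> norm (3/2 * (1/3) ^ n * h n x)"
      using tail[of n] by eventually_elim auto
  qed measurable
  show "(\<lambda>x. \<Sum>i. s i x) \<in> sq M"
    using ti[of 0] by (intro sqI) auto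
  show "nrm M (\<lambda>x. (\<Sum>i. s i x) - (\<Sum>i<n. s i x)) \<le> 3/2 * (1/3) ^ n"
  proof (rule nrm_bound[OF ti])
    have "(\<integral>x. (cmod ((\<Sum>i. s i x) - (\<Sum>i<n. s i x)))\<^sup>2 \<partial>M) \<le> (\<integral>x. 3/2 * (1/3) ^ n * h n x \<partial>M)"
      by (intro integral_mono_AE ti tail) (use hint in auto)
    also have "\<dots> \<le> 3/2 * (1/3) ^ n * (3/2 * (1/3) ^ n)"
      using hval[of n] by simp
    finally show "(\<integral>x. (cmod ((\<Sum>i. s i x) - (\<Sum>i<n. s i x)))\<^sup>2 \<partial>M) \<le> (3/2 * (1/3) ^ n)\<^sup>2"
      by (simp add: power2_eq_square)
  qed auto
qed

section \<open>The discrete Fourier transform of an orbit\<close>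

text \<open>Orthogonality of the characters of a cyclic group. In the application \<open>d\<close>
  is the difference of two indices below \<open>N\<close>, so \<open>N\<close> divides it only when
  it vanishes.\<close>

lemma sum_roots_of_unity:
  fixes N :: nat and d :: int
  assumes "N > 0" "\<bar>d\<bar> < int N"
  shows "(\<Sum>m<N. cis (2 * pi * of_int d / real N) ^ m) = (if d = 0 then of_nat N else 0)"
proof (cases "d = 0")
  case False
  let ?w = "cis (2 * pi * of_int d / real N)"
  have "?w \<noteq> 1"
  proof
    assume "?w = 1"
    then obtain n :: int where "2 * pi * of_int d / real N = of_int n * 2 * pi"
      by (auto simp: cis.ctr complex_eq_iff cos_one_2pi_int)
    then have "real_of_int d = of_int n * real N" using assms(1) by (simp add: field_simps)
    then have "d = n * int N" by (metis of_int_eq_iff of_int_mult of_int_of_nat_eq)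
    moreover have "n \<noteq> 0" using calculation False by auto
    then have "1 * int N \<le> \<bar>n\<bar> * int N" by (intro mult_right_mono) auto
    ultimately show False using assms(2) by (simp add: abs_mult)
  qed
  moreover have "?w ^ N = 1"
  proof -
    have "?w ^ N = cis (2 * pi * of_int d)" using assms(1) unfolding Complex.DeMoivre by (intro arg_cong[where f=cis]) simp
    then show ?thesis by (simp add: cis_multiple_2pi)
  qed
  ultimately show ?thesis using False by (simp add: sum_gp_strict)
qed simp

lemma discrete_Parseval:
  fixes c :: "nat \<Rightarrow> complex"
  assumes "N > 0"
  shows "(\<Sum>m<N. (cmod (\<Sum>j<N. cis (2 * pi * real j / real N) ^ m * c j))\<^sup>2) = real N * (\<Sum>j<N. (cmod (c j))\<^sup>2)"
proof -
  let ?w = "\<lambda>j::nat. cis (2 * pi * real j / real N)"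
  have w: "?w j ^ m * cnj (?w l ^ m) = cis (2 * pi * of_int (int j - int l) / real N) ^ m" for j l m
  proof -
    have "?w j * cnj (?w l) = cis (2 * pi * of_int (int j - int l) / real N)"
      by (simp add: cis_cnj cis_mult diff_divide_distrib right_diff_distrib)
    then show ?thesis by (simp add: power_mult_distrib[symmetric])
  qed
  have "complex_of_real (\<Sum>m<N. (cmod (\<Sum>j<N. ?w j ^ m * c j))\<^sup>2)
      = (\<Sum>m<N. (\<Sum>j<N. ?w j ^ m * c j) * cnj (\<Sum>l<N. ?w l ^ m * c l))"
    by (simp only: of_real_sum complex_norm_square)
  also have "\<dots> = (\<Sum>m<N. \<Sum>j<N. \<Sum>l<N. (?w j ^ m * cnj (?w l ^ m)) * (c j * cnj (c l)))"
    by (simp add: sum_product algebra_simps cnj_sum)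
  also have "\<dots> = (\<Sum>j<N. \<Sum>l<N. \<Sum>m<N. (?w j ^ m * cnj (?w l ^ m)) * (c j * cnj (c l)))"
    by (rule trans[OF sum.swap]) (rule sum.cong[OF refl], rule sum.swap)
  also have "\<dots> = (\<Sum>j<N. \<Sum>l<N. (if j = l then of_nat N else 0) * (c j * cnj (c l)))"
  proof (intro sum.cong refl)
    fix j l assume "j \<in> {..<N}" "l \<in> {..<N}"
    then show "(\<Sum>m<N. (?w j ^ m * cnj (?w l ^ m)) * (c j * cnj (c l))) = (if j = l then of_nat N else 0) * (c j * cnj (c l))"
      using sum_roots_of_unity[of N "int j - int l"] assms
      by (simp only: w sum_distrib_right[symmetric]) (auto simp: abs_if)
  qed
  also have "\<dots> = (\<Sum>j<N. of_nat N * (c j * cnj (c j)))"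
    by (intro sum.cong refl) (simp add: if_distrib[of "\<lambda>x. x * _"] cong: if_cong)
  also have "\<dots> = complex_of_real (real N * (\<Sum>j<N. (cmod (c j))\<^sup>2))"
    by (simp add: sum_distrib_left complex_norm_square[symmetric])
  finally show ?thesis by (simp only: of_real_eq_iff)
qed

lemma discrete_Parseval_nrm:
  assumes "N > 0" "\<And>j. j < N \<Longrightarrow> q j \<in> sq M"
  shows "(\<Sum>m<N. (nrm M (\<lambda>x. \<Sum>j<N. cis (2 * pi * real j / real N) ^ m * q j x))\<^sup>2) = real N * (\<Sum>j<N. (nrm M (q j))\<^sup>2)"
proof -
  have "(\<lambda>x. \<Sum>j<N. cis (2 * pi * real j / real N) ^ m * q j x) \<in> sq M" for m
    using assms(2) by (intro sq_sum sq_cmult) auto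
  then have "(\<Sum>m<N. (nrm M (\<lambda>x. \<Sum>j<N. cis (2 * pi * real j / real N) ^ m * q j x))\<^sup>2)
    = (\<integral>x. (\<Sum>m<N. (cmod (\<Sum>j<N. cis (2 * pi * real j / real N) ^ m * q j x))\<^sup>2) \<partial>M)"
    unfolding nrm_power2 by (subst Bochner_Integration.integral_sum) (auto intro: sq_integrable)
  also have "\<dots> = (\<integral>x. real N * (\<Sum>j<N. (cmod (q j x))\<^sup>2) \<partial>M)"
    by (simp only: discrete_Parseval[OF assms(1)])
  also have "\<dots> = real N * (\<Sum>j<N. (nrm M (q j))\<^sup>2)"
    unfolding nrm_power2
    by (subst integral_mult_right_zero, subst Bochner_Integration.integral_sum) (auto intro: sq_integrable assms(2))
  finally show ?thesis .
qed

section \<open>An implicit Euler orbit and its windowed Fourier transform\<close>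

lemma tent_sum_lower:
  fixes M :: nat assumes "M > 0"
  shows "real (4 * M) ^ 3 / 32 \<le> (\<Sum>j<4*M. (real (min j (4 * M - j)))\<^sup>2)"
proof -
  \<comment> \<open>The middle half of the tent has \<open>2 * M\<close> terms, each of height at
    least \<open>M\<close>.\<close>
  have "real (4 * M) ^ 3 / 32 = (\<Sum>j\<in>{M..<3*M}. (real M)\<^sup>2)"
    by (simp add: power2_eq_square power3_eq_cube)
  also have "\<dots> \<le> (\<Sum>j\<in>{M..<3*M}. (real (min j (4 * M - j)))\<^sup>2)"
    by (intro sum_mono power_mono) auto
  also have "\<dots> \<le> (\<Sum>j<4*M. (real (min j (4 * M - j)))\<^sup>2)"
    by (intro sum_mono2) auto
  finally show ?thesis .
qed

text \<open>An implicit Euler scheme with local error: \<open>q j\<close> is the orbit at time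
  \<open>j * \<tau>\<close>, \<open>p j\<close> its image under the generator, and \<open>E\<close>
  bounds the distance of \<open>p j\<close> from the backward difference. The generator enters as a
  relation because it is known only by its graph, and \<open>A_dis\<close> is dissipativity.\<close>

locale discrete_orbit =
  fixes X :: "'a measure" and A :: "('a \<Rightarrow> complex) \<Rightarrow> ('a \<Rightarrow> complex) \<Rightarrow> bool"
    and q p :: "nat \<Rightarrow> 'a \<Rightarrow> complex" and N :: nat and \<tau> E :: real
  assumes A_sq: "A f g \<Longrightarrow> f \<in> sq X \<and> g \<in> sq X"
    and A_lin: "(\<And>j. j \<in> J \<Longrightarrow> A (fs j) (gs j)) \<Longrightarrow> finite J \<Longrightarrow>
       A (\<lambda>x. \<Sum>j\<in>(J::nat set). c j * fs j x) (\<lambda>x. \<Sum>j\<in>J. c j * gs j x)"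
    and A_dis: "A f g \<Longrightarrow> 0 \<le> s \<Longrightarrow> nrm X f \<le> nrm X (\<lambda>x. f x - of_real s * g x)"
    and N_pos: "N > 0" and tau_pos: "\<tau> > 0"
    and A_qp: "j \<le> N \<Longrightarrow> A (q j) (p j)"
    and E_bound: "1 \<le> j \<Longrightarrow> j \<le> N \<Longrightarrow> nrm X (\<lambda>x. p j x - (q j x - q (j - 1) x) / of_real \<tau>) \<le> E"
begin

lemma E_nonneg: "0 \<le> E"
  using E_bound[of N] N_pos order_trans[OF nrm_nonneg] by (metis Suc_leI One_nat_def order_refl)

lemma q_sq: "j \<le> N \<Longrightarrow> q j \<in> sq X" and p_sq: "j \<le> N \<Longrightarrow> p j \<in> sq X"
  using A_sq[OF A_qp] by auto

lemma e_sq: "j \<le> N \<Longrightarrow> (\<lambda>x. p j x - (q j x - q (j - 1) x) / of_real \<tau>) \<in> sq X"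
  using sq_diff[OF p_sq[of j] sq_cmult[OF sq_diff[OF q_sq[of j] q_sq[of "j - 1"]], of "1 / of_real \<tau>"]] by simp

text \<open>One step reads \<open>q (Suc j) - \<tau> p (Suc j) = q j - \<tau> e\<close> with
  \<open>e\<close> the local error. By dissipativity, inverting \<open>1 - \<tau> A\<close> does not
  increase norms, so only the errors accumulate.\<close>

lemma contraction: "i \<le> j \<Longrightarrow> j \<le> N \<Longrightarrow> nrm X (q j) \<le> nrm X (q i) + (real j - real i) * \<tau> * E"
proof (induction j rule: dec_induct)
  case (step j)
  let ?e = "\<lambda>x. p (Suc j) x - (q (Suc j) x - q j x) / of_real \<tau>"
  have s: "q (Suc j) \<in> sq X" "p (Suc j) \<in> sq X" "q j \<in> sq X"
    using q_sq p_sq step.prems by auto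
  have es: "?e \<in> sq X"
    using e_sq[of "Suc j"] step.prems by simp
  have "nrm X (q (Suc j)) \<le> nrm X (\<lambda>x. q (Suc j) x - of_real \<tau> * p (Suc j) x)"
    using tau_pos by (intro A_dis A_qp step.prems) simp
  also have "(\<lambda>x. q (Suc j) x - of_real \<tau> * p (Suc j) x) = (\<lambda>x. q j x - of_real \<tau> * ?e x)"
    using tau_pos by (auto simp: field_simps)
  also have "nrm X \<dots> \<le> nrm X (q j) + nrm X (\<lambda>x. of_real \<tau> * ?e x)"
    by (intro nrm_triangle_diff s sq_cmult es)
  also have "nrm X (\<lambda>x. of_real \<tau> * ?e x) \<le> \<tau> * E"
    unfolding nrm_cmult using tau_pos E_bound[of "Suc j"] step.prems by simp
  finally show ?case using step by (simp add: algebra_simps)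
qed simp

text \<open>Backward differences make the spectral parameters \<open>(1 - \<omega>\<^sup>m) / \<tau>\<close> of the discrete Fourier
  transform lie in the right half plane, where the resolvent bound holds.\<close>

lemma window_sum:
  fixes ch :: "nat \<Rightarrow> real"
  assumes resolvent: "\<And>f g z. A f g \<Longrightarrow> 0 \<le> Re z \<Longrightarrow> \<Psi> * nrm X f \<le> nrm X (\<lambda>x. g x - z * f x)"
    and \<Psi>: "0 \<le> \<Psi>" and ch0: "ch 0 = 0" "ch N = 0"
  shows "\<Psi>\<^sup>2 * (\<Sum>j<N. (ch j)\<^sup>2 * (nrm X (q j))\<^sup>2)
    \<le> 2 * (\<Sum>j<N. ((ch j - ch (j + 1)) / \<tau>)\<^sup>2 * (nrm X (q j))\<^sup>2) + 2 * (\<Sum>j<N. (ch j)\<^sup>2 * E\<^sup>2)"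
proof -
  define e where "e j x = p j x - (q j x - q (j - 1) x) / of_real \<tau>" for j x
  define w where "w m = cis (2 * pi / real N) ^ m" for m
  have wj: "cis (2 * pi * real j / real N) ^ m = w m ^ j" for j m
  proof -
    have "cis (2 * pi * real j / real N) = cis (2 * pi / real N) ^ j"
      by (simp add: Complex.DeMoivre mult.commute)
    then show ?thesis by (simp add: w_def power_mult[symmetric] mult.commute)
  qed
  define F where "F m x = (\<Sum>j<N. w m ^ j * (of_real (ch j) * q j x))" for m x
  define P where "P m x = (\<Sum>j<N. w m ^ j * (of_real (ch j) * p j x))" for m x
  define U where "U m x = (\<Sum>j<N. w m ^ j * (of_real ((ch j - ch (j + 1)) / \<tau>) * q j x))" for m x
  define V where "V m x = (\<Sum>j<N. w m ^ j * (of_real (ch j) * e j x))" for m x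
  have esq: "e j \<in> sq X" if "j \<le> N" for j using e_sq[OF that] by (simp add: e_def[abs_def])
  have AF: "A (F m) (P m)" for m
    using A_lin[of "{..<N}" q p "\<lambda>j. w m ^ j * of_real (ch j)"] A_qp
    by (simp add: F_def[abs_def] P_def[abs_def] mult.assoc)
  have U_sq: "U m \<in> sq X" for m unfolding U_def[abs_def] by (intro sq_sum sq_cmult q_sq) auto
  have V_sq: "V m \<in> sq X" for m unfolding V_def[abs_def] by (intro sq_sum sq_cmult esq) auto
  have cw: "cmod (w m) = 1" for m by (simp add: w_def norm_power)
  \<comment> \<open>Summation by parts in \<open>j\<close>: \<open>U\<close> collects the
    differences of the window and \<open>V\<close> the local errors. The transformed orbit thus
    solves a resolvent equation whose right side involves the orbit only through the slope of the
    window.\<close>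
  have id: "P m x - (1 - w m) / of_real \<tau> * F m x = w m * U m x + V m x" for m x
  proof -
    \<comment> \<open>At \<open>j = 0\<close> truncated subtraction turns \<open>q (j - 1)\<close>
      into \<open>q 0\<close>, which \<open>ch 0 = 0\<close> removes; \<open>ch N = 0\<close>
      removes the term at the other end.\<close>
    have shift: "(\<Sum>j<N. w m ^ j * (of_real (ch j) * q (j - 1) x)) = w m * (\<Sum>j<N. w m ^ j * (of_real (ch (j + 1)) * q j x))"
    proof -
      obtain n where n: "N = Suc n" using N_pos by (cases N) auto
      have "(\<Sum>j<N. w m ^ j * (of_real (ch j) * q (j - 1) x)) = (\<Sum>j<n. w m ^ Suc j * (of_real (ch (Suc j)) * q j x))"
        unfolding n by (subst sum.lessThan_Suc_shift) (simp add: ch0)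
      also have "\<dots> = w m * (\<Sum>j<N. w m ^ j * (of_real (ch (j + 1)) * q j x))"
        using ch0(2) unfolding n by (simp add: sum_distrib_left mult.assoc)
      finally show ?thesis .
    qed
    have "P m x = (\<Sum>j<N. w m ^ j * (of_real (ch j) * ((q j x - q (j - 1) x) / of_real \<tau> + e j x)))"
      unfolding P_def e_def by simp
    also have "\<dots> = F m x / of_real \<tau> - (\<Sum>j<N. w m ^ j * (of_real (ch j) * q (j - 1) x)) / of_real \<tau> + V m x"
      by (simp add: F_def V_def sum_divide_distrib sum_subtractf[symmetric] sum.distrib[symmetric] algebra_simps diff_divide_distrib)
    finally have eqP: "P m x = F m x / of_real \<tau> - (w m * (\<Sum>j<N. w m ^ j * (of_real (ch (j + 1)) * q j x))) / of_real \<tau> + V m x"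
      by (simp only: shift)
    have eqU: "U m x = F m x / of_real \<tau> - (\<Sum>j<N. w m ^ j * (of_real (ch (j + 1)) * q j x)) / of_real \<tau>"
      by (simp add: F_def U_def sum_divide_distrib sum_subtractf[symmetric] algebra_simps diff_divide_distrib)
    show ?thesis unfolding eqP eqU by (simp add: algebra_simps diff_divide_distrib)
  qed
  have step: "\<Psi>\<^sup>2 * (nrm X (F m))\<^sup>2 \<le> 2 * (nrm X (U m))\<^sup>2 + 2 * (nrm X (V m))\<^sup>2" for m
  proof -
    have "Re (w m) \<le> 1" using complex_Re_le_cmod[of "w m"] cw by simp
    then have "0 \<le> Re ((1 - w m) / of_real \<tau>)" using tau_pos by simp
    from resolvent[OF AF[of m] this] have "\<Psi> * nrm X (F m) \<le> nrm X (\<lambda>x. w m * U m x + V m x)"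
      by (simp only: id)
    also have "\<dots> \<le> nrm X (U m) + nrm X (V m)"
      using nrm_triangle[OF sq_cmult[OF U_sq, of "w m"] V_sq] by (simp add: nrm_cmult cw)
    finally have "(\<Psi> * nrm X (F m))\<^sup>2 \<le> (nrm X (U m) + nrm X (V m))\<^sup>2"
      using \<Psi> by (intro power_mono) auto
    also have "\<dots> \<le> 2 * (nrm X (U m))\<^sup>2 + 2 * (nrm X (V m))\<^sup>2"
      using sum_squares_bound[of "nrm X (U m)" "nrm X (V m)"] by (simp add: power2_sum)
    finally show ?thesis by (simp add: power_mult_distrib)
  qed
  have pars: "(\<Sum>m<N. (nrm X (\<lambda>x. \<Sum>j<N. w m ^ j * (of_real (c j) * h j x)))\<^sup>2) = real N * (\<Sum>j<N. (c j)\<^sup>2 * (nrm X (h j))\<^sup>2)"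
    if "\<And>j. j < N \<Longrightarrow> h j \<in> sq X" for c :: "nat \<Rightarrow> real" and h
    using discrete_Parseval_nrm[OF N_pos, of "\<lambda>j x. of_real (c j) * h j x" X] that
    by (simp add: wj nrm_cmult power_mult_distrib sq_cmult)
  have "real N * (\<Psi>\<^sup>2 * (\<Sum>j<N. (ch j)\<^sup>2 * (nrm X (q j))\<^sup>2)) = (\<Sum>m<N. \<Psi>\<^sup>2 * (nrm X (F m))\<^sup>2)"
    unfolding F_def[abs_def] sum_distrib_left[symmetric] by (subst pars) (auto intro: q_sq)
  also have "\<dots> \<le> (\<Sum>m<N. 2 * (nrm X (U m))\<^sup>2 + 2 * (nrm X (V m))\<^sup>2)"
    by (intro sum_mono step)
  also have "\<dots> = 2 * (\<Sum>m<N. (nrm X (U m))\<^sup>2) + 2 * (\<Sum>m<N. (nrm X (V m))\<^sup>2)"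
    by (simp add: sum.distrib sum_distrib_left)
  also have "\<dots> = real N * (2 * (\<Sum>j<N. ((ch j - ch (j + 1)) / \<tau>)\<^sup>2 * (nrm X (q j))\<^sup>2) + 2 * (\<Sum>j<N. (ch j)\<^sup>2 * (nrm X (e j))\<^sup>2))"
    unfolding U_def[abs_def] V_def[abs_def]
    by (subst pars, (auto intro: q_sq)[1], subst pars, (auto intro: esq)[1]) (simp add: algebra_simps)
  also have "(\<Sum>j<N. (ch j)\<^sup>2 * (nrm X (e j))\<^sup>2) \<le> (\<Sum>j<N. (ch j)\<^sup>2 * E\<^sup>2)"
  proof (rule sum_mono)
    fix j assume j: "j \<in> {..<N}"
    show "(ch j)\<^sup>2 * (nrm X (e j))\<^sup>2 \<le> (ch j)\<^sup>2 * E\<^sup>2"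
    proof (cases "j = 0")
      case False
      then have "nrm X (e j) \<le> E" using E_bound[of j] j by (simp add: e_def[abs_def])
      then show ?thesis by (intro mult_left_mono power_mono) auto
    qed (simp add: ch0)
  qed
  finally show ?thesis using N_pos by (simp add: mult_le_cancel_left)
qed

text \<open>The window is a tent of slope one. Its differences contribute order N / \<tau>^2, while
  its squares add up to order N^3, so a long time \<open>T\<close> wins. As the error
  \<open>E\<close> tends to 0 the estimate becomes \<Psi> T a \<le> 8 b, where \<open>a\<close> and
  \<open>b\<close> bound the orbit from below and above by means of
  \<open>contraction\<close>.\<close>

lemma window:
  assumes resolvent: "\<And>f g z. A f g \<Longrightarrow> 0 \<le> Re z \<Longrightarrow> \<Psi> * nrm X f \<le> nrm X (\<lambda>x. g x - z * f x)"
    and \<Psi>: "0 \<le> \<Psi>" and NM: "N = 4 * M" and T: "T = N * \<tau>"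
    and a: "0 \<le> a" "a \<le> nrm X (q N) - T * E"
  shows "(\<Psi> * T * a)\<^sup>2 \<le> 64 * ((nrm X (q 0) + T * E)\<^sup>2 + (T * E)\<^sup>2)"
proof -
  define ch where "ch j = real (min j (N - j))" for j
  let ?b = "nrm X (q 0) + T * E"
  have M: "M > 0" using N_pos NM by simp
  have TE: "(real j - real i) * \<tau> * E \<le> T * E" if "j \<le> N" for i j
    unfolding T using that tau_pos E_nonneg by (intro mult_right_mono) auto
  have lo: "a\<^sup>2 \<le> (nrm X (q j))\<^sup>2" if "j \<le> N" for j
    using contraction[of j N] TE[of N j] a that by (intro power_mono) auto
  have hi: "(nrm X (q j))\<^sup>2 \<le> ?b\<^sup>2" if "j \<le> N" for j
    using contraction[of 0 j] TE[of j 0] that by (intro power_mono) auto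
  have c1: "((ch j - ch (j + 1)) / \<tau>)\<^sup>2 \<le> 1 / \<tau>\<^sup>2" for j
  proof -
    have "\<bar>ch j - ch (j + 1)\<bar> \<le> 1" unfolding ch_def by (auto simp: min_def)
    then have "(ch j - ch (j + 1))\<^sup>2 \<le> 1" by (simp add: abs_square_le_1)
    then show ?thesis unfolding power_divide by (intro divide_right_mono) auto
  qed
  have c2: "(ch j)\<^sup>2 \<le> (real N)\<^sup>2" for j
    unfolding ch_def by (intro power_mono) auto
  have "\<Psi>\<^sup>2 * (a\<^sup>2 * (real N ^ 3 / 32)) \<le> \<Psi>\<^sup>2 * (a\<^sup>2 * (\<Sum>j<N. (ch j)\<^sup>2))"
    using tent_sum_lower[OF M] unfolding ch_def NM by (intro mult_left_mono) auto
  also have "\<dots> = \<Psi>\<^sup>2 * (\<Sum>j<N. (ch j)\<^sup>2 * a\<^sup>2)" by (simp add: sum_distrib_left mult.commute)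
  also have "\<dots> \<le> \<Psi>\<^sup>2 * (\<Sum>j<N. (ch j)\<^sup>2 * (nrm X (q j))\<^sup>2)"
    by (intro mult_left_mono sum_mono lo) auto
  also have "\<dots> \<le> 2 * (\<Sum>j<N. ((ch j - ch (j + 1)) / \<tau>)\<^sup>2 * (nrm X (q j))\<^sup>2) + 2 * (\<Sum>j<N. (ch j)\<^sup>2 * E\<^sup>2)"
    by (intro window_sum resolvent \<Psi>) (auto simp: ch_def)
  also have "\<dots> \<le> 2 * (\<Sum>j<N. 1 / \<tau>\<^sup>2 * ?b\<^sup>2) + 2 * (\<Sum>j<N. (real N)\<^sup>2 * E\<^sup>2)"
    by (intro add_mono mult_left_mono sum_mono mult_mono c1 c2 hi) auto
  also have "\<dots> = 2 * N * (?b\<^sup>2 / \<tau>\<^sup>2 + (real N)\<^sup>2 * E\<^sup>2)" by (simp add: algebra_simps)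
  \<comment> \<open>The factor is chosen so that the left side becomes the square of
    \<open>\<Psi> * T * a\<close>.\<close>
  finally have "32 * \<tau>\<^sup>2 / N * (\<Psi>\<^sup>2 * (a\<^sup>2 * (real N ^ 3 / 32))) \<le> 32 * \<tau>\<^sup>2 / N * (2 * N * (?b\<^sup>2 / \<tau>\<^sup>2 + (real N)\<^sup>2 * E\<^sup>2))"
    by (intro mult_left_mono) auto
  moreover have "32 * \<tau>\<^sup>2 / N * (\<Psi>\<^sup>2 * (a\<^sup>2 * (real N ^ 3 / 32))) = (\<Psi> * T * a)\<^sup>2"
    using N_pos unfolding T by (simp add: power2_eq_square power3_eq_cube)
  moreover have "32 * \<tau>\<^sup>2 / N * (2 * N * (?b\<^sup>2 / \<tau>\<^sup>2 + (real N)\<^sup>2 * E\<^sup>2)) = 64 * (?b\<^sup>2 + (T * E)\<^sup>2)"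
  proof -
    have "32 * \<tau>\<^sup>2 / N * (2 * N * (c / \<tau>\<^sup>2 + (real N)\<^sup>2 * E\<^sup>2)) = 64 * (c + (N * \<tau> * E)\<^sup>2)" for c
      using N_pos tau_pos by (simp add: field_simps power2_eq_square)
    then show ?thesis unfolding T by simp
  qed
  ultimately show ?thesis by simp
qed

end

section \<open>Fourier analysis on the circle\<close>

text \<open>A density instead of a restricted space keeps the underlying space \<open>UNIV\<close>
  and the Borel sigma-algebra, so that one function on the line can be integrated over many
  intervals without new measurability questions.\<close>

definition ivl :: "real \<Rightarrow> real \<Rightarrow> real measure" where
  "ivl a b = density lborel (\<lambda>x. ennreal (indicator {a..b} x))"

abbreviation circ :: "real measure" where "circ \<equiv> ivl 0 (2 * pi)"

lemma sets_ivl [simp, measurable_cong]: "sets (ivl a b) = sets borel"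
  by (simp add: ivl_def)

lemma space_ivl [simp]: "space (ivl a b) = UNIV"
  by (simp add: ivl_def)

lemma finite_measure_ivl: "finite_measure (ivl a b)"
proof
  have "emeasure (ivl a b) UNIV = emeasure lborel {a..b}"
    unfolding ivl_def by (subst emeasure_density) (auto simp: ennreal_indicator)
  then show "emeasure (ivl a b) (space (ivl a b)) \<noteq> \<infinity>" by (simp add: emeasure_lborel_Icc_eq)
qed

interpretation ivl: finite_measure "ivl a b" for a b by (rule finite_measure_ivl)

lemma measure_ivl: "a \<le> b \<Longrightarrow> measure (ivl a b) UNIV = b - a"
  unfolding measure_def ivl_def by (subst emeasure_density) (auto simp: ennreal_indicator)

lemma integral_ivl:
  fixes f :: "real \<Rightarrow> 'b :: {banach, second_countable_topology}"
  assumes "f \<in> borel_measurable borel"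
  shows "integral\<^sup>L (ivl a b) f = (LINT x:{a..b}|lborel. f x)"
  unfolding ivl_def set_lebesgue_integral_def using assms by (subst integral_density) auto

lemma integrable_ivl:
  fixes f :: "real \<Rightarrow> 'b :: {banach, second_countable_topology}"
  assumes "f \<in> borel_measurable borel"
  shows "integrable (ivl a b) f \<longleftrightarrow> set_integrable lborel {a..b} f"
  unfolding ivl_def set_integrable_def using assms by (subst integrable_density) auto

lemma AE_ivl: "(AE x in ivl a b. P x) \<longleftrightarrow> (AE x in lborel. x \<in> {a..b} \<longrightarrow> P x)"
  unfolding ivl_def by (subst AE_density) (auto simp: indicator_def)

lemma integrable_ivl_continuous:
  fixes f :: "real \<Rightarrow> 'b :: euclidean_space"
  assumes "continuous_on UNIV f" shows "integrable (ivl a b) f"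
proof -
  have [measurable]: "f \<in> borel_measurable borel" by (rule borel_measurable_continuous_onI[OF assms])
  show ?thesis
    by (subst integrable_ivl) (auto intro!: borel_integrable_atLeastAtMost' continuous_on_subset[OF assms])
qed

lemma integral_ivl_FTC:
  fixes f :: "real \<Rightarrow> 'b :: euclidean_space"
  assumes "a \<le> b" "\<And>x. (F has_vector_derivative f x) (at x)" "continuous_on UNIV f"
  shows "integral\<^sup>L (ivl a b) f = F b - F a"
proof -
  have [measurable]: "f \<in> borel_measurable borel" by (rule borel_measurable_continuous_onI[OF assms(3)])
  show ?thesis
    unfolding integral_ivl[OF \<open>f \<in> borel_measurable borel\<close>] set_lebesgue_integral_def
    by (rule integral_FTC_atLeastAtMost[OF assms(1)])
      (auto intro: has_vector_derivative_at_within[OF assms(2)] continuous_on_subset[OF assms(3)])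
qed

lemma sq_ivl_continuous:
  assumes "continuous_on UNIV f" shows "f \<in> sq (ivl a b)"
proof (rule sqI)
  show "f \<in> borel_measurable (ivl a b)"
    using borel_measurable_continuous_onI[OF assms] by simp
  show "integrable (ivl a b) (\<lambda>x. (cmod (f x))\<^sup>2)"
    by (intro integrable_ivl_continuous continuous_intros assms)
qed

lemma integral_ivl_bounds:
  assumes "a \<le> b" "f \<in> borel_measurable borel" "\<And>x. a \<le> x \<Longrightarrow> x \<le> b \<Longrightarrow> f x \<le> B" "0 \<le> B"
    "integrable (ivl a b) f"
  shows "integral\<^sup>L (ivl a b) f \<le> (b - a) * B"
proof -
  have "integral\<^sup>L (ivl a b) f \<le> (\<integral>x. B \<partial>ivl a b)"
    by (intro integral_mono_AE assms(5)) (use assms in \<open>auto simp: AE_ivl\<close>)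
  then show ?thesis using measure_ivl[OF assms(1)] by simp
qed

text \<open>Fubini on the triangle s \<le> y. \<open>H\<close> is merely integrable, so its
  antiderivative need not be differentiable everywhere and the product rule is not at hand.\<close>

lemma integral_ivl_by_parts:
  fixes H \<Phi> \<phi> :: "real \<Rightarrow> complex"
  assumes "a \<le> b" and H: "integrable (ivl a b) H"
    and \<Phi>: "\<And>x. (\<Phi> has_vector_derivative \<phi> x) (at x)" and \<phi>: "continuous_on UNIV \<phi>"
  shows "(\<integral>y. (\<integral>s. indicator {..y} s *\<^sub>R H s \<partial>ivl a b) * \<phi> y \<partial>ivl a b)
    = integral\<^sup>L (ivl a b) H * \<Phi> b - (\<integral>s. H s * \<Phi> s \<partial>ivl a b)"
proof -
  interpret p: pair_sigma_finite "ivl a b" "ivl a b" ..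
  have [measurable]: "H \<in> borel_measurable borel" using H by auto
  have [measurable]: "\<phi> \<in> borel_measurable borel" by (rule borel_measurable_continuous_onI[OF \<phi>])
  have c\<Phi>: "continuous_on UNIV \<Phi>"
    using \<Phi> by (auto simp: continuous_on_eq_continuous_at intro: has_vector_derivative_continuous)
  have [measurable]: "\<Phi> \<in> borel_measurable borel" by (rule borel_measurable_continuous_onI[OF c\<Phi>])
  have i\<phi>: "integrable (ivl a b) \<phi>" by (rule integrable_ivl_continuous[OF \<phi>])
  have "integrable (ivl a b \<Otimes>\<^sub>M ivl a b) (\<lambda>(s, y). H s * \<phi> y)"
  proof (rule p.Fubini_integrable)
    show "(\<lambda>(s, y). H s * \<phi> y) \<in> borel_measurable (ivl a b \<Otimes>\<^sub>M ivl a b)" by measurable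
    show "integrable (ivl a b) (\<lambda>x. \<integral>y. norm (case (x, y) of (s, y) \<Rightarrow> H s * \<phi> y) \<partial>ivl a b)"
      using H by (simp add: norm_mult)
    show "AE x in ivl a b. integrable (ivl a b) (\<lambda>y. case (x, y) of (s, y) \<Rightarrow> H s * \<phi> y)"
      using i\<phi> by simp
  qed
  note int0 = this
  have [measurable]: "(\<lambda>(s, y). indicat_real {..y} s) \<in> borel_measurable (ivl a b \<Otimes>\<^sub>M ivl a b)"
  proof -
    have "(\<lambda>(s, y). indicat_real {..y} s) = (\<lambda>x. if fst x \<le> snd x then 1 else 0)"
      by (auto simp: fun_eq_iff indicator_def)
    also have "\<dots> \<in> borel_measurable (ivl a b \<Otimes>\<^sub>M ivl a b)" by measurable
    finally show ?thesis .
  qed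
  have int: "integrable (ivl a b \<Otimes>\<^sub>M ivl a b) (\<lambda>(s, y). indicator {..y} s *\<^sub>R (H s * \<phi> y))"
  proof (rule Bochner_Integration.integrable_bound[OF int0])
    show "(\<lambda>(s, y). indicator {..y} s *\<^sub>R (H s * \<phi> y)) \<in> borel_measurable (ivl a b \<Otimes>\<^sub>M ivl a b)"
      by measurable
  qed (auto split: split_indicator)
  have "(\<integral>y. (\<integral>s. indicator {..y} s *\<^sub>R H s \<partial>ivl a b) * \<phi> y \<partial>ivl a b)
      = (\<integral>y. (\<integral>s. indicator {..y} s *\<^sub>R (H s * \<phi> y) \<partial>ivl a b) \<partial>ivl a b)"
    unfolding integral_mult_left_zero[symmetric] scaleR_left_distrib mult_scaleR_left ..
  also have "\<dots> = (\<integral>s. (\<integral>y. indicator {..y} s *\<^sub>R (H s * \<phi> y) \<partial>ivl a b) \<partial>ivl a b)"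
    using p.Fubini_integral[OF int] .
  also have "\<dots> = (\<integral>s. H s * (\<Phi> b - \<Phi> s) \<partial>ivl a b)"
  proof (rule integral_cong_AE)
    have "(\<integral>y. indicator {..y} s *\<^sub>R (H s * \<phi> y) \<partial>ivl a b) = H s * (\<Phi> b - \<Phi> s)" if "s \<in> {a..b}" for s
    proof -
      have "(\<integral>y. indicator {..y} s *\<^sub>R (H s * \<phi> y) \<partial>ivl a b) = H s * (\<integral>y. indicator {s..} y *\<^sub>R \<phi> y \<partial>ivl a b)"
        by (subst integral_mult_right_zero[symmetric]) (auto intro!: Bochner_Integration.integral_cong split: split_indicator)
      also have "(\<integral>y. indicator {s..} y *\<^sub>R \<phi> y \<partial>ivl a b) = (\<integral>y. \<phi> y \<partial>ivl s b)"
        using that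
        by (subst (1 2) integral_ivl)
          (auto simp: set_lebesgue_integral_def intro!: Bochner_Integration.integral_cong split: split_indicator)
      also have "\<dots> = \<Phi> b - \<Phi> s" using that by (intro integral_ivl_FTC \<Phi> \<phi>) auto
      finally show ?thesis .
    qed
    then show "AE s in ivl a b. (\<integral>y. indicator {..y} s *\<^sub>R (H s * \<phi> y) \<partial>ivl a b) = H s * (\<Phi> b - \<Phi> s)"
      by (auto simp: AE_ivl)
  qed measurable
  also have "\<dots> = (\<integral>s. H s * \<Phi> b - H s * \<Phi> s \<partial>ivl a b)" by (simp add: right_diff_distrib)
  also have "\<dots> = integral\<^sup>L (ivl a b) H * \<Phi> b - (\<integral>s. H s * \<Phi> s \<partial>ivl a b)"
  proof -
    obtain B where "\<forall>s\<in>{a..b}. cmod (\<Phi> s) \<le> B"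
      using compact_imp_bounded[OF compact_continuous_image[OF continuous_on_subset[OF c\<Phi>, of "{a..b}"]]]
      by (auto simp: bounded_iff)
    then have B: "\<And>s. s \<in> {a..b} \<Longrightarrow> cmod (\<Phi> s) \<le> B" by blast
    have "integrable (ivl a b) (\<lambda>s. H s * \<Phi> s)"
    proof (rule Bochner_Integration.integrable_bound)
      show "integrable (ivl a b) (\<lambda>s. H s * of_real \<bar>B\<bar>)" using H by simp
      have "cmod (\<Phi> s) \<le> \<bar>B\<bar>" if "s \<in> {a..b}" for s using B[OF that] by linarith
      then show "AE s in ivl a b. norm (H s * \<Phi> s) \<le> norm (H s * of_real \<bar>B\<bar>)"
        by (auto simp: AE_ivl norm_mult intro!: mult_left_mono)
    qed measurable
    from Bochner_Integration.integral_diff[OF integrable_mult_left[OF H] this]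
    show ?thesis unfolding integral_mult_left_zero .
  qed
  finally show ?thesis .
qed

section \<open>Trigonometric polynomials\<close>

inductive trig :: "(real \<Rightarrow> complex) \<Rightarrow> bool" where
  mono: "trig (\<lambda>y. c * cis (of_int m * y))"
| add: "trig p \<Longrightarrow> trig q \<Longrightarrow> trig (\<lambda>y. p y + q y)"

lemma trig_cmult: "trig p \<Longrightarrow> trig (\<lambda>y. c * p y)"
proof (induction rule: trig.induct)
  case (mono d m)
  then show ?case using trig.mono[of "c * d" m] by (simp add: mult.assoc)
qed (simp add: distrib_left trig.add)

lemma trig_mult_mono: "trig p \<Longrightarrow> trig (\<lambda>y. cis (of_int m * y) * p y)"
proof (induction rule: trig.induct)
  case (mono d n)
  then show ?case using trig.mono[of d "m + n"] by (simp add: cis_mult[symmetric] algebra_simps)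
qed (simp add: distrib_left trig.add)

lemma trig_mult: "trig p \<Longrightarrow> trig q \<Longrightarrow> trig (\<lambda>y. p y * q y)"
proof (induction rule: trig.induct)
  case (mono d n)
  then show ?case using trig_cmult[OF trig_mult_mono[of q n], of d] by (simp add: mult.assoc)
qed (simp add: distrib_right trig.add)

lemma trig_const: "trig (\<lambda>y. c)"
  using trig.mono[of c 0] by simp

lemma trig_continuous: "trig p \<Longrightarrow> continuous_on UNIV p"
  by (induction rule: trig.induct) (auto intro!: continuous_intros simp: cis_conv_exp)

lemma trig_cos_sin: "trig (\<lambda>y. of_real (cos y))" "trig (\<lambda>y. of_real (sin y))"
proof -
  have "trig (\<lambda>y. 1/2 * cis (of_int 1 * y) + 1/2 * cis (of_int (-1) * y))"
    by (intro trig.add trig.mono)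
  also have "(\<lambda>y. 1/2 * cis (of_int 1 * y) + 1/2 * cis (of_int (-1) * y)) = (\<lambda>y. of_real (cos y))"
    by (auto simp: complex_eq_iff)
  finally show "trig (\<lambda>y. of_real (cos y))" .
  have "trig (\<lambda>y. (-\<i>/2) * cis (of_int 1 * y) + (\<i>/2) * cis (of_int (-1) * y))"
    by (intro trig.add trig.mono)
  also have "(\<lambda>y. (-\<i>/2) * cis (of_int 1 * y) + (\<i>/2) * cis (of_int (-1) * y)) = (\<lambda>y. of_real (sin y))"
    by (auto simp: complex_eq_iff)
  finally show "trig (\<lambda>y. of_real (sin y))" .
qed

text \<open>Stone--Weierstrass delivers polynomials in the real and imaginary part of a point. On
  the unit circle every real linear functional is a combination of cosine and sine, and
  \<open>trig\<close> is closed under products.\<close>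

lemma trig_real_polynomial_cis:
  "real_polynomial_function r \<Longrightarrow> trig (\<lambda>y. complex_of_real (r (cis y)))"
proof (induction rule: real_polynomial_function.induct)
  case (linear h)
  then interpret h: bounded_linear h .
  have "h (cis y) = cos y * h 1 + sin y * h \<i>" for y
  proof -
    have "cis y = cos y *\<^sub>R 1 + sin y *\<^sub>R \<i>" by (simp add: complex_eq_iff)
    then have "h (cis y) = h (cos y *\<^sub>R 1 + sin y *\<^sub>R \<i>)" by simp
    then show ?thesis by (simp add: h.add h.scaleR del: scaleR_conv_of_real)
  qed
  then show ?case
    using trig.add[OF trig_cmult[OF trig_cos_sin(1), of "h 1"] trig_cmult[OF trig_cos_sin(2), of "h \<i>"]]
    by (simp add: mult.commute)
qed (simp_all add: trig_const trig.add trig_mult)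

lemma trig_polynomial_cis:
  assumes "polynomial_function (P :: complex \<Rightarrow> complex)" shows "trig (\<lambda>y. P (cis y))"
proof -
  have "real_polynomial_function (Re \<circ> P)" "real_polynomial_function (Im \<circ> P)"
    using assms bounded_linear_Re bounded_linear_Im unfolding polynomial_function_def by blast+
  then have "trig (\<lambda>y. of_real ((Re \<circ> P) (cis y)) + \<i> * of_real ((Im \<circ> P) (cis y)))"
    by (intro trig.add trig_cmult trig_real_polynomial_cis)
  then show ?thesis by (simp add: complex_eq[symmetric])
qed

text \<open>The factor vanishing at the endpoints makes the function on the circle continuous at 1.\<close>

lemma trig_approx_continuous:
  fixes h :: "real \<Rightarrow> complex"
  assumes h: "continuous_on UNIV h" and B: "\<And>y. cmod (h y) \<le> B" and "0 < e"
  obtains p where "trig p"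
    "\<And>y. y \<in> {0..2*pi} \<Longrightarrow> cmod (h y * of_real (min 1 (real n * (1 - cos y))) - p y) < e"
proof -
  define g where "g z = h (Arg2pi z) * of_real (min 1 (real n * (1 - Re z)))" for z
  have B0: "0 \<le> B" using B[of 0] norm_ge_zero order_trans by blast
  have "isCont g z \<or> z = 1" if "z \<in> sphere 0 1" for z
  proof (cases "z \<in> \<real>\<^sub>\<ge>\<^sub>0")
    case True
    then have "z = 1" using that by (auto simp: nonneg_Reals_def)
    then show ?thesis by simp
  next
    case False
    have "isCont (h \<circ> Arg2pi) z"
      using h by (intro continuous_at_compose continuous_at_Arg2pi False) (simp add: continuous_on_eq_continuous_at)
    then have "isCont g z" unfolding g_def o_def
      by (intro continuous_intros) (assumption | rule linear_continuous_at[OF bounded_linear_Re])+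
    then show ?thesis ..
  qed
  moreover have "isCont g 1"
  proof -
    have "((\<lambda>z. g z) \<longlongrightarrow> 0) (at 1)"
    proof (rule Lim_null_comparison)
      have "norm (g z) \<le> B * \<bar>min 1 (real n * (1 - Re z))\<bar>" for z
        unfolding g_def norm_mult norm_of_real by (intro mult_right_mono B) auto
      then show "\<forall>\<^sub>F z in at 1. norm (g z) \<le> B * \<bar>min 1 (real n * (1 - Re z))\<bar>" by simp
      have "((\<lambda>z. B * \<bar>min 1 (real n * (1 - Re z))\<bar>) \<longlongrightarrow> B * \<bar>min 1 (real n * (1 - Re 1))\<bar>) (at 1)"
        by (intro tendsto_intros)
      then show "((\<lambda>z. B * \<bar>min 1 (real n * (1 - Re z))\<bar>) \<longlongrightarrow> 0) (at 1)" by simp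
    qed
    moreover have "g 1 = 0" by (simp add: g_def)
    ultimately show ?thesis by (simp add: isCont_def)
  qed
  ultimately have "continuous_on (sphere 0 1) g"
    by (metis continuous_at_imp_continuous_on)
  then obtain P where P: "polynomial_function P" "\<And>z. z \<in> sphere 0 1 \<Longrightarrow> norm (g z - P z) < e"
    using Stone_Weierstrass_polynomial_function[of "sphere 0 1" g e] \<open>0 < e\<close> by auto
  have "cmod (h y * of_real (min 1 (real n * (1 - cos y))) - P (cis y)) < e" if "y \<in> {0..2*pi}" for y
  proof -
    \<comment> \<open>At \<open>y = 2 * pi\<close> the function \<open>Arg2pi\<close> returns 0 and
      not \<open>y\<close>, but there the factor with \<open>1 - cos y\<close> vanishes on both
      sides.\<close>
    have "g (cis y) = h y * of_real (min 1 (real n * (1 - cos y)))"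
    proof (cases "y = 2 * pi")
      case False
      then have "Arg2pi (cis y) = y" using that by (intro Arg2pi_unique[where r=1]) (auto simp: cis_conv_exp)
      then show ?thesis by (simp add: g_def)
    qed (simp add: g_def)
    then show ?thesis using P(2)[of "cis y"] by simp
  qed
  then show thesis using that trig_polynomial_cis[OF P(1)] by blast
qed

section \<open>Density of trigonometric polynomials and uniqueness of Fourier coefficients\<close>

lemma sq_truncate:
  assumes "F \<in> sq M" "0 < e"
  obtains n :: nat where "nrm M (\<lambda>x. F x - (if cmod (F x) \<le> real n then F x else 0)) < e"
proof -
  note [measurable] = sq_meas[OF assms(1)]
  let ?D = "\<lambda>n x. F x - (if cmod (F x) \<le> real n then F x else 0)"
  have "(\<lambda>n. \<integral>x. (cmod (?D n x))\<^sup>2 \<partial>M) \<longlonglongrightarrow> (\<integral>x. 0 \<partial>M)"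
  proof (rule integral_dominated_convergence[where w="\<lambda>x. (cmod (F x))\<^sup>2"])
    show "AE x in M. (\<lambda>n. (cmod (?D n x))\<^sup>2) \<longlonglongrightarrow> 0"
    proof (rule AE_I2)
      fix x
      obtain n0 :: nat where "cmod (F x) \<le> real n0" using real_arch_simple by blast
      then have "\<forall>\<^sub>F n in sequentially. (cmod (?D n x))\<^sup>2 = 0"
        unfolding eventually_sequentially by (intro exI[of _ n0]) auto
      then show "(\<lambda>n. (cmod (?D n x))\<^sup>2) \<longlonglongrightarrow> 0" by (rule tendsto_eventually)
    qed
    show "AE x in M. norm ((cmod (?D n x))\<^sup>2) \<le> (cmod (F x))\<^sup>2" for n by auto
  qed (use sq_integrable[OF assms(1)] in auto)
  then have "(\<lambda>n. nrm M (?D n)) \<longlonglongrightarrow> sqrt 0"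
    unfolding nrm_def by (intro tendsto_real_sqrt) simp
  then have "\<forall>\<^sub>F n in sequentially. nrm M (?D n) < e"
    using assms(2) by (simp add: order_tendsto_iff)
  then show thesis using that eventually_happens by fastforce
qed

text \<open>\<open>F\<close> is an almost everywhere limit of continuous functions on the line.
  Retracting their values radially to the ball of radius \<open>B\<close> gives a constant majorant
  for dominated convergence, and the factor with \<open>1 - cos y\<close> tends to 1 away from the
  endpoints while making them continuous on the circle.\<close>

lemma trig_dense_bounded:
  assumes [measurable]: "F \<in> borel_measurable borel" and B: "\<And>x. cmod (F x) \<le> B" "0 < B" and "0 < e"
  obtains p where "trig p" "nrm circ (\<lambda>y. F y - p y) < e"
proof -
  have Fs: "F \<in> sq circ" by (rule sq_bounded[OF finite_measure_ivl, of F _ _ B]) (use B in auto)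
  have "F \<in> borel_measurable (lebesgue_on UNIV)" by (intro measurable_restrict_space1 measurable_completion) simp
  then have "F measurable_on UNIV" by (simp add: measurable_on_iff_borel_measurable)
  then obtain Z g where Z: "negligible Z" and g: "\<And>n. continuous_on UNIV (g n)"
    and lim: "\<And>x. x \<notin> Z \<Longrightarrow> (\<lambda>n. g n x) \<longlonglongrightarrow> F x"
    unfolding measurable_on_def by auto
  define clip where "clip z = z / of_real (max 1 (cmod z / B))" for z
  have clip_cont: "continuous_on UNIV clip"
    unfolding clip_def using B(2) by (intro continuous_intros) (auto simp: max_def)
  have clip_id: "clip z = z" if "cmod z \<le> B" for z
    using that B(2) by (simp add: clip_def max_def)
  have clip_le: "cmod (clip z) \<le> B" for z
    using B(2) by (auto simp: clip_def max_def norm_divide)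
  define k where "k n y = clip (g n y) * of_real (min 1 (real n * (1 - cos y)))" for n y
  have kc: "continuous_on UNIV (k n)" for n
    unfolding k_def by (intro continuous_intros continuous_on_compose2[OF clip_cont] g) auto
  have [measurable]: "k n \<in> borel_measurable borel" for n by (rule borel_measurable_continuous_onI[OF kc])
  have kB: "cmod (k n y) \<le> B" for n y
  proof -
    have "\<bar>min 1 (real n * (1 - cos y))\<bar> \<le> 1" by (auto simp: min_def)
    then have "cmod (clip (g n y)) * \<bar>min 1 (real n * (1 - cos y))\<bar> \<le> B * 1"
      using B(2) by (intro mult_mono clip_le) auto
    then show ?thesis by (simp add: k_def norm_mult)
  qed
  have klim: "(\<lambda>n. k n y) \<longlonglongrightarrow> F y" if "y \<notin> Z" "cos y < 1" for y
  proof -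
    have "(\<lambda>n. clip (g n y)) \<longlonglongrightarrow> clip (F y)"
      using clip_cont lim[OF that(1)] by (auto simp: continuous_on_eq_continuous_at intro: isCont_tendsto_compose)
    moreover have "\<forall>\<^sub>F n in sequentially. k n y = clip (g n y)"
    proof -
      obtain n0 :: nat where n0: "1 / (1 - cos y) \<le> real n0" using real_arch_simple by blast
      have "1 \<le> real n * (1 - cos y)" if "n0 \<le> n" for n
      proof -
        have "1 / (1 - cos y) \<le> real n" using n0 that by linarith
        then show ?thesis using \<open>cos y < 1\<close> by (simp add: field_simps)
      qed
      then show ?thesis unfolding eventually_sequentially k_def by (intro exI[of _ n0]) (auto simp: min_def)
    qed
    ultimately show ?thesis
      using tendsto_cong[of "\<lambda>n. k n y" "\<lambda>n. clip (g n y)" sequentially "F y"] by (simp add: clip_id B)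
  qed
  have "AE y in circ. y \<notin> Z \<and> cos y < 1"
  proof -
    have "AE y in lborel. y \<notin> Z"
    proof -
      have "AE y in lebesgue. y \<notin> Z" using Z by (intro AE_not_in) (simp add: negligible_iff_null_sets)
      then show ?thesis by (simp only: AE_completion_iff)
    qed
    moreover have "AE y in lborel. y \<notin> {0, 2 * pi}"
      by (rule AE_not_in) (auto intro: countable_imp_null_set_lborel)
    ultimately show ?thesis unfolding AE_ivl
    proof eventually_elim
      case (elim y)
      show ?case
      proof (intro impI conjI)
        assume y: "y \<in> {0..2*pi}"
        have "cos y \<noteq> 1"
        proof
          assume "cos y = 1"
          then obtain m :: int where m: "y = of_int m * 2 * pi" by (auto simp: cos_one_2pi_int)
          have "0 < y" "y < 2 * pi" using y elim by auto
          then have "0 * (2 * pi) < of_int m * (2 * pi)" "of_int m * (2 * pi) < 1 * (2 * pi)"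
            unfolding m mult.assoc by simp_all
          then have "0 < m" "m < 1" unfolding mult_less_cancel_right by auto
          then show False by simp
        qed
        then show "cos y < 1" using cos_le_one[of y] by linarith
      qed (use elim in auto)
    qed
  qed
  then have "(\<lambda>n. \<integral>y. (cmod (F y - k n y))\<^sup>2 \<partial>circ) \<longlonglongrightarrow> (\<integral>y. 0 \<partial>circ)"
  proof (intro integral_dominated_convergence[where w="\<lambda>y. (2 * B)\<^sup>2"])
    assume "AE y in circ. y \<notin> Z \<and> cos y < 1"
    then show "AE y in circ. (\<lambda>n. (cmod (F y - k n y))\<^sup>2) \<longlonglongrightarrow> 0"
    proof eventually_elim
      case (elim y)
      then have "(\<lambda>n. (cmod (F y - k n y))\<^sup>2) \<longlonglongrightarrow> (cmod (F y - F y))\<^sup>2"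
        by (intro tendsto_intros klim) auto
      then show ?case by simp
    qed
    show "AE y in circ. norm ((cmod (F y - k n y))\<^sup>2) \<le> (2 * B)\<^sup>2" for n
    proof (rule AE_I2)
      fix y
      have "cmod (F y - k n y) \<le> 2 * B" using norm_triangle_ineq4[of "F y" "k n y"] B(1)[of y] kB[of n y] by linarith
      then have "(cmod (F y - k n y))\<^sup>2 \<le> (2 * B)\<^sup>2" by (intro power_mono) auto
      then show "norm ((cmod (F y - k n y))\<^sup>2) \<le> (2 * B)\<^sup>2" by simp
    qed
  qed auto
  then have "(\<lambda>n. nrm circ (\<lambda>y. F y - k n y)) \<longlonglongrightarrow> sqrt 0"
    unfolding nrm_def by (intro tendsto_real_sqrt) simp
  then have "\<forall>\<^sub>F n in sequentially. nrm circ (\<lambda>y. F y - k n y) < e / 2"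
    using \<open>0 < e\<close> by (intro order_tendstoD(2)) auto
  then obtain n where n: "nrm circ (\<lambda>y. F y - k n y) < e / 2"
    using eventually_happens by fastforce
  \<comment> \<open>The circle has length below 9, so a pointwise error \<open>e / 6\<close> costs
    at most \<open>e / 2\<close> in the norm.\<close>
  define e' where "e' = e / 6"
  obtain p where p: "trig p" "\<And>y. y \<in> {0..2*pi} \<Longrightarrow> cmod (k n y - p y) < e'"
  proof (rule trig_approx_continuous[of "\<lambda>y. clip (g n y)" B e' n])
    show "continuous_on UNIV (\<lambda>y. clip (g n y))"
      by (intro continuous_on_compose2[OF clip_cont] g) auto
  qed (use clip_le \<open>0 < e\<close> in \<open>auto simp: k_def e'_def\<close>)
  have pc: "continuous_on UNIV p" by (rule trig_continuous[OF p(1)])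
  have "(\<integral>y. (cmod (k n y - p y))\<^sup>2 \<partial>circ) \<le> (2 * pi - 0) * e'\<^sup>2"
  proof (rule integral_ivl_bounds)
    show "integrable circ (\<lambda>y. (cmod (k n y - p y))\<^sup>2)"
      by (intro integrable_ivl_continuous continuous_intros kc pc)
    show "(\<lambda>y. (cmod (k n y - p y))\<^sup>2) \<in> borel_measurable borel"
      by (intro borel_measurable_continuous_onI continuous_intros kc pc)
    show "(cmod (k n y - p y))\<^sup>2 \<le> e'\<^sup>2" if "0 \<le> y" "y \<le> 2 * pi" for y
      using p(2)[of y] that by (intro power_mono) auto
  qed auto
  also have "\<dots> \<le> 9 * e'\<^sup>2" using pi_less_4 by (intro mult_right_mono) auto
  also have "\<dots> = (e / 2)\<^sup>2" by (simp add: e'_def power2_eq_square)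
  finally have "nrm circ (\<lambda>y. k n y - p y) \<le> e / 2"
    using \<open>0 < e\<close> sq_diff[OF sq_ivl_continuous[OF kc] sq_ivl_continuous[OF pc], THEN sq_integrable]
    by (intro nrm_bound) auto
  moreover have "nrm circ (\<lambda>y. (F y - k n y) + (k n y - p y)) \<le> nrm circ (\<lambda>y. F y - k n y) + nrm circ (\<lambda>y. k n y - p y)"
    by (intro nrm_triangle sq_diff Fs sq_ivl_continuous kc pc)
  ultimately have "nrm circ (\<lambda>y. F y - p y) < e" using n by simp
  then show thesis using that p(1) by blast
qed

lemma trig_dense:
  assumes "F \<in> sq circ" "0 < e"
  obtains p where "trig p" "nrm circ (\<lambda>y. F y - p y) < e"
proof -
  have Fm [measurable]: "F \<in> borel_measurable borel" using sq_meas[OF assms(1)] by simp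
  obtain n :: nat where n: "nrm circ (\<lambda>x. F x - (if cmod (F x) \<le> real n then F x else 0)) < e / 2"
    using sq_truncate[OF assms(1), of "e / 2"] \<open>0 < e\<close> by auto
  let ?F = "\<lambda>x. if cmod (F x) \<le> real n then F x else 0"
  obtain p where p: "trig p" "nrm circ (\<lambda>y. ?F y - p y) < e / 2"
    by (rule trig_dense_bounded[of ?F "real n + 1" "e / 2"]) (use \<open>0 < e\<close> in auto)
  have Fs: "?F \<in> sq circ" by (rule sq_bounded[OF finite_measure_ivl, of _ _ _ "real n"]) auto
  have "nrm circ (\<lambda>y. (F y - ?F y) + (?F y - p y)) \<le> nrm circ (\<lambda>y. F y - ?F y) + nrm circ (\<lambda>y. ?F y - p y)"
    by (intro nrm_triangle sq_diff Fs assms sq_ivl_continuous trig_continuous p)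
  then have "nrm circ (\<lambda>y. F y - p y) < e" using n p(2) by simp
  then show thesis using that p(1) by blast
qed

text \<open>Since \<open>F\<close> integrates to zero against every trigonometric polynomial, an
  approximation \<open>p\<close> of \<open>cnj F\<close> can be subtracted for free in the integral
  of \<open>F * cnj F\<close>. Cauchy--Schwarz then bounds the square of the norm by the norm times
  an arbitrary \<open>e\<close>.\<close>

lemma fourier_unique:
  assumes F: "F \<in> sq circ" and zero: "\<And>m::int. (\<integral>y. F y * cis (of_int m * y) \<partial>circ) = 0"
  shows "AE y in circ. F y = 0"
proof -
  have orth: "(\<integral>y. F y * p y \<partial>circ) = 0" if "trig p" for p
    using that
  proof induction
    case (mono c m)
    have "(\<integral>y. F y * (c * cis (of_int m * y)) \<partial>circ) = c * (\<integral>y. F y * cis (of_int m * y) \<partial>circ)"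
      by (subst integral_mult_right_zero[symmetric]) (simp add: mult.left_commute)
    then show ?case by (simp add: zero)
  next
    case (add p q)
    have "integrable circ (\<lambda>y. F y * p y)" "integrable circ (\<lambda>y. F y * q y)"
      using add.hyps by (auto intro!: sq_prod_integrable F sq_ivl_continuous trig_continuous)
    then show ?case using add.IH by (simp add: distrib_left)
  qed
  have "nrm circ F \<le> 0"
  proof (rule field_le_epsilon)
    fix e :: real assume e: "0 < e"
    obtain p where p: "trig p" "nrm circ (\<lambda>y. cnj (F y) - p y) < e"
      using trig_dense[OF sq_conj[OF F] e] .
    have ps: "p \<in> sq circ" by (intro sq_ivl_continuous trig_continuous p)
    have "complex_of_real ((nrm circ F)\<^sup>2) = (\<integral>y. F y * cnj (F y) \<partial>circ)"
      unfolding nrm_power2 complex_norm_square[symmetric]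
      by (rule integral_of_real[symmetric, OF sq_integrable[OF F]])
    also have "\<dots> = (\<integral>y. F y * (cnj (F y) - p y) \<partial>circ)"
      using orth[OF p(1)] sq_prod_integrable[OF F sq_conj[OF F]] sq_prod_integrable[OF F ps]
      by (simp add: right_diff_distrib)
    finally have eq: "complex_of_real ((nrm circ F)\<^sup>2) = (\<integral>y. F y * (cnj (F y) - p y) \<partial>circ)" .
    have "(nrm circ F)\<^sup>2 = cmod (\<integral>y. F y * (cnj (F y) - p y) \<partial>circ)"
      unfolding eq[symmetric] norm_of_real by simp
    also have "\<dots> \<le> nrm circ F * nrm circ (\<lambda>y. cnj (F y) - p y)"
      by (intro cmod_integral_mult_le F sq_diff sq_conj ps)
    also have "\<dots> \<le> nrm circ F * e" using p(2) by (intro mult_left_mono) auto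
    finally have le: "nrm circ F * nrm circ F \<le> nrm circ F * e" by (simp only: power2_eq_square)
    show "nrm circ F \<le> 0 + e"
    proof (cases "nrm circ F = 0")
      case False
      then have "0 < nrm circ F" using nrm_nonneg[of circ F] by linarith
      then show ?thesis using le by simp
    qed (use e in simp)
  qed
  then have "nrm circ F = 0" using nrm_nonneg[of circ F] by linarith
  then show ?thesis using nrm_eq_0[OF F] by blast
qed

section \<open>From the weak equation to a classical derivative\<close>

lemma continuous_indefinite_integral:
  fixes H :: "real \<Rightarrow> complex"
  assumes H: "integrable M H" and sets: "sets M = sets borel" and null: "\<And>y. AE s in M. s \<noteq> y"
  shows "continuous_on UNIV (\<lambda>y. \<integral>s. indicator {..y} s *\<^sub>R H s \<partial>M)"
  unfolding continuous_on_eq_continuous_at[OF open_UNIV] continuous_at_sequentially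
proof (intro ballI allI impI)
  note [measurable_cong] = sets
  have [measurable]: "H \<in> borel_measurable M" using H by auto
  fix y :: real and X :: "nat \<Rightarrow> real" assume X: "X \<longlonglongrightarrow> y"
  show "((\<lambda>y. \<integral>s. indicator {..y} s *\<^sub>R H s \<partial>M) \<circ> X) \<longlonglongrightarrow> (\<integral>s. indicator {..y} s *\<^sub>R H s \<partial>M)"
    unfolding o_def
  proof (rule integral_dominated_convergence[where w="\<lambda>s. norm (H s)"])
    show "AE s in M. (\<lambda>n. indicator {..X n} s *\<^sub>R H s) \<longlonglongrightarrow> indicator {..y} s *\<^sub>R H s"
      using null[of y]
    proof eventually_elim
      case (elim s)
      have "\<forall>\<^sub>F n in sequentially. indicat_real {..X n} s = indicat_real {..y} s"
      proof (cases "s < y")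
        case True
        then have "\<forall>\<^sub>F n in sequentially. s < X n" using X by (simp add: order_tendsto_iff)
        then show ?thesis by eventually_elim (use True in auto)
      next
        case False
        then have "\<forall>\<^sub>F n in sequentially. X n < s" using X elim by (simp add: order_tendsto_iff)
        then show ?thesis by eventually_elim (use False elim in auto)
      qed
      then have "\<forall>\<^sub>F n in sequentially. indicator {..X n} s *\<^sub>R H s = indicator {..y} s *\<^sub>R H s"
        by eventually_elim simp
      then show ?case by (rule tendsto_eventually)
    qed
    show "AE s in M. norm (indicator {..X n} s *\<^sub>R H s) \<le> norm (H s)" for n
      by (auto split: split_indicator)
  qed (use H in auto)
qed

lemma AE_ivl_neq: "AE s in ivl a b. s \<noteq> y"
  unfolding AE_ivl using AE_lborel_singleton[of y] by eventually_elim simp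

lemma cis_deriv:
  "((\<lambda>y. cis (c * y)) has_vector_derivative (\<i> * of_real c) * cis (c * x)) (at x)"
  unfolding has_vector_derivative_complex_iff
  by (auto intro!: derivative_eq_intros)

lemma continuous_cis: "continuous_on UNIV (\<lambda>y. cis (c * y))"
  by (intro continuous_intros)

lemma cis_circ_end: "cis (real_of_int m * (2 * pi)) = 1"
  using cis_multiple_2pi[of "of_int m"] by (simp add: mult.commute mult.left_commute)

text \<open>A function whose second derivative in the sense of periodic distributions is \<open>H\<close>: testing against
  exponentials is enough to identify it with the periodic second antiderivative of \<open>H\<close>.\<close>

lemma periodic_regularity:
  assumes F: "F \<in> sq circ" and H: "H \<in> sq circ"
    and weak: "\<And>m::int. (\<integral>y. F y * (- (of_int m)\<^sup>2 * cis (of_int m * y)) \<partial>circ) = (\<integral>y. H y * cis (of_int m * y) \<partial>circ)"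
  obtains f V where "\<And>y. (f has_vector_derivative V y) (at y)" "continuous_on UNIV V"
    "AE y in circ. F y = f y"
    "\<And>y. V y = V 0 + (\<integral>s. indicator {..y} s *\<^sub>R H s \<partial>circ)"
    "(\<integral>y. H y * cnj (f y) \<partial>circ) = - of_real ((nrm circ V)\<^sup>2)"
proof -
  have Hi: "integrable circ H" by (rule sq_integrable1[OF finite_measure_ivl H])
  define V0 where "V0 y = (\<integral>s. indicator {..y} s *\<^sub>R H s \<partial>circ)" for y
  have V0c: "continuous_on UNIV V0"
    unfolding V0_def[abs_def] by (intro continuous_indefinite_integral Hi AE_ivl_neq) simp
  \<comment> \<open>The frequency \<open>m = 0\<close> of \<open>weak\<close> says that
    \<open>H\<close> has mean zero, which is what removes the boundary term when integrating by
    parts against a periodic function.\<close>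
  have H0: "integral\<^sup>L circ H = 0" using weak[of 0] by simp
  have V00: "V0 0 = 0"
  proof -
    have "V0 0 = (\<integral>s. 0 \<partial>circ)" unfolding V0_def
    proof (rule integral_cong_AE)
      show "AE s in circ. indicat_real {..0} s *\<^sub>R H s = 0"
        unfolding AE_ivl using AE_lborel_singleton[of "0::real"] by eventually_elim auto
    qed (use Hi in auto)
    then show ?thesis by simp
  qed
  have "\<exists>W. \<forall>x. - \<infinity> < ereal x \<longrightarrow> ereal x < \<infinity> \<longrightarrow> (W has_vector_derivative V0 x) (at x)"
    by (rule einterval_antiderivative) (use V0c in \<open>auto simp: continuous_on_eq_continuous_at\<close>)
  then obtain W0 where W0: "\<And>y. (W0 has_vector_derivative V0 y) (at y)" by auto
  \<comment> \<open>The mean of \<open>V0\<close>; subtracting it makes the next antiderivative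
    periodic.\<close>
  define c where "c = (W0 (2 * pi) - W0 0) / (2 * pi)"
  define V where "V y = V0 y - c" for y
  define W where "W y = W0 y - of_real y * c" for y
  have Wd: "(W has_vector_derivative V y) (at y)" for y
  proof -
    have "((\<lambda>y. y *\<^sub>R c) has_vector_derivative c) (at y)"
      by (auto intro!: derivative_eq_intros simp: has_vector_derivative_def)
    from has_vector_derivative_diff[OF W0[of y] this] show ?thesis
      by (simp add: W_def[abs_def] V_def scaleR_conv_of_real)
  qed
  have Vc: "continuous_on UNIV V" unfolding V_def[abs_def] by (intro continuous_intros V0c)
  have Wc: "continuous_on UNIV W"
    using Wd by (auto simp: continuous_on_eq_continuous_at intro: has_vector_derivative_continuous)
  have Wper: "W (2 * pi) = W 0" by (simp add: W_def c_def)
  have Vsq: "V \<in> sq circ" and Wsq: "W \<in> sq circ" by (intro sq_ivl_continuous Vc Wc)+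
  have Vby: "(\<integral>y. V y * \<phi> y \<partial>circ) = - (\<integral>s. H s * \<Phi> s \<partial>circ)"
    if \<Phi>: "\<And>x. (\<Phi> has_vector_derivative \<phi> x) (at x)" and \<phi>: "continuous_on UNIV \<phi>" and per: "\<Phi> (2 * pi) = \<Phi> 0"
    for \<Phi> \<phi>
  proof -
    have sq: "\<phi> \<in> sq circ" "V0 \<in> sq circ" by (intro sq_ivl_continuous \<phi> V0c)+
    have "(\<integral>y. V y * \<phi> y \<partial>circ) = (\<integral>y. V0 y * \<phi> y \<partial>circ) - c * (\<integral>y. \<phi> y \<partial>circ)"
      using sq_prod_integrable[OF sq(2,1)] sq_integrable1[OF finite_measure_ivl sq(1)]
      by (simp add: V_def left_diff_distrib)
    also have "(\<integral>y. \<phi> y \<partial>circ) = 0"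
      using integral_ivl_FTC[OF _ \<Phi> \<phi>, of 0 "2 * pi"] per by simp
    also have "(\<integral>y. V0 y * \<phi> y \<partial>circ) = - (\<integral>s. H s * \<Phi> s \<partial>circ)"
      unfolding V0_def using integral_ivl_by_parts[OF _ Hi \<Phi> \<phi>] H0 by simp
    finally show ?thesis by simp
  qed
  \<comment> \<open>Two integrations by parts show that \<open>W\<close> satisfies the same weak
    equation as \<open>F\<close>. The common factor \<open>m^2\<close> can be divided out exactly
    when \<open>m\<close> is nonzero.\<close>
  have coef: "(\<integral>y. (F y - W y) * cis (of_int m * y) \<partial>circ) = 0" if "m \<noteq> 0" for m :: int
  proof -
    let ?e = "\<lambda>y. cis (of_int m * y)" and ?i = "\<i> * of_real (of_int m)"
    have e: "((\<lambda>y. ?e y) has_vector_derivative ?i * ?e x) (at x)" for x by (rule cis_deriv)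
    have ec: "continuous_on UNIV ?e" by (rule continuous_cis)
    have es: "?e \<in> sq circ" by (intro sq_ivl_continuous ec)
    have ies: "(\<lambda>y. ?i * ?e y) \<in> sq circ" by (intro sq_cmult es)
    have "(\<integral>y. V y * (?i * ?e y) \<partial>circ) = - (\<integral>s. H s * ?e s \<partial>circ)"
      by (rule Vby[OF e]) (auto intro!: continuous_intros ec simp: cis_circ_end)
    moreover have "(\<integral>y. V y * (?i * ?e y) + W y * (?i * (?i * ?e y)) \<partial>circ) = 0"
    proof -
      have "((\<lambda>y. W y * (?i * ?e y)) has_vector_derivative (V y * (?i * ?e y) + W y * (?i * (?i * ?e y)))) (at y)" for y
        using has_vector_derivative_mult[OF Wd[of y] has_vector_derivative_mult[OF has_vector_derivative_const[of ?i] e[of y]]]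
        by (simp add: add.commute)
      then have "(\<integral>y. V y * (?i * ?e y) + W y * (?i * (?i * ?e y)) \<partial>circ)
          = W (2 * pi) * (?i * ?e (2 * pi)) - W 0 * (?i * ?e 0)"
        by (intro integral_ivl_FTC) (auto intro!: continuous_intros Vc Wc)
      then show ?thesis by (simp add: Wper cis_circ_end)
    qed
    moreover have "integrable circ (\<lambda>y. V y * (?i * ?e y))" "integrable circ (\<lambda>y. W y * (?i * (?i * ?e y)))"
      by (intro sq_prod_integrable Vsq Wsq sq_cmult es)+
    ultimately have "(\<integral>y. W y * (?i * (?i * ?e y)) \<partial>circ) = (\<integral>s. H s * ?e s \<partial>circ)"
      by simp
    also have "(\<lambda>y. W y * (?i * (?i * ?e y))) = (\<lambda>y. W y * (- (of_int m)\<^sup>2 * ?e y))"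
      by (auto simp: power2_eq_square algebra_simps)
    finally have "(\<integral>y. F y * (- (of_int m)\<^sup>2 * ?e y) \<partial>circ) - (\<integral>y. W y * (- (of_int m)\<^sup>2 * ?e y) \<partial>circ) = 0"
      using weak[of m] by simp
    moreover have "(\<integral>y. F y * (- (of_int m)\<^sup>2 * ?e y) \<partial>circ) - (\<integral>y. W y * (- (of_int m)\<^sup>2 * ?e y) \<partial>circ)
       = (\<integral>y. F y * (- (of_int m)\<^sup>2 * ?e y) - W y * (- (of_int m)\<^sup>2 * ?e y) \<partial>circ)"
      by (intro Bochner_Integration.integral_diff[symmetric] sq_prod_integrable F Wsq sq_cmult es)
    moreover have "(\<lambda>y. F y * (- (of_int m)\<^sup>2 * ?e y) - W y * (- (of_int m)\<^sup>2 * ?e y)) = (\<lambda>y. - (of_int m)\<^sup>2 * ((F y - W y) * ?e y))"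
      by (auto simp: algebra_simps)
    ultimately have "- (of_int m)\<^sup>2 * (\<integral>y. (F y - W y) * ?e y \<partial>circ) = 0"
      by (simp only: integral_mult_right_zero)
    then show ?thesis using that by simp
  qed
  \<comment> \<open>The weak equation does not see the constant mode of \<open>F\<close>, so
    \<open>W\<close> is correct up to an additive constant.\<close>
  define d where "d = (\<integral>y. F y - W y \<partial>circ) / (2 * pi)"
  have FWs: "(\<lambda>y. F y - W y) \<in> sq circ" by (intro sq_diff F Wsq)
  have FWd: "(\<lambda>y. F y - W y - d) \<in> sq circ"
    by (intro sq_diff FWs F Wsq sq_ivl_continuous continuous_intros)
  have "AE y in circ. F y - W y - d = 0"
  proof (rule fourier_unique[OF FWd])
    fix m :: int
    have es: "(\<lambda>y. cis (of_int m * y)) \<in> sq circ" by (intro sq_ivl_continuous continuous_cis)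
    have "(\<integral>y. (F y - W y - d) * cis (of_int m * y) \<partial>circ)
       = (\<integral>y. (F y - W y) * cis (of_int m * y) - d * cis (of_int m * y) \<partial>circ)"
      by (simp add: left_diff_distrib)
    also have "\<dots> = (\<integral>y. (F y - W y) * cis (of_int m * y) \<partial>circ) - d * (\<integral>y. cis (of_int m * y) \<partial>circ)"
      using sq_prod_integrable[OF FWs es] sq_integrable1[OF finite_measure_ivl es] by simp
    also have "\<dots> = 0"
    proof (cases "m = 0")
      case True
      have "measure circ UNIV = 2 * pi" using measure_ivl[of 0 "2 * pi"] by simp
      then show ?thesis using True by (simp add: d_def scaleR_conv_of_real)
    next
      case False
      have "(\<integral>y. (\<i> * of_real (of_int m)) * cis (of_int m * y) \<partial>circ) = 0"
        using integral_ivl_FTC[of 0 "2 * pi", OF _ cis_deriv[of "of_int m"]]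
        by (simp add: cis_circ_end continuous_on_mult_left continuous_cis)
      then have "(\<integral>y. cis (of_int m * y) \<partial>circ) = 0" using False by simp
      then show ?thesis using coef[OF False] by simp
    qed
    finally show "(\<integral>y. (F y - W y - d) * cis (of_int m * y) \<partial>circ) = 0" .
  qed
  then have AE: "AE y in circ. F y = W y + d" by eventually_elim (simp add: algebra_simps)
  have der: "((\<lambda>y. W y + d) has_vector_derivative V y) (at y)" for y
    using has_vector_derivative_add[OF Wd has_vector_derivative_const[of d]] by simp
  have Vform: "V y = V 0 + (\<integral>s. indicator {..y} s *\<^sub>R H s \<partial>circ)" for y
    by (simp add: V_def V00 V0_def[symmetric])
  \<comment> \<open>The energy identity: in \<open>Vby\<close> the conjugate of the function itself
    serves as test function.\<close>
  have "(\<integral>y. V y * cnj (V y) \<partial>circ) = - (\<integral>s. H s * cnj (W s + d) \<partial>circ)"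
    using has_vector_derivative_cnj[OF der] by (intro Vby) (auto intro!: continuous_intros Vc simp: Wper)
  moreover have "(\<integral>y. V y * cnj (V y) \<partial>circ) = of_real ((nrm circ V)\<^sup>2)"
    unfolding nrm_power2 complex_norm_square[symmetric] by (rule integral_of_real[OF sq_integrable[OF Vsq]])
  ultimately have "(\<integral>y. H y * cnj (W y + d) \<partial>circ) = - of_real ((nrm circ V)\<^sup>2)" by simp
  with der Vc AE Vform show thesis by (rule that)
qed

section \<open>A local estimate\<close>

lemma cmod_add3_sq_le: "(cmod (a - b - c))\<^sup>2 \<le> 3 * (cmod a)\<^sup>2 + 3 * (cmod b)\<^sup>2 + 3 * (cmod c)\<^sup>2"
proof -
  have "cmod (a - b - c) \<le> cmod a + cmod b + cmod c"
    using norm_triangle_ineq4[of "a - b" c] norm_triangle_ineq4[of a b] by linarith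
  then have "(cmod (a - b - c))\<^sup>2 \<le> (cmod a + cmod b + cmod c)\<^sup>2" by (intro power_mono) auto
  also have "\<dots> \<le> 3 * (cmod a)\<^sup>2 + 3 * (cmod b)\<^sup>2 + 3 * (cmod c)\<^sup>2"
    using sum_squares_bound[of "cmod a" "cmod b"] sum_squares_bound[of "cmod b" "cmod c"]
      sum_squares_bound[of "cmod a" "cmod c"] by (simp add: power2_eq_square algebra_simps)
  finally show ?thesis .
qed

lemma integral_ivl_indicator_FTC:
  fixes f :: "real \<Rightarrow> 'b :: euclidean_space"
  assumes "a \<le> y" "y \<le> b" "\<And>x. (F has_vector_derivative f x) (at x)" "continuous_on UNIV f"
  shows "(\<integral>s. indicator {..y} s *\<^sub>R f s \<partial>ivl a b) = F y - F a"
proof -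
  have [measurable]: "f \<in> borel_measurable borel" by (rule borel_measurable_continuous_onI[OF assms(4)])
  have "(\<integral>s. indicator {..y} s *\<^sub>R f s \<partial>ivl a b) = integral\<^sup>L (ivl a y) f"
    using assms(1,2)
    by (subst (1 2) integral_ivl)
      (auto simp: set_lebesgue_integral_def intro!: Bochner_Integration.integral_cong split: split_indicator)
  also have "\<dots> = F y - F a" by (rule integral_ivl_FTC[OF assms(1,3,4)])
  finally show ?thesis .
qed

lemma integral_norm_le_nrm:
  assumes "a \<le> b" "f \<in> sq (ivl a b)"
  shows "(\<integral>x. cmod (f x) \<partial>ivl a b) \<le> sqrt (b - a) * nrm (ivl a b) f"
proof -
  have 1: "(\<lambda>x. 1) \<in> sq (ivl a b)" by (intro sq_ivl_continuous continuous_intros)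
  have "nrm (ivl a b) (\<lambda>x. 1) = sqrt (b - a)" using measure_ivl[OF assms(1)] by (simp add: nrm_def)
  then show ?thesis using Cauchy_Schwarz_nrm[OF 1 assms(2)] by simp
qed

text \<open>With \<open>\<psi>\<close> the mean-zero antiderivative of \<open>U\<close>, the function \<open>\<psi> f + (i \<nu> / k) f'\<close> is
  nearly constant, because its derivative \<open>\<psi> f' + (i / k) P\<close> does not involve \<open>U\<close>. When \<open>f\<close> is nearly constant too, the
  size of \<open>\<psi>\<close> bounds \<open>f\<close>.\<close>

lemma local_estimate:
  fixes f V H P :: "real \<Rightarrow> complex" and U \<psi> :: "real \<Rightarrow> real"
  assumes ab: "a < b" and k: "k \<noteq> 0" and r: "0 < r"
    and f: "\<And>y. (f has_vector_derivative V y) (at y)" and V: "continuous_on UNIV V"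
    and H: "integrable (ivl a b) H"
    and VH: "\<And>y. y \<in> {a..b} \<Longrightarrow> V y = V a + (\<integral>s. indicator {..y} s *\<^sub>R H s \<partial>ivl a b)"
    and P: "P \<in> sq (ivl a b)"
    and eq: "AE y in ivl a b. of_real \<nu> * H y = \<i> * of_real (k * U y) * f y + P y"
    and \<psi>: "\<And>y. (\<psi> has_real_derivative U y) (at y)" and U: "continuous_on UNIV U"
    and mean: "(\<integral>y. \<psi> y \<partial>ivl a b) = 0"
    and low: "r\<^sup>2 * (b - a) ^ 3 \<le> (\<integral>y. (\<psi> y)\<^sup>2 \<partial>ivl a b)"
  shows "(\<integral>y. (cmod (f y))\<^sup>2 \<partial>ivl a b) \<le> 12 / (k * r)\<^sup>2 * (\<integral>y. (cmod (P y))\<^sup>2 \<partial>ivl a b)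
    + (20 * (b - a)\<^sup>2 + 6 * \<nu>\<^sup>2 / (k * (b - a) * r)\<^sup>2) * (\<integral>y. (cmod (V y))\<^sup>2 \<partial>ivl a b)"
proof -
  let ?M = "ivl a b"
  define d where "d = b - a"
  define p2 where "p2 = (\<integral>y. (cmod (P y))\<^sup>2 \<partial>?M)"
  define v2 where "v2 = (\<integral>y. (cmod (V y))\<^sup>2 \<partial>?M)"
  define m2 where "m2 = (\<integral>y. (\<psi> y)\<^sup>2 \<partial>?M)"
  have d0: "0 < d" using ab by (simp add: d_def)
  have fc: "continuous_on UNIV f"
    using f by (auto simp: continuous_on_eq_continuous_at intro: has_vector_derivative_continuous)
  have \<psi>c: "continuous_on UNIV \<psi>"
    using \<psi> by (auto simp: continuous_on_eq_continuous_at intro: DERIV_isCont)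
  have \<psi>s: "(\<lambda>y. complex_of_real (\<psi> y)) \<in> sq ?M" by (intro sq_ivl_continuous continuous_intros \<psi>c)
  have Vs: "V \<in> sq ?M" by (intro sq_ivl_continuous V)
  have nV: "(nrm ?M V)\<^sup>2 = v2" and nP: "(nrm ?M P)\<^sup>2 = p2" and nps: "(nrm ?M (\<lambda>y. complex_of_real (\<psi> y)))\<^sup>2 = m2"
    by (simp_all add: nrm_power2 v2_def p2_def m2_def)
  have mu: "measure ?M UNIV = d" using measure_ivl[of a b] ab by (simp add: d_def)
  have m2: "r\<^sup>2 * d ^ 3 \<le> m2" using low by (simp add: m2_def d_def)
  have m20: "0 < m2" using m2 r d0 by (meson mult_pos_pos order_less_le_trans zero_less_power)
  have p20: "0 \<le> p2" and v20: "0 \<le> v2" by (simp_all add: p2_def v2_def)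
  define c where "c = f a"
  define Z where "Z y = of_real (\<psi> y) * f y + \<i> * of_real (\<nu> / k) * V y" for y
  have fc_bound: "(cmod (f y - c))\<^sup>2 \<le> d * v2" if y: "y \<in> {a..b}" for y
  proof -
    have "f y - c = (\<integral>s. indicator {..y} s *\<^sub>R V s \<partial>?M)"
      unfolding c_def using y by (intro integral_ivl_indicator_FTC[symmetric] f V) auto
    then have "cmod (f y - c) \<le> (\<integral>s. cmod (indicator {..y} s *\<^sub>R V s) \<partial>?M)"
      using integral_norm_bound[of ?M "\<lambda>s. indicator {..y} s *\<^sub>R V s"] by simp
    also have "\<dots> \<le> (\<integral>s. cmod (V s) \<partial>?M)"
      by (intro integral_mono' integrable_norm integrable_ivl_continuous V) (auto split: split_indicator)
    also have "\<dots> \<le> sqrt d * nrm ?M V" using integral_norm_le_nrm[OF _ Vs] ab by (simp add: d_def)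
    finally have "(cmod (f y - c))\<^sup>2 \<le> (sqrt d * nrm ?M V)\<^sup>2" by (intro power_mono) auto
    then show ?thesis using d0 by (simp add: power_mult_distrib nV)
  qed
  have Z_bound: "(cmod (Z y - Z a))\<^sup>2 \<le> 2 * d * p2 / k\<^sup>2 + 2 * m2 * v2" if y: "y \<in> {a..b}" for y
  proof -
    define Q where "Q s = of_real (U s) * f s + of_real (\<psi> s) * V s" for s
    have Qc: "continuous_on UNIV Q" unfolding Q_def by (intro continuous_intros U fc \<psi>c V)
    have Q: "((\<lambda>s. of_real (\<psi> s) * f s) has_vector_derivative Q s) (at s)" for s
      using has_vector_derivative_mult[OF has_vector_derivative_of_real[OF \<psi>[of s]] f[of s]]
      by (simp add: Q_def add.commute)
    have iQ: "integrable ?M Q" by (intro integrable_ivl_continuous Qc)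
    have "Z y - Z a = (\<integral>s. indicator {..y} s *\<^sub>R Q s \<partial>?M) + \<i> * of_real (\<nu> / k) * (\<integral>s. indicator {..y} s *\<^sub>R H s \<partial>?M)"
      using integral_ivl_indicator_FTC[OF _ _ Q Qc, of a y b] VH[OF y] y by (simp add: Z_def algebra_simps)
    also have "\<dots> = (\<integral>s. indicator {..y} s *\<^sub>R Q s + \<i> * of_real (\<nu> / k) * (indicator {..y} s *\<^sub>R H s) \<partial>?M)"
    proof -
      have 1: "integrable ?M (\<lambda>s. indicator {..y} s *\<^sub>R Q s)" and 2: "integrable ?M (\<lambda>s. indicator {..y} s *\<^sub>R H s)"
        using integrable_mult_indicator[OF _ iQ, of "{..y}"] integrable_mult_indicator[OF _ H, of "{..y}"] by simp_all
      show ?thesis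
        unfolding Bochner_Integration.integral_add[OF 1 integrable_mult_right[OF 2]] integral_mult_right_zero ..
    qed
    also have "\<dots> = (\<integral>s. indicator {..y} s *\<^sub>R (of_real (\<psi> s) * V s + \<i> / of_real k * P s) \<partial>?M)"
    proof (rule integral_cong_AE)
      have [measurable]: "Q \<in> borel_measurable borel" "V \<in> borel_measurable borel" "\<psi> \<in> borel_measurable borel"
        by (intro borel_measurable_continuous_onI Qc V \<psi>c)+
      have [measurable]: "H \<in> borel_measurable borel" using H by auto
      have [measurable]: "P \<in> borel_measurable borel" using sq_meas[OF P] by simp
      show "(\<lambda>s. indicator {..y} s *\<^sub>R Q s + \<i> * of_real (\<nu> / k) * (indicator {..y} s *\<^sub>R H s)) \<in> borel_measurable ?M"
        "(\<lambda>s. indicator {..y} s *\<^sub>R (of_real (\<psi> s) * V s + \<i> / of_real k * P s)) \<in> borel_measurable ?M"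
        by measurable
      show "AE s in ?M. indicator {..y} s *\<^sub>R Q s + \<i> * of_real (\<nu> / k) * (indicator {..y} s *\<^sub>R H s)
          = indicator {..y} s *\<^sub>R (of_real (\<psi> s) * V s + \<i> / of_real k * P s)"
        using eq
      proof eventually_elim
        case (elim s)
        have "\<i> * of_real (\<nu> / k) * H s = \<i> / of_real k * (of_real \<nu> * H s)" by simp
        also have "\<dots> = - (of_real (U s) * f s) + \<i> / of_real k * P s"
          unfolding elim using k by (simp add: field_simps)
        finally show ?case by (simp add: Q_def split: split_indicator)
      qed
    qed
    finally have Zeq: "Z y - Z a = (\<integral>s. indicator {..y} s *\<^sub>R (of_real (\<psi> s) * V s + \<i> / of_real k * P s) \<partial>?M)" .
    have "cmod (Z y - Z a) \<le> (\<integral>s. cmod (indicator {..y} s *\<^sub>R (of_real (\<psi> s) * V s + \<i> / of_real k * P s)) \<partial>?M)"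
      unfolding Zeq by (rule integral_norm_bound)
    also have "\<dots> \<le> (\<integral>s. cmod (of_real (\<psi> s)) * cmod (V s) + 1 / \<bar>k\<bar> * cmod (P s) \<partial>?M)"
    proof (intro integral_mono')
      show "integrable ?M (\<lambda>s. cmod (of_real (\<psi> s)) * cmod (V s) + 1 / \<bar>k\<bar> * cmod (P s))"
        using sq_prod_norm_integrable[OF \<psi>s Vs] sq_integrable1[OF finite_measure_ivl P] by simp
      show "cmod (indicator {..y} s *\<^sub>R (of_real (\<psi> s) * V s + \<i> / of_real k * P s))
         \<le> cmod (of_real (\<psi> s)) * cmod (V s) + 1 / \<bar>k\<bar> * cmod (P s)" for s
        using norm_triangle_ineq[of "of_real (\<psi> s) * V s" "\<i> / of_real k * P s"]
        by (auto simp: norm_mult norm_divide split: split_indicator)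
    qed auto
    also have "\<dots> = (\<integral>s. cmod (of_real (\<psi> s)) * cmod (V s) \<partial>?M) + 1 / \<bar>k\<bar> * (\<integral>s. cmod (P s) \<partial>?M)"
      using sq_prod_norm_integrable[OF \<psi>s Vs] sq_integrable1[OF finite_measure_ivl P] by simp
    also have "\<dots> \<le> nrm ?M (\<lambda>y. of_real (\<psi> y)) * nrm ?M V + 1 / \<bar>k\<bar> * (sqrt d * nrm ?M P)"
      using integral_norm_le_nrm[OF _ P] ab unfolding d_def
      by (intro add_mono mult_left_mono Cauchy_Schwarz_nrm \<psi>s Vs) auto
    finally have "(cmod (Z y - Z a))\<^sup>2 \<le> (nrm ?M (\<lambda>y. of_real (\<psi> y)) * nrm ?M V + 1 / \<bar>k\<bar> * (sqrt d * nrm ?M P))\<^sup>2"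
      by (intro power_mono) auto
    also have "\<dots> \<le> 2 * (nrm ?M (\<lambda>y. of_real (\<psi> y)) * nrm ?M V)\<^sup>2 + 2 * (1 / \<bar>k\<bar> * (sqrt d * nrm ?M P))\<^sup>2"
      using sum_squares_bound[of "nrm ?M (\<lambda>y. of_real (\<psi> y)) * nrm ?M V" "1 / \<bar>k\<bar> * (sqrt d * nrm ?M P)"]
      by (simp add: power2_sum)
    also have "\<dots> = 2 * d * p2 / k\<^sup>2 + 2 * m2 * v2"
      using d0 by (simp add: power_mult_distrib nV nP nps power_divide)
    finally show ?thesis .
  qed
  \<comment> \<open>Because \<psi> has mean zero, constants are orthogonal to it. The norm of
    \<open>c * \<psi> - Z a\<close> is therefore at least |c| times that of \<psi>, whatever
    \<open>Z a\<close> is, while pointwise this difference is small by \<open>Z_bound\<close> and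
    \<open>fc_bound\<close>.\<close>
  have main: "(cmod c)\<^sup>2 * m2 \<le> 3 * (2 * d * p2 / k\<^sup>2 + 2 * m2 * v2) * d + 3 * (d * v2) * m2 + 3 * (\<nu> / k)\<^sup>2 * v2"
  proof -
    have i\<psi>: "integrable ?M \<psi>" "integrable ?M (\<lambda>y. (\<psi> y)\<^sup>2)" "integrable ?M (\<lambda>y. (cmod (V y))\<^sup>2)"
      by (intro integrable_ivl_continuous continuous_intros \<psi>c V)+
    have "(\<integral>y. (cmod (c * of_real (\<psi> y) - Z a))\<^sup>2 \<partial>?M)
        = (\<integral>y. (cmod c)\<^sup>2 * (\<psi> y)\<^sup>2 - 2 * Re (c * cnj (Z a)) * \<psi> y + (cmod (Z a))\<^sup>2 \<partial>?M)"
      by (intro Bochner_Integration.integral_cong refl) (simp only: cmod_power2, simp add: power2_eq_square algebra_simps)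
    also have "\<dots> = (cmod c)\<^sup>2 * m2 + (cmod (Z a))\<^sup>2 * d"
      using i\<psi> mean by (simp add: m2_def mu)
    finally have "(cmod c)\<^sup>2 * m2 \<le> (\<integral>y. (cmod (c * of_real (\<psi> y) - Z a))\<^sup>2 \<partial>?M)"
      using d0 by simp
    also have "\<dots> \<le> (\<integral>y. 3 * (2 * d * p2 / k\<^sup>2 + 2 * m2 * v2) + 3 * (d * v2) * (\<psi> y)\<^sup>2 + 3 * (\<nu> / k)\<^sup>2 * (cmod (V y))\<^sup>2 \<partial>?M)"
    proof (rule integral_mono_AE)
      show "integrable ?M (\<lambda>y. (cmod (c * of_real (\<psi> y) - Z a))\<^sup>2)"
        by (intro integrable_ivl_continuous continuous_intros \<psi>c)
      show "integrable ?M (\<lambda>y. 3 * (2 * d * p2 / k\<^sup>2 + 2 * m2 * v2) + 3 * (d * v2) * (\<psi> y)\<^sup>2 + 3 * (\<nu> / k)\<^sup>2 * (cmod (V y))\<^sup>2)"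
        by (intro integrable_ivl_continuous continuous_intros \<psi>c V)
      have "(cmod (c * of_real (\<psi> y) - Z a))\<^sup>2 \<le> 3 * (2 * d * p2 / k\<^sup>2 + 2 * m2 * v2) + 3 * (d * v2) * (\<psi> y)\<^sup>2 + 3 * (\<nu> / k)\<^sup>2 * (cmod (V y))\<^sup>2"
        if y: "y \<in> {a..b}" for y
      proof -
        have "c * of_real (\<psi> y) - Z a = (Z y - Z a) - of_real (\<psi> y) * (f y - c) - \<i> * of_real (\<nu> / k) * V y"
          by (simp add: Z_def algebra_simps)
        then have "(cmod (c * of_real (\<psi> y) - Z a))\<^sup>2 \<le> 3 * (cmod (Z y - Z a))\<^sup>2 + 3 * (cmod (of_real (\<psi> y) * (f y - c)))\<^sup>2
            + 3 * (cmod (\<i> * of_real (\<nu> / k) * V y))\<^sup>2"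
          by (simp only: cmod_add3_sq_le)
        also have "\<dots> = 3 * (cmod (Z y - Z a))\<^sup>2 + 3 * (cmod (f y - c))\<^sup>2 * (\<psi> y)\<^sup>2 + 3 * (\<nu> / k)\<^sup>2 * (cmod (V y))\<^sup>2"
          by (simp add: norm_mult norm_divide power_mult_distrib power_divide)
        also have "\<dots> \<le> 3 * (2 * d * p2 / k\<^sup>2 + 2 * m2 * v2) + 3 * (d * v2) * (\<psi> y)\<^sup>2 + 3 * (\<nu> / k)\<^sup>2 * (cmod (V y))\<^sup>2"
          by (intro add_mono mult_left_mono mult_right_mono Z_bound fc_bound y) auto
        finally show ?thesis .
      qed
      then show "AE y in ?M. (cmod (c * of_real (\<psi> y) - Z a))\<^sup>2 \<le> 3 * (2 * d * p2 / k\<^sup>2 + 2 * m2 * v2) + 3 * (d * v2) * (\<psi> y)\<^sup>2 + 3 * (\<nu> / k)\<^sup>2 * (cmod (V y))\<^sup>2"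
        by (auto simp: AE_ivl)
    qed
    also have "\<dots> = 3 * (2 * d * p2 / k\<^sup>2 + 2 * m2 * v2) * d + 3 * (d * v2) * m2 + 3 * (\<nu> / k)\<^sup>2 * v2"
      using i\<psi> by (simp add: mu m2_def[symmetric] v2_def[symmetric])
    finally show ?thesis .
  qed
  have dm: "d ^ 3 / m2 \<le> 1 / r\<^sup>2"
    using m2 m20 r by (simp add: field_simps)
  \<comment> \<open>Division by \<open>m2\<close> leaves the ratio \<open>d ^ 3 / m2\<close>, which
    the lower bound \<open>low\<close> on the antiderivative controls.\<close>
  have cd: "d * (cmod c)\<^sup>2 \<le> 6 * p2 / (k * r)\<^sup>2 + 9 * d\<^sup>2 * v2 + 3 * (\<nu> / (k * d * r))\<^sup>2 * v2"
  proof -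
    have "d * (cmod c)\<^sup>2 = d / m2 * ((cmod c)\<^sup>2 * m2)" using m20 by simp
    also have "\<dots> \<le> d / m2 * (3 * (2 * d * p2 / k\<^sup>2 + 2 * m2 * v2) * d + 3 * (d * v2) * m2 + 3 * (\<nu> / k)\<^sup>2 * v2)"
      using d0 m20 by (intro mult_left_mono main) auto
    also have "\<dots> = 6 * p2 / k\<^sup>2 * (d ^ 3 / m2) + 9 * d\<^sup>2 * v2 + 3 * (\<nu> / (k * d))\<^sup>2 * v2 * (d ^ 3 / m2)"
    proof -
      have "d / m2 * (3 * (2 * d * p2 / k\<^sup>2 + 2 * m2 * v2) * d + 3 * (d * v2) * m2 + 3 * (\<nu> / k)\<^sup>2 * v2)
        = 6 * p2 / k\<^sup>2 * (d ^ 3 / m2) + 9 * d\<^sup>2 * v2 * (m2 / m2) + 3 * (\<nu> / k)\<^sup>2 * v2 * (d / m2)"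
        by (simp only: add_divide_distrib distrib_left distrib_right power2_eq_square power3_eq_cube times_divide_eq_left times_divide_eq_right) (simp add: algebra_simps)
      also have "3 * (\<nu> / k)\<^sup>2 * v2 * (d / m2) = 3 * (\<nu> / (k * d))\<^sup>2 * v2 * (d ^ 3 / m2)"
        using d0 by (simp add: power_divide power_mult_distrib power2_eq_square power3_eq_cube)
      also have "m2 / m2 = 1" using m20 by simp
      finally show ?thesis by simp
    qed
    also have "\<dots> \<le> 6 * p2 / k\<^sup>2 * (1 / r\<^sup>2) + 9 * d\<^sup>2 * v2 + 3 * (\<nu> / (k * d))\<^sup>2 * v2 * (1 / r\<^sup>2)"
      using p20 v20 by (intro add_mono mult_left_mono dm order_refl) auto
    also have "\<dots> = 6 * p2 / (k * r)\<^sup>2 + 9 * d\<^sup>2 * v2 + 3 * (\<nu> / (k * d * r))\<^sup>2 * v2"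
      by (simp add: power_mult_distrib power_divide)
    finally show ?thesis .
  qed
  have "(\<integral>y. (cmod (f y))\<^sup>2 \<partial>?M) \<le> (b - a) * (2 * (cmod c)\<^sup>2 + 2 * (d * v2))"
  proof (rule integral_ivl_bounds)
    show "integrable ?M (\<lambda>y. (cmod (f y))\<^sup>2)" by (intro integrable_ivl_continuous continuous_intros fc)
    show "(\<lambda>y. (cmod (f y))\<^sup>2) \<in> borel_measurable borel"
      by (intro borel_measurable_continuous_onI continuous_intros fc)
    show "(cmod (f y))\<^sup>2 \<le> 2 * (cmod c)\<^sup>2 + 2 * (d * v2)" if "a \<le> y" "y \<le> b" for y
      using cmod_add_sq_le[of c "f y - c"] fc_bound[of y] that by simp
  qed (use ab d0 v20 in auto)
  also have "\<dots> = 2 * (d * (cmod c)\<^sup>2) + 2 * d\<^sup>2 * v2" by (simp add: d_def power2_eq_square algebra_simps)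
  also have "\<dots> \<le> 2 * (6 * p2 / (k * r)\<^sup>2 + 9 * d\<^sup>2 * v2 + 3 * (\<nu> / (k * d * r))\<^sup>2 * v2) + 2 * d\<^sup>2 * v2"
    by (intro add_right_mono mult_left_mono cd) simp
  also have "\<dots> = 12 / (k * r)\<^sup>2 * p2 + (20 * d\<^sup>2 + 6 * \<nu>\<^sup>2 / (k * d * r)\<^sup>2) * v2"
    by (simp add: algebra_simps power_divide)
  finally show ?thesis unfolding d_def p2_def v2_def .
qed

section \<open>Oscillation of the lacunary series\<close>

text \<open>The derivative of \<open>p cos(pz) sin(qz) - q sin(pz) cos(qz)\<close> is
  \<open>(q^2 - p^2) sin(pz) sin(qz)\<close>. Whole periods of the frequency \<open>q\<close> leave
  only the endpoint values of the other mode.\<close>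

lemma integral_sin_sin:
  fixes p q :: real
  assumes "a \<le> b" "p\<^sup>2 \<noteq> q\<^sup>2" "sin (q * a) = 0" "sin (q * b) = 0" "cos (q * a) = 1" "cos (q * b) = 1"
  shows "(\<integral>z. sin (p * z) * sin (q * z) \<partial>ivl a b) = q * (sin (p * a) - sin (p * b)) / (q\<^sup>2 - p\<^sup>2)"
proof -
  let ?F = "\<lambda>z. (p * cos (p * z) * sin (q * z) - q * sin (p * z) * cos (q * z)) / (q\<^sup>2 - p\<^sup>2)"
  have "(?F has_vector_derivative (sin (p * z) * sin (q * z))) (at z)" for z
  proof -
    have "(?F has_real_derivative ((p * (- sin (p * z) * p) * sin (q * z) + p * cos (p * z) * (cos (q * z) * q)
        - (q * (cos (p * z) * p) * cos (q * z) + q * sin (p * z) * (- sin (q * z) * q))) / (q\<^sup>2 - p\<^sup>2))) (at z)"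
      using assms(2) by (auto intro!: derivative_eq_intros)
    moreover have "(p * (- sin (p * z) * p) * sin (q * z) + p * cos (p * z) * (cos (q * z) * q)
        - (q * (cos (p * z) * p) * cos (q * z) + q * sin (p * z) * (- sin (q * z) * q))) / (q\<^sup>2 - p\<^sup>2) = sin (p * z) * sin (q * z)"
      using assms(2) by (simp add: field_simps power2_eq_square)
    ultimately show ?thesis by (simp add: has_real_derivative_iff_has_vector_derivative)
  qed
  then have "(\<integral>z. sin (p * z) * sin (q * z) \<partial>ivl a b) = ?F b - ?F a"
    by (intro integral_ivl_FTC[where F="?F"] assms(1)) (auto intro!: continuous_intros)
  then show ?thesis using assms(3-6) by (simp add: diff_divide_distrib right_diff_distrib)
qed

lemma integral_sin_sq:
  fixes q :: real
  assumes "a \<le> b" "q \<noteq> 0" "sin (q * a) = 0" "sin (q * b) = 0"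
  shows "(\<integral>z. sin (q * z) * sin (q * z) \<partial>ivl a b) = (b - a) / 2"
proof -
  let ?F = "\<lambda>z. z / 2 - sin (q * z) * cos (q * z) / (2 * q)"
  have "(?F has_vector_derivative (sin (q * z) * sin (q * z))) (at z)" for z
  proof -
    have "(?F has_real_derivative (1 / 2 - ((cos (q * z) * q) * cos (q * z) + sin (q * z) * (- sin (q * z) * q)) / (2 * q))) (at z)"
      using assms(2) by (auto intro!: derivative_eq_intros simp: field_simps)
    moreover have "1 / 2 - ((cos (q * z) * q) * cos (q * z) + sin (q * z) * (- sin (q * z) * q)) / (2 * q) = sin (q * z) * sin (q * z)"
    proof -
      have B: "sin (q * z) * sin (q * z) + cos (q * z) * cos (q * z) = 1"
        using sin_cos_squared_add[of "q * z"] by (simp add: power2_eq_square)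
      have A: "((cos (q * z) * q) * cos (q * z) + sin (q * z) * (- sin (q * z) * q)) / (2 * q)
        = (cos (q * z) * cos (q * z) - sin (q * z) * sin (q * z)) / 2" using assms(2) by (simp add: field_simps)
      show ?thesis unfolding A using B by (simp add: field_simps)
    qed
    ultimately show ?thesis by (simp add: has_real_derivative_iff_has_vector_derivative)
  qed
  then have "(\<integral>z. sin (q * z) * sin (q * z) \<partial>ivl a b) = ?F b - ?F a"
    by (intro integral_ivl_FTC[where F="?F"] assms(1)) (auto intro!: continuous_intros)
  then show ?thesis using assms(3,4) by (simp add: diff_divide_distrib)
qed

text \<open>A mode \<open>sin (3 ^ m * y)\<close> with m \<ge> j completes whole periods between
  neighbouring nodes of level \<open>j\<close>.\<close>

definition node :: "nat \<Rightarrow> nat \<Rightarrow> real" where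
  "node j i = 2 * pi * real i / 3 ^ j"

lemma node_diff: "node j (Suc i) - node j i = 2 * pi / 3 ^ j"
  by (simp add: node_def field_simps)

lemma node_mono: "node j i < node j (Suc i)"
proof -
  have "0 < 2 * pi / 3 ^ j" by simp
  then show ?thesis using node_diff[of j i] by linarith
qed

lemma node_freq:
  assumes "j \<le> m" shows "3 ^ m * node j i = 2 * pi * real (3 ^ (m - j) * i)"
proof -
  have "(3::real) ^ m = 3 ^ (m - j) * 3 ^ j" using assms by (simp flip: power_add)
  then show ?thesis by (simp add: node_def)
qed

lemma sin_node: "j \<le> m \<Longrightarrow> sin (3 ^ m * node j i) = 0"
  and cos_node: "j \<le> m \<Longrightarrow> cos (3 ^ m * node j i) = 1"
proof -
  assume "j \<le> m"
  note f = node_freq[OF this, of i]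
  have c: "cis (2 * pi * real (3 ^ (m - j) * i)) = 1" by (rule cis_multiple_2pi) auto
  show "sin (3 ^ m * node j i) = 0" "cos (3 ^ m * node j i) = 1"
    unfolding f using arg_cong[OF c, of Im] arg_cong[OF c, of Re] by (simp_all only: cis.sel one_complex.sel)
qed

text \<open>Modes of level at least \<open>j\<close> are orthogonal on each interval. A mode coarser
  than \<open>j\<close> changes between the endpoints by at most \<open>3 ^ m\<close> times the
  length of the interval, and integration against the finer sine gains \<open>3 ^ n\<close>, whence
  the factor \<open>(1/3) ^ (n - m)\<close>. The constant 9/8 comes from q^2 - p^2 \<ge> 8/9 q^2
  when q \<ge> 3p.\<close>

lemma integral_modes:
  assumes "j \<le> n"
  shows "j \<le> m \<Longrightarrow> m \<noteq> n \<Longrightarrow> (\<integral>z. sin (3 ^ m * z) * sin (3 ^ n * z) \<partial>ivl (node j i) (node j (Suc i))) = 0"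
    and "(\<integral>z. sin (3 ^ n * z) * sin (3 ^ n * z) \<partial>ivl (node j i) (node j (Suc i))) = (2 * pi / 3 ^ j) / 2"
    and "m < j \<Longrightarrow> \<bar>\<integral>z. sin (3 ^ m * z) * sin (3 ^ n * z) \<partial>ivl (node j i) (node j (Suc i))\<bar>
      \<le> 9 / 8 * (2 * pi / 3 ^ j) * (1/3) ^ (n - m)"
proof -
  let ?a = "node j i" and ?b = "node j (Suc i)"
  have ab: "?a \<le> ?b" using node_mono[of j i] by simp
  have J: "(\<integral>z. sin (3 ^ m * z) * sin (3 ^ n * z) \<partial>ivl ?a ?b)
     = 3 ^ n * (sin (3 ^ m * ?a) - sin (3 ^ m * ?b)) / ((3 ^ n)\<^sup>2 - (3 ^ m)\<^sup>2)" if "m \<noteq> n"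
    using that assms by (intro integral_sin_sin ab) (auto simp: sin_node cos_node power2_eq_iff_nonneg power_inject_exp)
  show "j \<le> m \<Longrightarrow> m \<noteq> n \<Longrightarrow> (\<integral>z. sin (3 ^ m * z) * sin (3 ^ n * z) \<partial>ivl ?a ?b) = 0"
    using J by (simp add: sin_node)
  show "(\<integral>z. sin (3 ^ n * z) * sin (3 ^ n * z) \<partial>ivl ?a ?b) = (2 * pi / 3 ^ j) / 2"
    using integral_sin_sq[OF ab, of "3 ^ n"] assms by (simp add: sin_node node_diff)
  assume mj: "m < j"
  then have mn: "m < n" using assms by simp
  define p q :: real where "p = 3 ^ m" and "q = 3 ^ n"
  have p0: "0 < p" by (simp add: p_def)
  have q: "q = p * 3 ^ (n - m)" using mn by (simp add: p_def q_def flip: power_add)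
  have three: "(3::real) \<le> 3 ^ (n - m)" using mn power_increasing[of 1 "n - m" "3::real"] by simp
  have pq: "3 * p \<le> q" unfolding q using three p0 by simp
  have qq: "8 / 9 * q\<^sup>2 \<le> \<bar>q\<^sup>2 - p\<^sup>2\<bar>"
  proof -
    have "(3 * p)\<^sup>2 \<le> q\<^sup>2" using pq p0 by (intro power_mono) auto
    then have "9 * p\<^sup>2 \<le> q\<^sup>2" by (simp add: power_mult_distrib)
    then show ?thesis using zero_le_power2[of p] by linarith
  qed
  have q0: "0 < q" using pq p0 by linarith
  have s: "\<bar>sin (p * ?a) - sin (p * ?b)\<bar> \<le> p * (2 * pi / 3 ^ j)"
  proof -
    have "\<bar>sin (p * ?a) - sin (p * ?b)\<bar> = \<bar>2 * sin ((p * ?a - p * ?b) / 2) * cos ((p * ?a + p * ?b) / 2)\<bar>"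
      by (simp add: sin_diff_sin)
    also have "\<dots> \<le> 2 * \<bar>sin ((p * ?a - p * ?b) / 2)\<bar> * 1"
      unfolding abs_mult by (intro mult_mono) auto
    also have "\<dots> \<le> 2 * \<bar>(p * ?a - p * ?b) / 2\<bar>" using abs_sin_x_le_abs_x[of "(p * ?a - p * ?b) / 2"] by simp
    also have "\<dots> = p * (?b - ?a)" using p0 ab by (simp add: right_diff_distrib[symmetric] abs_mult)
    finally show ?thesis by (simp add: node_diff)
  qed
  have "\<bar>\<integral>z. sin (3 ^ m * z) * sin (3 ^ n * z) \<partial>ivl ?a ?b\<bar> = q * \<bar>sin (p * ?a) - sin (p * ?b)\<bar> / \<bar>q\<^sup>2 - p\<^sup>2\<bar>"
    using J mn q0 by (simp add: p_def[symmetric] q_def[symmetric] abs_mult)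
  also have "\<dots> \<le> q * (p * (2 * pi / 3 ^ j)) / (8 / 9 * q\<^sup>2)"
    using qq q0 by (intro frac_le mult_left_mono s mult_nonneg_nonneg) (use p0 in auto)
  also have "\<dots> = 9 / 8 * (2 * pi / 3 ^ j) * (p / q)" using q0 by (simp add: field_simps power2_eq_square)
  also have "p / q = (1/3) ^ (n - m)" using p0 by (simp add: q power_one_over divide_simps)
  finally show "\<bar>\<integral>z. sin (3 ^ m * z) * sin (3 ^ n * z) \<partial>ivl ?a ?b\<bar> \<le> 9 / 8 * (2 * pi / 3 ^ j) * (1/3) ^ (n - m)" .
qed

text \<open>Polynomial growth of the coefficient ratios is absorbed here: together with the gain
  \<open>(1/3) ^ d\<close> from the coarse modes it leaves the summable
  \<open>(2/3) ^ d\<close>.\<close>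

lemma square_le_two_power: "(1 + real d)\<^sup>2 \<le> 4 * 2 ^ d"
proof (induction d)
  case (Suc d)
  show ?case
  proof (cases "d < 2")
    case True
    then have "d = 0 \<or> d = 1" by auto
    then show ?thesis by auto
  next
    case False
    then have "2 * 2 \<le> real d * real d" by (intro mult_mono) auto
    then have "(1 + real (Suc d))\<^sup>2 \<le> 2 * (1 + real d)\<^sup>2"
      by (simp add: power2_eq_square algebra_simps)
    then show ?thesis using Suc by simp
  qed
qed simp

locale lacunary =
  fixes a :: "nat \<Rightarrow> real" and \<alpha> C\<^sub>0 :: real and u :: "real \<Rightarrow> real"
  assumes \<alpha>: "1 < \<alpha>" "\<alpha> < 2" and C0: "1 < C\<^sub>0"
    and a_lower: "n \<ge> 1 \<Longrightarrow> real n powr (- \<alpha>) \<le> \<bar>a n\<bar>"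
    and a_upper: "n \<ge> 1 \<Longrightarrow> \<bar>a n\<bar> \<le> C\<^sub>0 * real n powr (- \<alpha>)"
    and u_eq: "u y = (\<Sum>n. a (Suc n) * sin (3 ^ Suc n * y))"
begin

lemma a_summable: "summable (\<lambda>n. \<bar>a (Suc n)\<bar>)"
proof (rule summable_comparison_test')
  show "summable (\<lambda>n. C\<^sub>0 * real (Suc n) powr (- \<alpha>))"
    using \<alpha> by (intro summable_mult summable_Suc_iff[THEN iffD2]) (simp add: summable_real_powr_iff)
  show "norm \<bar>a (Suc n)\<bar> \<le> C\<^sub>0 * real (Suc n) powr (- \<alpha>)" for n using a_upper[of "Suc n"] by simp
qed

lemma u_continuous: "continuous_on UNIV u"
proof -
  have "continuous_on UNIV (\<lambda>y. \<Sum>n. a (Suc n) * sin (3 ^ Suc n * y))"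
  proof (rule uniform_limit_theorem[where F=sequentially])
    show "uniform_limit UNIV (\<lambda>n x. \<Sum>i<n. a (Suc i) * sin (3 ^ Suc i * x)) (\<lambda>y. \<Sum>n. a (Suc n) * sin (3 ^ Suc n * y)) sequentially"
    proof (rule Weierstrass_m_test[OF _ a_summable])
      show "norm (a (Suc n) * sin (3 ^ Suc n * x)) \<le> \<bar>a (Suc n)\<bar>" for n x
        using abs_sin_le_one[of "3 ^ Suc n * x"] mult_left_mono[of "\<bar>sin (3 ^ Suc n * x)\<bar>" 1 "\<bar>a (Suc n)\<bar>"]
        by (simp add: abs_mult)
    qed
  qed (auto intro!: always_eventually continuous_intros)
  then show ?thesis by (simp add: u_eq[abs_def])
qed

text \<open>A gap of \<open>K\<close> levels between the frequency of the test function and the length of the interval kills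
  the modes in between exactly, and makes the contribution of all coarser modes small.\<close>

lemma oscillation:
  assumes K: "36 * C\<^sub>0 * (2/3) ^ K \<le> 1"
  shows "\<bar>\<integral>z. u z * sin (3 ^ (j + K) * z) \<partial>ivl (node j i) (node j (Suc i))\<bar> \<ge> \<bar>a (j + K)\<bar> * (2 * pi / 3 ^ j) / 4"
proof -
  let ?n = "j + K"
  let ?M = "ivl (node j i) (node j (Suc i))"
  let ?d = "2 * pi / 3 ^ j :: real"
  define J where "J m = (\<integral>z. sin (3 ^ m * z) * sin (3 ^ ?n * z) \<partial>?M)" for m
  have K1: "1 \<le> K" using K C0 by (cases K) auto
  have d0: "0 < ?d" by simp
  have ab: "node j i \<le> node j (Suc i)" using node_mono[of j i] by simp
  have i1: "integrable ?M (\<lambda>z. a (Suc m) * sin (3 ^ Suc m * z) * sin (3 ^ ?n * z))" for m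
    by (intro integrable_ivl_continuous continuous_intros)
  have bd: "\<bar>a (Suc m) * sin (3 ^ Suc m * z) * sin (3 ^ ?n * z)\<bar> \<le> \<bar>a (Suc m)\<bar>" for m z
  proof -
    have "\<bar>a (Suc m)\<bar> * \<bar>sin (3 ^ Suc m * z)\<bar> * \<bar>sin (3 ^ ?n * z)\<bar> \<le> \<bar>a (Suc m)\<bar> * 1 * 1"
      by (intro mult_mono abs_sin_le_one) auto
    then show ?thesis by (simp add: abs_mult)
  qed
  have "(\<integral>z. u z * sin (3 ^ ?n * z) \<partial>?M) = (\<integral>z. (\<Sum>m. a (Suc m) * sin (3 ^ Suc m * z) * sin (3 ^ ?n * z)) \<partial>?M)"
  proof (intro Bochner_Integration.integral_cong refl)
    fix z
    have "summable (\<lambda>m. a (Suc m) * sin (3 ^ Suc m * z))"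
    proof (rule summable_comparison_test'[OF a_summable])
      show "norm (a (Suc m) * sin (3 ^ Suc m * z)) \<le> \<bar>a (Suc m)\<bar>" for m
        using mult_left_mono[OF abs_sin_le_one[of "3 ^ Suc m * z"], of "\<bar>a (Suc m)\<bar>"] by (simp add: abs_mult)
    qed
    then show "u z * sin (3 ^ ?n * z) = (\<Sum>m. a (Suc m) * sin (3 ^ Suc m * z) * sin (3 ^ ?n * z))"
      unfolding u_eq by (rule suminf_mult2)
  qed
  also have "\<dots> = (\<Sum>m. \<integral>z. a (Suc m) * sin (3 ^ Suc m * z) * sin (3 ^ ?n * z) \<partial>?M)"
  proof (rule integral_suminf[OF i1])
    show "AE z in ?M. summable (\<lambda>m. norm (a (Suc m) * sin (3 ^ Suc m * z) * sin (3 ^ ?n * z)))"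
      by (intro AE_I2 summable_comparison_test'[OF a_summable]) (use bd in simp)
    show "summable (\<lambda>m. \<integral>z. norm (a (Suc m) * sin (3 ^ Suc m * z) * sin (3 ^ ?n * z)) \<partial>?M)"
    proof (rule summable_comparison_test'[OF summable_mult[OF a_summable, of ?d]])
      fix m
      have "(\<integral>z. norm (a (Suc m) * sin (3 ^ Suc m * z) * sin (3 ^ ?n * z)) \<partial>?M) \<le> (node j (Suc i) - node j i) * \<bar>a (Suc m)\<bar>"
        using bd ab by (intro integral_ivl_bounds integrable_norm[OF i1])
          (auto intro!: borel_measurable_continuous_onI continuous_intros)
      then show "norm (\<integral>z. norm (a (Suc m) * sin (3 ^ Suc m * z) * sin (3 ^ ?n * z)) \<partial>?M) \<le> ?d * \<bar>a (Suc m)\<bar>"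
        by (simp add: node_diff)
    qed
  qed
  also have "\<dots> = (\<Sum>m. a (Suc m) * J (Suc m))"
    unfolding J_def mult.assoc integral_mult_right_zero ..
  \<comment> \<open>Index \<open>m\<close> stands for the mode \<open>Suc m\<close>, so this range
    ends with the mode of the test function itself; all finer modes integrate to zero.\<close>
  also have "\<dots> = (\<Sum>m<?n. a (Suc m) * J (Suc m))"
  proof (rule suminf_finite)
    fix m assume "m \<notin> {..<?n}"
    then have "J (Suc m) = 0" unfolding J_def by (intro integral_modes(1)) auto
    then show "a (Suc m) * J (Suc m) = 0" by simp
  qed simp
  also have "\<dots> = a ?n * J ?n + (\<Sum>m<?n - 1. a (Suc m) * J (Suc m))"
    using K1 by (cases ?n) auto
  finally have eq: "(\<integral>z. u z * sin (3 ^ ?n * z) \<partial>?M) = a ?n * (?d / 2) + (\<Sum>m<?n - 1. a (Suc m) * J (Suc m))"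
    using integral_modes(2)[of j ?n i] by (simp add: J_def)
  \<comment> \<open>With M = Suc m, the ratio (n/M)^\<alpha> is at most (1 + (n - M))^2 because
    \<alpha> < 2 and n/M \<le> 1 + (n - M). This costs \<open>4 * 2 ^ (n - M)\<close> against the
    gain \<open>9/8 * (1/3) ^ (n - M)\<close>.\<close>
  have mode_bound: "\<bar>a (Suc m) * J (Suc m)\<bar> \<le> 9/2 * C\<^sub>0 * \<bar>a ?n\<bar> * ?d * (if Suc m < j then (2/3) ^ (?n - Suc m) else 0)"
    if m: "m < ?n - 1" for m
  proof (cases "Suc m < j")
    case False
    then have "J (Suc m) = 0" unfolding J_def using m by (intro integral_modes(1)) auto
    then show ?thesis using False by simp
  next
    case True
    let ?k = "?n - Suc m"
    have sm: "0 < real (Suc m)" by simp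
    have ratio: "real ?n / real (Suc m) \<le> 1 + real ?k"
    proof -
      have "real ?n = real ?k + real (Suc m)" using m by simp
      also have "\<dots> \<le> real ?k * real (Suc m) + real (Suc m)" using mult_left_mono[of 1 "real (Suc m)" "real ?k"] by simp
      finally have "real ?n \<le> (1 + real ?k) * real (Suc m)" by (simp add: distrib_right)
      then show ?thesis by (simp only: pos_divide_le_eq[OF sm])
    qed
    have ge1: "1 \<le> real ?n / real (Suc m)" using m by (simp add: field_simps)
    have "real (Suc m) powr (- \<alpha>) = (real ?n / real (Suc m)) powr \<alpha> * real ?n powr (- \<alpha>)"
      using m by (simp add: powr_divide powr_minus field_simps)
    also have "\<dots> \<le> (real ?n / real (Suc m)) powr 2 * \<bar>a ?n\<bar>"
      using \<alpha> ge1 K1 by (intro mult_mono powr_mono a_lower) auto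
    also have "(real ?n / real (Suc m)) powr 2 = (real ?n / real (Suc m))\<^sup>2"
      using ge1 by (intro powr_numeral) linarith
    also have "\<dots> \<le> (1 + real ?k)\<^sup>2" using ratio ge1 by (intro power_mono) auto
    also have "\<dots> \<le> 4 * 2 ^ ?k" by (rule square_le_two_power)
    finally have pw: "real (Suc m) powr (- \<alpha>) \<le> 4 * 2 ^ ?k * \<bar>a ?n\<bar>" by (simp add: mult_right_mono)
    have "\<bar>a (Suc m)\<bar> \<le> C\<^sub>0 * real (Suc m) powr (- \<alpha>)" by (rule a_upper) simp
    also have "\<dots> \<le> C\<^sub>0 * (4 * 2 ^ ?k * \<bar>a ?n\<bar>)" using C0 by (intro mult_left_mono pw) auto
    finally have A: "\<bar>a (Suc m)\<bar> \<le> C\<^sub>0 * (4 * 2 ^ ?k * \<bar>a ?n\<bar>)" .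
    have "\<bar>J (Suc m)\<bar> \<le> 9 / 8 * ?d * (1/3) ^ ?k"
      unfolding J_def by (rule integral_modes(3)) (use True in auto)
    then have "\<bar>a (Suc m)\<bar> * \<bar>J (Suc m)\<bar> \<le> C\<^sub>0 * (4 * 2 ^ ?k * \<bar>a ?n\<bar>) * (9 / 8 * ?d * (1/3) ^ ?k)"
      using C0 by (intro mult_mono A) auto
    also have "\<dots> = 9/2 * C\<^sub>0 * \<bar>a ?n\<bar> * ?d * (2 ^ ?k * (1/3) ^ ?k)" by (simp add: mult_ac)
    also have "2 ^ ?k * (1/3) ^ ?k = (2/3::real) ^ ?k" by (simp add: power_mult_distrib[symmetric])
    finally show ?thesis using True by (simp add: abs_mult)
  qed
  have "\<bar>\<Sum>m<?n - 1. a (Suc m) * J (Suc m)\<bar> \<le> (\<Sum>m<?n - 1. \<bar>a (Suc m) * J (Suc m)\<bar>)" by (rule sum_abs)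
  also have "\<dots> \<le> (\<Sum>m<?n - 1. 9/2 * C\<^sub>0 * \<bar>a ?n\<bar> * ?d * (if Suc m < j then (2/3) ^ (?n - Suc m) else 0))"
    by (intro sum_mono mode_bound) auto
  also have "\<dots> = 9/2 * C\<^sub>0 * \<bar>a ?n\<bar> * ?d * (\<Sum>m<?n - 1. if Suc m < j then (2/3) ^ (?n - Suc m) else 0)"
    by (simp only: sum_distrib_left)
  also have "\<dots> \<le> 9/2 * C\<^sub>0 * \<bar>a ?n\<bar> * ?d * (2 * (2/3) ^ K)"
  proof (rule mult_left_mono)
    have "(\<Sum>m<?n - 1. if Suc m < j then (2/3) ^ (?n - Suc m) else 0) = (\<Sum>m\<in>{m. Suc m < j}. (2/3::real) ^ (?n - Suc m))"
      by (rule sum.mono_neutral_cong_right) auto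
    also have "\<dots> = (\<Sum>l\<in>{1..<j}. (2/3::real) ^ (K + l))"
      by (rule sum.reindex_bij_witness[of _ "\<lambda>l. j - l - 1" "\<lambda>m. j - Suc m"]) (auto simp: algebra_simps)
    also have "\<dots> = (2/3) ^ K * (\<Sum>l\<in>{1..<j}. (2/3) ^ l)" by (simp add: power_add sum_distrib_left)
    also have "(\<Sum>l\<in>{1..<j}. (2/3::real) ^ l) \<le> 2"
    proof -
      have "(\<Sum>l\<in>{1..<j}. (2/3::real) ^ l) \<le> (\<Sum>l. (2/3) ^ Suc l)"
      proof -
        have "(\<Sum>l\<in>{1..<j}. (2/3::real) ^ l) = (\<Sum>l<j - 1. (2/3) ^ Suc l)"
          by (rule sum.reindex_bij_witness[of _ "\<lambda>l. Suc l" "\<lambda>l. l - 1"]) auto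
        also have "\<dots> \<le> (\<Sum>l. (2/3) ^ Suc l)" by (intro sum_le_suminf) (auto intro: summable_mult)
        finally show ?thesis .
      qed
      also have "(\<Sum>l. (2/3::real) ^ Suc l) = 2/3 * (\<Sum>l. (2/3) ^ l)"
        unfolding power_Suc by (rule suminf_mult) simp
      also have "\<dots> = 2" by (subst suminf_geometric) auto
      finally show ?thesis .
    qed
    finally show "(\<Sum>m<?n - 1. if Suc m < j then (2/3) ^ (?n - Suc m) else 0) \<le> 2 * (2/3::real) ^ K"
      by (simp add: mult.commute)
  qed (use C0 in auto)
  \<comment> \<open>The assumption on \<open>K\<close> is made so that the coarse modes take away at
    most half of the diagonal term \<open>\<bar>a ?n\<bar> * ?d / 2\<close>.\<close>
  also have "\<dots> = \<bar>a ?n\<bar> * ?d / 4 * (36 * C\<^sub>0 * (2/3) ^ K)" by simp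
  also have "\<dots> \<le> \<bar>a ?n\<bar> * ?d / 4 * 1" by (intro mult_left_mono K) auto
  finally have small: "\<bar>\<Sum>m<?n - 1. a (Suc m) * J (Suc m)\<bar> \<le> \<bar>a ?n\<bar> * ?d / 4" by simp
  have "\<bar>a ?n * (?d / 2)\<bar> = \<bar>a ?n\<bar> * ?d / 2" using d0 by (simp add: abs_mult)
  moreover have "A / 4 \<le> \<bar>x + s\<bar>" if "\<bar>x\<bar> = A / 2" "\<bar>s\<bar> \<le> A / 4" for A x s :: real
    using that by linarith
  ultimately show ?thesis unfolding eq using small by blast
qed

end

section \<open>The operator on a Fourier mode\<close>

text \<open>The generator of one mode in weak form, so that no regularity of \<open>F\<close> is
  built in. Testing against exponentials already determines a periodic distribution, and
  exponentials in both variables are what the operator on the torus is tested with.\<close>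

definition mode_op :: "real \<Rightarrow> real \<Rightarrow> (real \<Rightarrow> real) \<Rightarrow> int \<Rightarrow> (real \<Rightarrow> complex) \<Rightarrow> (real \<Rightarrow> complex) \<Rightarrow> bool" where
  "mode_op \<mu> \<nu> u k F G \<longleftrightarrow> F \<in> sq circ \<and> G \<in> sq circ \<and>
     (\<forall>m::int. (\<integral>y. G y * cis (of_int m * y) \<partial>circ) =
        (\<integral>y. F y * ((- of_real (\<mu> * (of_int k)\<^sup>2) - of_real (\<nu> * (of_int m)\<^sup>2) - \<i> * of_real (of_int k * u y)) * cis (of_int m * y)) \<partial>circ))"

lemma sq_mult_continuous:
  assumes g: "continuous_on UNIV g" and F: "F \<in> sq (ivl a b)"
  shows "(\<lambda>y. g y * F y) \<in> sq (ivl a b)"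
proof (rule sqI)
  have [measurable]: "g \<in> borel_measurable borel" by (rule borel_measurable_continuous_onI[OF g])
  have [measurable]: "F \<in> borel_measurable borel" using sq_meas[OF F] by simp
  show "(\<lambda>y. g y * F y) \<in> borel_measurable (ivl a b)" by measurable
  obtain B where "\<forall>s\<in>{a..b}. cmod (g s) \<le> B"
    using compact_imp_bounded[OF compact_continuous_image[OF continuous_on_subset[OF g, of "{a..b}"]]]
    by (auto simp: bounded_iff)
  then have B: "cmod (g s) \<le> \<bar>B\<bar>" if "s \<in> {a..b}" for s using that by (meson abs_ge_self order_trans)
  show "integrable (ivl a b) (\<lambda>y. (cmod (g y * F y))\<^sup>2)"
  proof (rule Bochner_Integration.integrable_bound)
    show "integrable (ivl a b) (\<lambda>y. B\<^sup>2 * (cmod (F y))\<^sup>2)" using sq_integrable[OF F] by simp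
    have "(cmod (g y * F y))\<^sup>2 \<le> B\<^sup>2 * (cmod (F y))\<^sup>2" if "y \<in> {a..b}" for y
    proof -
      have "(cmod (g y))\<^sup>2 \<le> \<bar>B\<bar>\<^sup>2" by (intro power_mono B that) auto
      then show ?thesis by (simp add: norm_mult power_mult_distrib mult_right_mono)
    qed
    then show "AE y in ivl a b. norm ((cmod (g y * F y))\<^sup>2) \<le> norm (B\<^sup>2 * (cmod (F y))\<^sup>2)"
      by (auto simp: AE_ivl)
  qed measurable
qed

lemma mode_opD:
  assumes "mode_op \<mu> \<nu> u k F G"
  shows "F \<in> sq circ" "G \<in> sq circ"
    "(\<integral>y. G y * cis (of_int m * y) \<partial>circ) =
        (\<integral>y. F y * ((- of_real (\<mu> * (of_int k)\<^sup>2) - of_real (\<nu> * (of_int m)\<^sup>2) - \<i> * of_real (of_int k * u y)) * cis (of_int m * y)) \<partial>circ)"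
  using assms unfolding mode_op_def by auto

lemma mode_op_sum:
  assumes u: "continuous_on UNIV u"
    and op: "\<And>j. j \<in> J \<Longrightarrow> mode_op \<mu> \<nu> u k (F j) (G j)"
  shows "mode_op \<mu> \<nu> u k (\<lambda>y. \<Sum>j\<in>J. c j * F j y) (\<lambda>y. \<Sum>j\<in>J. c j * G j y)"
  unfolding mode_op_def
proof (intro conjI allI)
  show "(\<lambda>y. \<Sum>j\<in>J. c j * F j y) \<in> sq circ" "(\<lambda>y. \<Sum>j\<in>J. c j * G j y) \<in> sq circ"
    by (auto intro!: sq_sum sq_cmult mode_opD(1,2)[OF op])
  fix m :: int
  let ?w = "\<lambda>y. (- complex_of_real (\<mu> * (of_int k)\<^sup>2) - of_real (\<nu> * (of_int m)\<^sup>2) - \<i> * of_real (of_int k * u y)) * cis (of_int m * y)"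
  have ws: "?w \<in> sq circ" by (intro sq_ivl_continuous continuous_intros u)
  have es: "(\<lambda>y. cis (of_int m * y)) \<in> sq circ" by (intro sq_ivl_continuous continuous_cis)
  have "(\<integral>y. (\<Sum>j\<in>J. c j * G j y) * cis (of_int m * y) \<partial>circ) = (\<integral>y. (\<Sum>j\<in>J. c j * (G j y * cis (of_int m * y))) \<partial>circ)"
    by (simp add: sum_distrib_right mult.assoc)
  also have "\<dots> = (\<Sum>j\<in>J. c j * (\<integral>y. G j y * cis (of_int m * y) \<partial>circ))"
    using sq_prod_integrable[OF mode_opD(2)[OF op] es] by (subst Bochner_Integration.integral_sum) auto
  also have "\<dots> = (\<Sum>j\<in>J. c j * (\<integral>y. F j y * ?w y \<partial>circ))"
    by (intro sum.cong refl arg_cong2[where f="(*)"] mode_opD(3) op)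
  also have "\<dots> = (\<integral>y. (\<Sum>j\<in>J. c j * (F j y * ?w y)) \<partial>circ)"
    using sq_prod_integrable[OF mode_opD(1)[OF op] ws] by (subst Bochner_Integration.integral_sum) auto
  also have "\<dots> = (\<integral>y. (\<Sum>j\<in>J. c j * F j y) * ?w y \<partial>circ)"
    by (simp add: sum_distrib_right mult.assoc)
  finally show "(\<integral>y. (\<Sum>j\<in>J. c j * G j y) * cis (of_int m * y) \<partial>circ) = (\<integral>y. (\<Sum>j\<in>J. c j * F j y) * ?w y \<partial>circ)" .
qed

text \<open>Solving the equation for the second derivative of \<open>F\<close> gives a
  square-integrable function, since \<open>u\<close> is bounded on the circle; this is the situation
  of \<open>periodic_regularity\<close>. In the energy identity the term with \<open>u\<close> is
  purely imaginary and drops out of the real part.\<close>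

lemma mode_op_regular:
  assumes op: "mode_op \<mu> \<nu> u k F G" and \<nu>: "0 < \<nu>" and u: "continuous_on UNIV u"
  obtains f V where "\<And>y. (f has_vector_derivative V y) (at y)" "continuous_on UNIV V"
    "AE y in circ. F y = f y"
    "(\<lambda>y. (G y + of_real (\<mu> * (of_int k)\<^sup>2) * F y + \<i> * of_real (of_int k * u y) * F y) / of_real \<nu>) \<in> sq circ"
    "\<And>y. V y = V 0 + (\<integral>s. indicator {..y} s *\<^sub>R ((G s + of_real (\<mu> * (of_int k)\<^sup>2) * F s + \<i> * of_real (of_int k * u s) * F s) / of_real \<nu>) \<partial>circ)"
    "Re (\<integral>y. G y * cnj (F y) \<partial>circ) = - (\<nu> * (nrm circ V)\<^sup>2) - \<mu> * (of_int k)\<^sup>2 * (nrm circ F)\<^sup>2"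
proof -
  note F = mode_opD(1)[OF op] and G = mode_opD(2)[OF op]
  define H where "H y = (G y + of_real (\<mu> * (of_int k)\<^sup>2) * F y + \<i> * of_real (of_int k * u y) * F y) / of_real \<nu>" for y
  have \<nu>H: "of_real \<nu> * (H y * w) = (G y + of_real (\<mu> * (of_int k)\<^sup>2) * F y + \<i> * of_real (of_int k * u y) * F y) * w" for y w
    using \<nu> by (simp add: H_def)
  have uF: "(\<lambda>y. \<i> * of_real (of_int k * u y) * F y) \<in> sq circ"
    by (intro sq_mult_continuous F continuous_intros u)
  have Hs: "H \<in> sq circ"
    using sq_cmult[OF sq_add[OF sq_add[OF G sq_cmult[OF F, of "of_real (\<mu> * (of_int k)\<^sup>2)"]] uF], of "1 / of_real \<nu>"]
    by (simp add: H_def[abs_def])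
  have weak: "(\<integral>y. F y * (- (of_int m)\<^sup>2 * cis (of_int m * y)) \<partial>circ) = (\<integral>y. H y * cis (of_int m * y) \<partial>circ)" for m :: int
  proof -
    let ?e = "\<lambda>y. cis (of_int m * y)"
    let ?A = "\<lambda>y. F y * ((- of_real (\<mu> * (of_int k)\<^sup>2) - of_real (\<nu> * (of_int m)\<^sup>2) - \<i> * of_real (of_int k * u y)) * ?e y)"
    have es: "?e \<in> sq circ" by (intro sq_ivl_continuous continuous_cis)
    have ws: "(\<lambda>y. (- complex_of_real (\<mu> * (of_int k)\<^sup>2) - of_real (\<nu> * (of_int m)\<^sup>2) - \<i> * of_real (of_int k * u y)) * ?e y) \<in> sq circ"
      by (intro sq_ivl_continuous continuous_intros u)
    have i1: "integrable circ ?A" by (intro sq_prod_integrable F ws)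
    have i2: "integrable circ (\<lambda>y. G y * ?e y)" by (intro sq_prod_integrable G es)
    have "of_real \<nu> * (\<integral>y. H y * ?e y \<partial>circ) = (\<integral>y. of_real \<nu> * (H y * ?e y) \<partial>circ)" by simp
    also have "\<dots> = (\<integral>y. (G y * ?e y - ?A y) + of_real \<nu> * (F y * (- (of_int m)\<^sup>2 * ?e y)) \<partial>circ)"
      unfolding \<nu>H by (intro Bochner_Integration.integral_cong refl) (simp add: algebra_simps)
    also have "\<dots> = ((\<integral>y. G y * ?e y \<partial>circ) - (\<integral>y. ?A y \<partial>circ)) + of_real \<nu> * (\<integral>y. F y * (- (of_int m)\<^sup>2 * ?e y) \<partial>circ)"
    proof -
      have i4: "integrable circ (\<lambda>y. F y * (- (of_int m)\<^sup>2 * ?e y))" by (intro sq_prod_integrable F sq_cmult es)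
      show ?thesis
        unfolding Bochner_Integration.integral_add[OF Bochner_Integration.integrable_diff[OF i2 i1] integrable_mult_right[OF i4]]
          Bochner_Integration.integral_diff[OF i2 i1] integral_mult_right_zero ..
    qed
    also have "(\<integral>y. G y * ?e y \<partial>circ) - (\<integral>y. ?A y \<partial>circ) = 0" using mode_opD(3)[OF op, of m] by simp
    finally have "of_real \<nu> * (\<integral>y. H y * ?e y \<partial>circ) = of_real \<nu> * (\<integral>y. F y * (- (of_int m)\<^sup>2 * ?e y) \<partial>circ)"
      by (simp only: add_0)
    moreover have "complex_of_real \<nu> \<noteq> 0" using \<nu> by simp
    ultimately show ?thesis by (metis mult_cancel_left)
  qed
  obtain f V where fV: "\<And>y. (f has_vector_derivative V y) (at y)" "continuous_on UNIV V"
    "AE y in circ. F y = f y"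
    "\<And>y. V y = V 0 + (\<integral>s. indicator {..y} s *\<^sub>R H s \<partial>circ)"
    and en: "(\<integral>y. H y * cnj (f y) \<partial>circ) = - of_real ((nrm circ V)\<^sup>2)"
    using periodic_regularity[OF F Hs weak] by blast
  have fc: "continuous_on UNIV f"
    using fV(1) by (auto simp: continuous_on_eq_continuous_at intro: has_vector_derivative_continuous)
  have [measurable]: "f \<in> borel_measurable borel" "F \<in> borel_measurable borel" "H \<in> borel_measurable borel"
    using sq_meas[OF F] sq_meas[OF Hs] borel_measurable_continuous_onI[OF fc] by auto
  have en': "(\<integral>y. H y * cnj (F y) \<partial>circ) = - of_real ((nrm circ V)\<^sup>2)"
  proof -
    have [measurable]: "(\<lambda>y. cnj (f y)) \<in> borel_measurable borel" "(\<lambda>y. cnj (F y)) \<in> borel_measurable borel"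
      using sq_meas[OF sq_conj[OF F]] sq_meas[OF sq_conj[OF sq_ivl_continuous[OF fc, of 0 "2*pi"]]] by auto
    have "(\<integral>y. H y * cnj (F y) \<partial>circ) = (\<integral>y. H y * cnj (f y) \<partial>circ)"
    proof (rule integral_cong_AE)
      show "AE y in circ. H y * cnj (F y) = H y * cnj (f y)" using fV(3) by eventually_elim simp
    qed measurable
    then show ?thesis using en by simp
  qed
  have "(\<integral>y. G y * cnj (F y) \<partial>circ) = (\<integral>y. of_real \<nu> * (H y * cnj (F y)) - (of_real (\<mu> * (of_int k)\<^sup>2) * F y) * cnj (F y)
      - (\<i> * of_real (of_int k * u y) * F y) * cnj (F y) \<partial>circ)"
    unfolding \<nu>H by (intro Bochner_Integration.integral_cong refl) (simp add: algebra_simps)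
  also have "\<dots> = of_real \<nu> * (\<integral>y. H y * cnj (F y) \<partial>circ) - (\<integral>y. (of_real (\<mu> * (of_int k)\<^sup>2) * F y) * cnj (F y) \<partial>circ)
      - (\<integral>y. (\<i> * of_real (of_int k * u y) * F y) * cnj (F y) \<partial>circ)"
  proof -
    have i1: "integrable circ (\<lambda>y. H y * cnj (F y))" by (intro sq_prod_integrable Hs sq_conj F)
    have i2: "integrable circ (\<lambda>y. (of_real (\<mu> * (of_int k)\<^sup>2) * F y) * cnj (F y))" by (intro sq_prod_integrable sq_cmult sq_conj F)
    have i3: "integrable circ (\<lambda>y. (\<i> * of_real (of_int k * u y) * F y) * cnj (F y))" by (intro sq_prod_integrable uF sq_conj F)
    show ?thesis
      unfolding Bochner_Integration.integral_diff[OF Bochner_Integration.integrable_diff[OF integrable_mult_right[OF i1] i2] i3]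
        Bochner_Integration.integral_diff[OF integrable_mult_right[OF i1] i2] integral_mult_right_zero ..
  qed
  also have "(\<integral>y. (of_real (\<mu> * (of_int k)\<^sup>2) * F y) * cnj (F y) \<partial>circ) = of_real (\<mu> * (of_int k)\<^sup>2 * (nrm circ F)\<^sup>2)"
  proof -
    have "(\<integral>y. (of_real (\<mu> * (of_int k)\<^sup>2) * F y) * cnj (F y) \<partial>circ) = (\<integral>y. complex_of_real (\<mu> * (of_int k)\<^sup>2 * (cmod (F y))\<^sup>2) \<partial>circ)"
      by (simp only: mult.assoc of_real_mult complex_norm_square)
    also have "\<dots> = of_real (\<integral>y. \<mu> * (of_int k)\<^sup>2 * (cmod (F y))\<^sup>2 \<partial>circ)"
      by (rule integral_of_real) (use sq_integrable[OF F] in auto)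
    finally show ?thesis by (simp add: nrm_power2)
  qed
  also have "(\<integral>y. (\<i> * of_real (of_int k * u y) * F y) * cnj (F y) \<partial>circ) = \<i> * of_real (\<integral>y. of_int k * u y * (cmod (F y))\<^sup>2 \<partial>circ)"
  proof -
    have "(\<integral>y. (\<i> * of_real (of_int k * u y) * F y) * cnj (F y) \<partial>circ) = (\<integral>y. \<i> * complex_of_real (of_int k * u y * (cmod (F y))\<^sup>2) \<partial>circ)"
      by (simp only: mult.assoc of_real_mult complex_norm_square)
    then show ?thesis by (simp only: integral_mult_right_zero integral_complex_of_real)
  qed
  finally have "Re (\<integral>y. G y * cnj (F y) \<partial>circ) = - (\<nu> * (nrm circ V)\<^sup>2) - \<mu> * (of_int k)\<^sup>2 * (nrm circ F)\<^sup>2"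
    unfolding en' by simp
  from fV(1,2,3) Hs[unfolded H_def[abs_def]] fV(4)[unfolded H_def] this show thesis by (rule that)
qed

section \<open>Dissipativity of the mode operator\<close>

lemma Re_integral_le:
  assumes "F \<in> sq M" "G \<in> sq M" shows "\<bar>Re (\<integral>y. G y * cnj (F y) \<partial>M)\<bar> \<le> nrm M G * nrm M F"
  using cmod_integral_mult_le[OF assms(2) sq_conj[OF assms(1)]] abs_Re_le_cmod[of "\<integral>y. G y * cnj (F y) \<partial>M"]
  by (simp add: nrm_conj)

lemma integral_self:
  assumes "F \<in> sq M" shows "(\<integral>y. F y * cnj (F y) \<partial>M) = of_real ((nrm M F)\<^sup>2)"
  unfolding nrm_power2 complex_norm_square[symmetric] by (rule integral_of_real[OF sq_integrable[OF assms]])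

lemma Re_integral_shift:
  assumes "F \<in> sq M" "G \<in> sq M"
  shows "Re (\<integral>y. (G y - z * F y) * cnj (F y) \<partial>M) = Re (\<integral>y. G y * cnj (F y) \<partial>M) - Re z * (nrm M F)\<^sup>2"
proof -
  have i1: "integrable M (\<lambda>y. G y * cnj (F y))" and i2: "integrable M (\<lambda>y. F y * cnj (F y))"
    by (intro sq_prod_integrable assms sq_conj)+
  have "(\<integral>y. (G y - z * F y) * cnj (F y) \<partial>M) = (\<integral>y. G y * cnj (F y) - z * (F y * cnj (F y)) \<partial>M)"
    by (simp add: algebra_simps)
  also have "\<dots> = (\<integral>y. G y * cnj (F y) \<partial>M) - z * of_real ((nrm M F)\<^sup>2)"
    unfolding Bochner_Integration.integral_diff[OF i1 integrable_mult_right[OF i2]] integral_mult_right_zero integral_self[OF assms(1)] ..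
  finally show ?thesis by simp
qed

text \<open>By the energy identity the real part of the product of \<open>G\<close> and
  \<open>F\<close> is not positive, hence the square of the norm of \<open>F\<close> is at most the
  real part of the product of \<open>F - s G\<close> with \<open>F\<close>.\<close>

lemma mode_op_dissipative:
  assumes op: "mode_op \<mu> \<nu> u k F G" and \<nu>: "0 < \<nu>" and \<mu>: "0 \<le> \<mu>" and u: "continuous_on UNIV u" and s: "0 \<le> s"
  shows "nrm circ F \<le> nrm circ (\<lambda>x. F x - of_real s * G x)"
proof -
  note F = mode_opD(1)[OF op] and G = mode_opD(2)[OF op]
  obtain V where "Re (\<integral>y. G y * cnj (F y) \<partial>circ) = - (\<nu> * (nrm circ V)\<^sup>2) - \<mu> * (of_int k)\<^sup>2 * (nrm circ F)\<^sup>2"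
    by (rule mode_op_regular[OF op \<nu> u])
  also have "\<dots> \<le> 0"
  proof -
    have "0 \<le> \<nu> * (nrm circ V)\<^sup>2" "0 \<le> \<mu> * (of_int k)\<^sup>2 * (nrm circ F)\<^sup>2" using \<nu> \<mu> by auto
    then show ?thesis by linarith
  qed
  finally have neg: "s * Re (\<integral>y. G y * cnj (F y) \<partial>circ) \<le> 0" using s by (simp add: mult_nonneg_nonpos)
  have i1: "integrable circ (\<lambda>y. G y * cnj (F y))" and i2: "integrable circ (\<lambda>y. F y * cnj (F y))"
    by (intro sq_prod_integrable F G sq_conj)+
  have "(\<integral>y. (F y - of_real s * G y) * cnj (F y) \<partial>circ) = (\<integral>y. F y * cnj (F y) - of_real s * (G y * cnj (F y)) \<partial>circ)"
    by (simp add: algebra_simps)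
  also have "\<dots> = of_real ((nrm circ F)\<^sup>2) - of_real s * (\<integral>y. G y * cnj (F y) \<partial>circ)"
    unfolding Bochner_Integration.integral_diff[OF i2 integrable_mult_right[OF i1]] integral_mult_right_zero integral_self[OF F] ..
  finally have "(nrm circ F)\<^sup>2 \<le> Re (\<integral>y. (F y - of_real s * G y) * cnj (F y) \<partial>circ)" using neg by simp
  also have "\<dots> \<le> nrm circ (\<lambda>x. F x - of_real s * G x) * nrm circ F"
    using Re_integral_le[OF F sq_diff[OF F sq_cmult[OF G, of "of_real s"]]] by linarith
  finally have "nrm circ F * nrm circ F \<le> nrm circ (\<lambda>x. F x - of_real s * G x) * nrm circ F" by (simp only: power2_eq_square)
  then show ?thesis
    by (cases "nrm circ F = 0") (auto simp: mult_le_cancel_right less_le)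
qed

section \<open>Cutting the circle at the nodes\<close>

lemma ivl_split:
  fixes h :: "real \<Rightarrow> real"
  assumes "a \<le> b" "b \<le> c" and h: "integrable (ivl a c) h"
  shows "integrable (ivl a b) h" "integrable (ivl b c) h"
    "integral\<^sup>L (ivl a c) h = integral\<^sup>L (ivl a b) h + integral\<^sup>L (ivl b c) h"
proof -
  have [measurable]: "h \<in> borel_measurable borel" using h by auto
  have i: "set_integrable lborel {a..c} h" using h by (simp add: integrable_ivl)
  have i1: "set_integrable lborel {a..b} h" "set_integrable lborel {b..c} h"
    using assms by (auto intro!: set_integrable_subset[OF i])
  then show "integrable (ivl a b) h" "integrable (ivl b c) h" by (simp_all add: integrable_ivl)
  have "(LINT x:{a..c}|lborel. h x) = (LINT x:{a..b} \<union> {b..c}|lborel. h x)"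
    using assms by (simp add: ivl_disj_un_two_touch(4))
  also have "\<dots> = (LINT x:{a..b}|lborel. h x) + (LINT x:{b..c}|lborel. h x)"
    by (rule set_integral_Un_AE[OF _ _ _ i1]) (use AE_lborel_singleton[of b] in \<open>auto elim: eventually_mono\<close>)
  finally show "integral\<^sup>L (ivl a c) h = integral\<^sup>L (ivl a b) h + integral\<^sup>L (ivl b c) h"
    by (simp add: integral_ivl)
qed

lemma node_0 [simp]: "node j 0 = 0" and node_last [simp]: "node j (3 ^ j) = 2 * pi"
  by (simp_all add: node_def)

lemma node_le: "i \<le> l \<Longrightarrow> node j i \<le> node j l"
  by (simp add: node_def divide_right_mono)

lemma integral_partition:
  fixes h :: "real \<Rightarrow> real"
  assumes h: "integrable circ h"
  shows "(\<And>i. i < 3 ^ j \<Longrightarrow> integrable (ivl (node j i) (node j (Suc i))) h)"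
    "integral\<^sup>L circ h = (\<Sum>i<3 ^ j. integral\<^sup>L (ivl (node j i) (node j (Suc i))) h)"
proof -
  have *: "integrable (ivl 0 (node j l)) h \<and> integral\<^sup>L (ivl 0 (node j l)) h = (\<Sum>i<l. integral\<^sup>L (ivl (node j i) (node j (Suc i))) h)
     \<and> (\<forall>i<l. integrable (ivl (node j i) (node j (Suc i))) h)" if "l \<le> 3 ^ j" for l
    using that
  proof (induction l)
    case 0
    have "integrable (ivl 0 0) h \<and> integral\<^sup>L (ivl 0 0) h = 0"
      using ivl_split(1,3)[of 0 0 "2 * pi" h] h by simp
    then show ?case by simp
  next
    case (Suc l)
    have i: "integrable (ivl 0 (node j (Suc l))) h"
    proof (rule ivl_split(1)[OF _ _ h])
      show "0 \<le> node j (Suc l)" using node_le[of 0 "Suc l" j] by simp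
      show "node j (Suc l) \<le> 2 * pi" using node_le[OF Suc.prems, of j] by simp
    qed
    have o: "0 \<le> node j l" "node j l \<le> node j (Suc l)" using node_le[of 0 l j] node_le[of l "Suc l" j] by auto
    show ?case using ivl_split[OF o i] i Suc by (auto simp: less_Suc_eq)
  qed
  from *[of "3 ^ j"] show "integral\<^sup>L circ h = (\<Sum>i<3 ^ j. integral\<^sup>L (ivl (node j i) (node j (Suc i))) h)"
    "(\<And>i. i < 3 ^ j \<Longrightarrow> integrable (ivl (node j i) (node j (Suc i))) h)"
    by auto
qed

lemma AE_ivl_subset:
  assumes "AE x in ivl a b. Q x" "a \<le> c" "d \<le> b" shows "AE x in ivl c d. Q x"
  using assms(1) unfolding AE_ivl by eventually_elim (use assms in auto)

section \<open>The lower bound for the mode operator at a fixed scale\<close>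

context lacunary
begin

text \<open>With \<open>q = 3 ^ (j + K)\<close>, integration by parts against
  \<open>sin (q * y)\<close>, which vanishes at both nodes, moves the lower bound of
  \<open>oscillation\<close> from \<open>u\<close> to the integral of
  \<open>\<psi> * cos (q * y)\<close>; the level \<open>l\<close> disappears because the sine has
  mean zero. Cauchy--Schwarz then bounds \<psi> from below, and \<open>q\<close> times the interval
  length is \<open>2 * pi * 3 ^ K\<close>, which explains the constant.\<close>

lemma interval_oscillation:
  assumes K: "36 * C\<^sub>0 * (2/3) ^ K \<le> 1"
    and \<psi>: "\<And>y. (\<psi> has_real_derivative (u y - l)) (at y)"
  shows "(\<bar>a (j + K)\<bar> / (8 * pi * 3 ^ K))\<^sup>2 * (node j (Suc i) - node j i) ^ 3
    \<le> (\<integral>y. (\<psi> y)\<^sup>2 \<partial>ivl (node j i) (node j (Suc i)))"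
proof -
  let ?M = "ivl (node j i) (node j (Suc i))"
  define d where "d = node j (Suc i) - node j i"
  define q :: real where "q = 3 ^ (j + K)"
  define m2 where "m2 = (\<integral>y. (\<psi> y)\<^sup>2 \<partial>?M)"
  define A where "A = \<bar>a (j + K)\<bar>"
  have ab: "node j i \<le> node j (Suc i)" using node_mono[of j i] by simp
  have d0: "0 < d" using node_mono[of j i] by (simp add: d_def)
  have q0: "0 < q" by (simp add: q_def)
  have \<psi>c: "continuous_on UNIV \<psi>" using \<psi> by (auto simp: continuous_on_eq_continuous_at intro: DERIV_isCont)
  have sn: "sin (q * node j i) = 0" "sin (q * node j (Suc i)) = 0" "cos (q * node j i) = 1" "cos (q * node j (Suc i)) = 1"
    unfolding q_def by (simp_all only: sin_node cos_node le_add1)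
  have parts: "(\<integral>y. (u y - l) * sin (q * y) + \<psi> y * (cos (q * y) * q) \<partial>?M) = 0"
  proof -
    have "((\<lambda>y. \<psi> y * sin (q * y)) has_vector_derivative ((u y - l) * sin (q * y) + \<psi> y * (cos (q * y) * q))) (at y)" for y
      unfolding has_real_derivative_iff_has_vector_derivative[symmetric]
      by (auto intro!: derivative_eq_intros \<psi>)
    then have "(\<integral>y. (u y - l) * sin (q * y) + \<psi> y * (cos (q * y) * q) \<partial>?M)
      = \<psi> (node j (Suc i)) * sin (q * node j (Suc i)) - \<psi> (node j i) * sin (q * node j i)"
      by (intro integral_ivl_FTC[where F="\<lambda>y. \<psi> y * sin (q * y)"] ab) (auto intro!: continuous_intros u_continuous \<psi>c)
    then show ?thesis by (simp add: sn)
  qed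
  have sin0: "(\<integral>y. sin (q * y) \<partial>?M) = 0"
  proof -
    have "((\<lambda>y. - cos (q * y) / q) has_vector_derivative (sin (q * y))) (at y)" for y
      unfolding has_real_derivative_iff_has_vector_derivative[symmetric]
      using q0 by (auto intro!: derivative_eq_intros)
    then have "(\<integral>y. sin (q * y) \<partial>?M) = - cos (q * node j (Suc i)) / q - - cos (q * node j i) / q"
      by (intro integral_ivl_FTC[where F="\<lambda>y. - cos (q * y) / q"] ab) (auto intro!: continuous_intros)
    then show ?thesis by (simp add: sn)
  qed
  have i1: "integrable ?M (\<lambda>y. u y * sin (q * y))" "integrable ?M (\<lambda>y. sin (q * y))" "integrable ?M (\<lambda>y. \<psi> y * cos (q * y))"
    by (intro integrable_ivl_continuous continuous_intros u_continuous \<psi>c)+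
  have "(\<integral>y. (u y - l) * sin (q * y) + \<psi> y * (cos (q * y) * q) \<partial>?M)
    = (\<integral>y. u y * sin (q * y) - l * sin (q * y) + q * (\<psi> y * cos (q * y)) \<partial>?M)"
    by (simp add: algebra_simps)
  also have "\<dots> = (\<integral>y. u y * sin (q * y) \<partial>?M) + q * (\<integral>y. \<psi> y * cos (q * y) \<partial>?M)"
    using i1 sin0 by simp
  finally have "(\<integral>y. u y * sin (q * y) \<partial>?M) = - (q * (\<integral>y. \<psi> y * cos (q * y) \<partial>?M))"
    using parts by simp
  then have "A * d / 4 \<le> q * \<bar>\<integral>y. \<psi> y * cos (q * y) \<partial>?M\<bar>"
    using oscillation[OF K, of j i] q0 by (simp add: q_def[symmetric] A_def d_def node_diff abs_mult)
  moreover have "\<bar>\<integral>y. \<psi> y * cos (q * y) \<partial>?M\<bar> \<le> sqrt m2 * sqrt d"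
  proof -
    have s: "(\<lambda>y. complex_of_real (\<psi> y)) \<in> sq ?M" "(\<lambda>y. complex_of_real (cos (q * y))) \<in> sq ?M"
      by (intro sq_ivl_continuous continuous_intros \<psi>c)+
    have "(\<integral>y. (cos (q * y))\<^sup>2 \<partial>?M) \<le> (node j (Suc i) - node j i) * 1"
      using ab by (intro integral_ivl_bounds integrable_ivl_continuous borel_measurable_continuous_onI continuous_intros)
        (auto simp: abs_square_le_1)
    then have "nrm ?M (\<lambda>y. complex_of_real (cos (q * y))) \<le> sqrt d" by (simp add: nrm_def d_def)
    moreover have "nrm ?M (\<lambda>y. complex_of_real (\<psi> y)) = sqrt m2" by (simp add: nrm_def m2_def)
    moreover have "\<bar>\<integral>y. \<psi> y * cos (q * y) \<partial>?M\<bar> \<le> (\<integral>y. \<bar>\<psi> y\<bar> * \<bar>cos (q * y)\<bar> \<partial>?M)"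
      using integral_abs_bound[of ?M "\<lambda>y. \<psi> y * cos (q * y)"] by (simp add: abs_mult)
    ultimately show ?thesis
      using Cauchy_Schwarz_nrm[OF s] mult_left_mono[of "nrm ?M (\<lambda>y. complex_of_real (cos (q * y)))" "sqrt d" "sqrt m2"]
      by (simp add: m2_def)
  qed
  ultimately have "A * d / 4 \<le> q * (sqrt m2 * sqrt d)"
    using q0 by (meson mult_left_mono order_trans less_imp_le)
  moreover have "0 \<le> m2" by (simp add: m2_def)
  ultimately have "(A * d / 4)\<^sup>2 \<le> (q * (sqrt m2 * sqrt d))\<^sup>2"
    using d0 by (intro power_mono) (auto simp: A_def)
  then have "(A * d / 4)\<^sup>2 \<le> q\<^sup>2 * (m2 * d)" using d0 \<open>0 \<le> m2\<close> by (simp add: power_mult_distrib)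
  then have "(A * d / 4)\<^sup>2 / (q\<^sup>2 * d) \<le> m2" using q0 d0 by (simp add: divide_le_eq mult_ac)
  moreover have "(A * d / 4)\<^sup>2 / (q\<^sup>2 * d) = (A / (8 * pi * 3 ^ K))\<^sup>2 * d ^ 3"
  proof -
    have q: "q = 2 * pi / d * 3 ^ K" by (simp add: q_def d_def node_diff power_add)
    show ?thesis unfolding q using d0 by (simp add: field_simps power2_eq_square power3_eq_cube)
  qed
  ultimately show ?thesis by (simp add: A_def d_def m2_def)
qed

text \<open>The sum of \<open>local_estimate\<close> over all intervals. The energy identity bounds
  the derivative \<open>V\<close> by \<open>e * X / \<nu>\<close>, and the source \<open>P\<close>
  has norm at most \<open>2 * e\<close>, which turns the factor 12 into 48.\<close>

lemma mode_estimate: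
  fixes k :: int
  assumes K: "36 * C\<^sub>0 * (2/3) ^ K \<le> 1"
    and op: "mode_op \<mu> \<nu> u k F G" and \<nu>: "0 < \<nu>" and \<mu>: "0 \<le> \<mu>" and k: "k \<noteq> 0" and z: "0 \<le> Re z"
    and r: "0 < r" "r \<le> \<bar>a (j + K)\<bar> / (8 * pi * 3 ^ K)" and d: "d = 2 * pi / 3 ^ j"
    and X: "X = nrm circ F" and e: "e = nrm circ (\<lambda>y. G y - z * F y)"
  shows "X\<^sup>2 \<le> 48 / (of_int k * r)\<^sup>2 * e\<^sup>2 + (20 * d\<^sup>2 + 6 * \<nu>\<^sup>2 / (of_int k * d * r)\<^sup>2) * (e * X / \<nu>)"
proof -
  note F = mode_opD(1)[OF op] and G = mode_opD(2)[OF op]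
  define H where "H y = (G y + of_real (\<mu> * (of_int k)\<^sup>2) * F y + \<i> * of_real (of_int k * u y) * F y) / of_real \<nu>" for y
  obtain f V where f: "\<And>y. (f has_vector_derivative V y) (at y)" and V: "continuous_on UNIV V"
    and Ff: "AE y in circ. F y = f y" and Hs: "H \<in> sq circ"
    and VH: "\<And>y. V y = V 0 + (\<integral>s. indicator {..y} s *\<^sub>R H s \<partial>circ)"
    and en: "Re (\<integral>y. G y * cnj (F y) \<partial>circ) = - (\<nu> * (nrm circ V)\<^sup>2) - \<mu> * (of_int k)\<^sup>2 * (nrm circ F)\<^sup>2"
    using mode_op_regular[OF op \<nu> u_continuous] unfolding H_def[abs_def] by blast
  have fc: "continuous_on UNIV f"
    using f by (auto simp: continuous_on_eq_continuous_at intro: has_vector_derivative_continuous)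
  have Vs: "V \<in> sq circ" by (intro sq_ivl_continuous V)
  \<comment> \<open>The spectral parameter is split. Its imaginary part becomes a level
    \<open>l\<close> subtracted from \<open>u\<close>, harmless because the oscillation bound is
    uniform in the level. Its real part and \<open>\<mu> k^2\<close> go into the source, where the
    energy identity bounds them by \<open>\<beta> * X \<le> e\<close>.\<close>
  define \<beta> where "\<beta> = Re z + \<mu> * (of_int k)\<^sup>2"
  define l where "l = - Im z / of_int k"
  define P where "P y = (G y - z * F y) + of_real \<beta> * F y" for y
  have \<beta>0: "0 \<le> \<beta>" using z \<mu> by (simp add: \<beta>_def)
  have Es: "(\<lambda>y. G y - z * F y) \<in> sq circ" by (intro sq_diff G sq_cmult F)
  have Ps: "P \<in> sq circ" unfolding P_def[abs_def] by (intro sq_add Es sq_cmult F)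
  have X0: "0 \<le> X" and e0: "0 \<le> e" by (simp_all add: X e)
  have energy: "\<nu> * (nrm circ V)\<^sup>2 + \<beta> * X\<^sup>2 \<le> e * X"
  proof -
    have "- (\<nu> * (nrm circ V)\<^sup>2 + \<beta> * X\<^sup>2) = Re (\<integral>y. (G y - z * F y) * cnj (F y) \<partial>circ)"
      unfolding Re_integral_shift[OF F G] en by (simp add: \<beta>_def X algebra_simps)
    then show ?thesis using Re_integral_le[OF F Es] by (simp add: X e)
  qed
  have V2: "(nrm circ V)\<^sup>2 \<le> e * X / \<nu>"
  proof -
    have "\<nu> * (nrm circ V)\<^sup>2 \<le> e * X" using energy mult_nonneg_nonneg[OF \<beta>0 zero_le_power2[of X]] by linarith
    then show ?thesis using \<nu> by (simp add: field_simps)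
  qed
  have \<beta>X: "\<beta> * X \<le> e"
  proof (cases "X = 0")
    case False
    then have "0 < X" using X0 by simp
    moreover have "(\<beta> * X) * X \<le> e * X"
    proof -
      have "0 \<le> \<nu> * (nrm circ V)\<^sup>2" using \<nu> by simp
      then have "\<beta> * X\<^sup>2 \<le> e * X" using energy by linarith
      then show ?thesis by (simp add: power2_eq_square mult.assoc)
    qed
    ultimately show ?thesis by simp
  qed (use e0 in simp)
  have P2: "(nrm circ P)\<^sup>2 \<le> 4 * e\<^sup>2"
  proof -
    have "nrm circ P \<le> e + \<beta> * X"
      using nrm_triangle[OF Es sq_cmult[OF F, of "of_real \<beta>"]] \<beta>0 by (simp add: P_def[abs_def] nrm_cmult X e)
    then have "nrm circ P \<le> 2 * e" using \<beta>X by simp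
    then have "(nrm circ P)\<^sup>2 \<le> (2 * e)\<^sup>2" by (intro power_mono) auto
    then show ?thesis by (simp add: power_mult_distrib)
  qed
  let ?k = "real_of_int k"
  let ?I = "\<lambda>i. ivl (node j i) (node j (Suc i))"
  define U where "U y = u y - l" for y
  have Uc: "continuous_on UNIV U" unfolding U_def by (intro continuous_intros u_continuous)
  have eq: "AE y in circ. of_real \<nu> * H y = \<i> * of_real (?k * U y) * f y + P y"
    using Ff
  proof eventually_elim
    case (elim y)
    have "of_real \<nu> * H y = G y + of_real (\<mu> * ?k\<^sup>2) * F y + \<i> * of_real (?k * u y) * F y"
      using \<nu> by (simp add: H_def)
    moreover have kl: "?k * l = - Im z" using k by (simp add: l_def)
    have "z = of_real (Re z) + \<i> * of_real (Im z)" by (simp add: complex_eq_iff)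
    then have "z = of_real (Re z) - \<i> * of_real (?k * l)" by (simp add: kl)
    then have "P y = G y - (of_real (Re z) - \<i> * of_real (?k * l)) * F y + of_real \<beta> * F y" by (simp add: P_def)
    ultimately show ?case
      by (simp add: U_def \<beta>_def elim[symmetric] algebra_simps)
  qed
  define C1 where "C1 = 12 / (?k * r)\<^sup>2"
  define C2 where "C2 = 20 * d\<^sup>2 + 6 * \<nu>\<^sup>2 / (?k * d * r)\<^sup>2"
  have loc: "(\<integral>y. (cmod (f y))\<^sup>2 \<partial>?I i) \<le> C1 * (\<integral>y. (cmod (P y))\<^sup>2 \<partial>?I i) + C2 * (\<integral>y. (cmod (V y))\<^sup>2 \<partial>?I i)"
    if i: "i < 3 ^ j" for i
  proof -
    have lo: "0 \<le> node j i" using node_le[of 0 i j] by simp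
    have hi: "node j (Suc i) \<le> 2 * pi" using node_le[of "Suc i" "3 ^ j" j] i by simp
    have lt: "node j i < node j (Suc i)" by (rule node_mono)
    have d': "node j (Suc i) - node j i = d" by (simp add: node_diff d)
    have [measurable]: "H \<in> borel_measurable borel" "P \<in> borel_measurable borel" using sq_meas[OF Hs] sq_meas[OF Ps] by auto
    have Hi: "integrable circ H" by (rule sq_integrable1[OF finite_measure_ivl Hs])
    have HI: "integrable (?I i) H"
      using Hi lo hi by (auto simp: integrable_ivl intro!: set_integrable_subset[where A="{0..2*pi}"])
    have PI: "P \<in> sq (?I i)"
      using integral_partition(1)[OF sq_integrable[OF Ps] i] by (intro sqI) auto
    have "\<exists>W. \<forall>x. - \<infinity> < ereal x \<longrightarrow> ereal x < \<infinity> \<longrightarrow> (W has_vector_derivative U x) (at x)"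
      by (rule einterval_antiderivative) (use Uc in \<open>auto simp: continuous_on_eq_continuous_at\<close>)
    then obtain W where W: "\<And>y. (W has_vector_derivative U y) (at y)" by auto
    define \<psi> where "\<psi> y = W y - (\<integral>y. W y \<partial>?I i) / (node j (Suc i) - node j i)" for y
    have \<psi>: "(\<psi> has_real_derivative U y) (at y)" for y
      unfolding \<psi>_def[abs_def] has_real_derivative_iff_has_vector_derivative
      using has_vector_derivative_diff[OF W has_vector_derivative_const] by simp
    have Wc: "continuous_on UNIV W"
      using W by (auto simp: continuous_on_eq_continuous_at intro: has_vector_derivative_continuous)
    have mean: "(\<integral>y. \<psi> y \<partial>?I i) = 0"
      using integrable_ivl_continuous[OF Wc, of "node j i" "node j (Suc i)"] measure_ivl[of "node j i" "node j (Suc i)"] lt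
      by (simp add: \<psi>_def[abs_def])
    have low: "r\<^sup>2 * (node j (Suc i) - node j i) ^ 3 \<le> (\<integral>y. (\<psi> y)\<^sup>2 \<partial>?I i)"
    proof -
      have "r\<^sup>2 * (node j (Suc i) - node j i) ^ 3 \<le> (\<bar>a (j + K)\<bar> / (8 * pi * 3 ^ K))\<^sup>2 * (node j (Suc i) - node j i) ^ 3"
        using r lt by (intro mult_right_mono power_mono) auto
      also have "\<dots> \<le> (\<integral>y. (\<psi> y)\<^sup>2 \<partial>?I i)"
        by (rule interval_oscillation[OF K \<psi>[unfolded U_def]])
      finally show ?thesis .
    qed
    have VI: "V y = V (node j i) + (\<integral>s. indicator {..y} s *\<^sub>R H s \<partial>?I i)" if y: "y \<in> {node j i..node j (Suc i)}" for y
    proof -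
      have "V y - V (node j i) = (\<integral>s. indicator {..y} s *\<^sub>R H s \<partial>circ) - (\<integral>s. indicator {..node j i} s *\<^sub>R H s \<partial>circ)"
        using VH[of y] VH[of "node j i"] by simp
      also have "\<dots> = (\<integral>s. indicator {..y} s *\<^sub>R H s - indicator {..node j i} s *\<^sub>R H s \<partial>circ)"
        using integrable_mult_indicator[OF _ Hi, of "{..y}"] integrable_mult_indicator[OF _ Hi, of "{..node j i}"] by simp
      also have "\<dots> = (LINT s:{0..2*pi}|lborel. indicator {..y} s *\<^sub>R H s - indicator {..node j i} s *\<^sub>R H s)"
        by (rule integral_ivl) measurable
      also have "\<dots> = (LINT s:{node j i..node j (Suc i)}|lborel. indicator {..y} s *\<^sub>R H s)"
        unfolding set_lebesgue_integral_def
      proof (rule integral_cong_AE)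
        show "AE s in lborel. indicator {0..2*pi} s *\<^sub>R (indicator {..y} s *\<^sub>R H s - indicator {..node j i} s *\<^sub>R H s)
            = indicator {node j i..node j (Suc i)} s *\<^sub>R indicator {..y} s *\<^sub>R H s"
          using AE_lborel_singleton[of "node j i"]
          by eventually_elim (use y lo hi in \<open>auto split: split_indicator\<close>)
      qed measurable
      also have "\<dots> = (\<integral>s. indicator {..y} s *\<^sub>R H s \<partial>?I i)"
        by (rule integral_ivl[symmetric]) measurable
      finally show ?thesis unfolding diff_eq_eq by (simp only: add.commute)
    qed
    have eqI: "AE y in ?I i. of_real \<nu> * H y = \<i> * of_real (?k * U y) * f y + P y"
      by (rule AE_ivl_subset[OF eq lo hi])
    show ?thesis
      using local_estimate[OF lt _ r(1) f V HI VI PI eqI \<psi> Uc mean low] k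
      unfolding d' C1_def C2_def by simp
  qed
  have if2: "integrable circ (\<lambda>y. (cmod (f y))\<^sup>2)" "integrable circ (\<lambda>y. (cmod (V y))\<^sup>2)"
    by (intro integrable_ivl_continuous continuous_intros fc V)+
  have "X\<^sup>2 = (\<integral>y. (cmod (f y))\<^sup>2 \<partial>circ)"
    unfolding X nrm_power2[symmetric] using nrm_cong_AE[OF _ _ Ff] sq_meas[OF F] borel_measurable_continuous_onI[OF fc] by simp
  also have "\<dots> = (\<Sum>i<3 ^ j. \<integral>y. (cmod (f y))\<^sup>2 \<partial>?I i)"
    by (rule integral_partition(2)[OF if2(1)])
  also have "\<dots> \<le> (\<Sum>i<3 ^ j. C1 * (\<integral>y. (cmod (P y))\<^sup>2 \<partial>?I i) + C2 * (\<integral>y. (cmod (V y))\<^sup>2 \<partial>?I i))"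
    by (intro sum_mono loc) simp
  also have "\<dots> = C1 * (nrm circ P)\<^sup>2 + C2 * (nrm circ V)\<^sup>2"
    unfolding nrm_power2 integral_partition(2)[OF if2(2), of j] integral_partition(2)[OF sq_integrable[OF Ps], of j]
    by (simp add: sum.distrib sum_distrib_left)
  also have "\<dots> \<le> C1 * (4 * e\<^sup>2) + C2 * (e * X / \<nu>)"
    by (intro add_mono mult_left_mono P2 V2) (auto simp: C1_def C2_def)
  finally show ?thesis by (simp add: C1_def C2_def)
qed

end

section \<open>Choice of the scale and the resolvent bound\<close>

lemma quadratic_absorb:
  fixes X x B :: real
  assumes "0 \<le> X" "0 \<le> x" "0 \<le> B" "X\<^sup>2 \<le> 48 * x\<^sup>2 + B * (x * X)"
  shows "X \<le> (48 + B) * x"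
proof (cases "x < X")
  case True
  have "X * X \<le> 48 * (x * x) + B * (x * X)" using assms(4) by (simp add: power2_eq_square)
  \<comment> \<open>When \<open>X\<close> exceeds \<open>x\<close>, one factor \<open>x\<close> may
    be raised to \<open>X\<close>, after which a factor \<open>X\<close> cancels.\<close>
  also have "\<dots> \<le> 48 * (x * X) + B * (x * X)" using True assms by (intro add_right_mono mult_left_mono) auto
  finally have "X * X \<le> ((48 + B) * x) * X" by (simp add: algebra_simps)
  then show ?thesis using True assms(2) by (simp add: mult_le_cancel_right)
next
  case False
  have "X \<le> 1 * x" using False by simp
  also have "\<dots> \<le> (48 + B) * x" using assms by (intro mult_right_mono) auto
  finally show ?thesis .
qed

text \<open>Powers of 1/9, since the squared interval length is \<open>4 * pi^2 * (1/9) ^ j\<close>.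
  The exponent is the last one whose power is not below \<open>t\<close>.\<close>

lemma geometric_scale:
  fixes t :: real
  assumes "0 < t" "t \<le> 1"
  obtains j :: nat where "t \<le> (1/9) ^ j" "(1/9) ^ j < 9 * t"
proof -
  have "\<exists>n. (1/9 :: real) ^ n < t" using real_arch_pow_inv[of t "1/9"] assms by auto
  define m where "m = (LEAST n. (1/9 :: real) ^ n < t)"
  have m: "(1/9) ^ m < t" unfolding m_def by (rule LeastI_ex) fact
  then have "m \<noteq> 0" using assms by (intro notI) simp
  then obtain j where j: "m = Suc j" by (cases m) auto
  have "\<not> (1/9) ^ j < t" using not_less_Least[of j "\<lambda>n. (1/9 :: real) ^ n < t"] j unfolding m_def[symmetric] by simp
  then show thesis using that[of j] m j by simp
qed

context lacunary
begin

text \<open>The target \<open>v * L powr \<alpha>\<close> is halved because it can exceed 1: from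
  \<alpha> < 2 one has only v (1 + L)^2 \<le> 2 v exp L = 2. Conversely \<open>L\<close> is at least
  \<open>ln 2\<close>, so the halved target is at least \<open>exp (- L) / 8\<close>; hence
  \<open>j\<close> is at most a multiple of \<open>L\<close>, and
  \<open>\<bar>a (j + K)\<bar>\<close> cannot be smaller than order L^-\<alpha>.\<close>

lemma scale_choice:
  assumes \<nu>: "0 < v" "v \<le> 1/2"
  defines "L \<equiv> ln (1 / v)"
  obtains j :: nat where "0 < L" "real (j + K) \<le> (4 + 2 * real K) * L"
    "v * L powr \<alpha> / 2 \<le> (1/9) ^ j" "(1/9) ^ j < 9 * (v * L powr \<alpha> / 2)"
proof -
  have ev: "v = exp (- L)" using \<nu> by (simp add: L_def ln_div)
  have ln2: "1/2 \<le> ln (2::real)"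
    using ln_add_one_self_le_self2[of "-1/2::real"] by (simp add: ln_div)
  have L2: "ln 2 \<le> L" unfolding L_def using \<nu> by (subst ln_le_cancel_iff) (auto simp: field_simps)
  then have Lh: "1/2 \<le> L" using ln2 by simp
  define A where "A = L powr \<alpha>"
  have A0: "0 < A" using Lh by (simp add: A_def)
  have "A \<le> (1 + L) powr \<alpha>" unfolding A_def using Lh \<alpha> by (intro powr_mono2) auto
  also have "\<dots> \<le> (1 + L) powr 2" using Lh \<alpha> by (intro powr_mono) auto
  also have "\<dots> = (1 + L)\<^sup>2" using Lh by simp
  also have "\<dots> \<le> 2 * exp L" using exp_lower_Taylor_quadratic[of L] Lh by (simp add: power2_eq_square algebra_simps)
  finally have "v * A \<le> v * (2 * exp L)" using \<nu> by (intro mult_left_mono) auto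
  also have "\<dots> = 2" by (simp add: ev exp_minus)
  finally have t1: "v * A / 2 \<le> 1" by simp
  have t0: "0 < v * A / 2" using \<nu> A0 by simp
  obtain j where j: "v * A / 2 \<le> (1/9) ^ j" "(1/9) ^ j < 9 * (v * A / 2)"
    using geometric_scale[OF t0 t1] .
  have A4: "1/4 \<le> A"
  proof -
    have "(1/4::real) = (1/2) powr 2" by (simp add: power2_eq_square)
    also have "\<dots> \<le> (1/2) powr \<alpha>" using \<alpha> by (intro powr_mono') auto
    also have "\<dots> \<le> A" unfolding A_def using Lh \<alpha> by (intro powr_mono2) auto
    finally show ?thesis .
  qed
  have "exp (- L) / 8 \<le> v * A / 2" using A4 \<nu> by (simp add: ev[symmetric])
  also have "\<dots> \<le> (1/9) ^ j" by (rule j(1))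
  finally have "ln (exp (- L) / 8) \<le> ln ((1/9) ^ j)" by (subst ln_le_cancel_iff) auto
  moreover have "ln (exp (- L) / 8) = - L - 3 * ln 2"
    using ln_realpow[of 2 3] by (simp add: ln_div)
  moreover have "ln ((1/9::real) ^ j) = - (real j * ln 9)" by (simp add: ln_realpow ln_div)
  ultimately have "real j * ln 9 \<le> L + 3 * ln 2" by simp
  also have "\<dots> \<le> 4 * L" using L2 by simp
  finally have "real j * ln 9 \<le> 4 * L" .
  moreover have "real j * 1 \<le> real j * ln 9"
  proof (rule mult_left_mono)
    have "exp 1 \<le> (9::real)" using exp_le by simp
    then show "1 \<le> ln (9::real)" by (subst ln_ge_iff) auto
  qed simp
  ultimately have "real j \<le> 4 * L" by simp
  moreover have "real K * 1 \<le> real K * (2 * L)" using Lh by (intro mult_left_mono) auto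
  ultimately have "real (j + K) \<le> (4 + 2 * real K) * L" by (simp add: algebra_simps)
  then show thesis using that[of j] j Lh by (simp add: A_def)
qed

text \<open>Write \<open>q = \<bar>k\<bar> * r\<close>, which is the desired rate up to a constant.
  In the unit \<open>e / q\<close> the coefficients of \<open>mode_estimate\<close> become
  \<open>d^2 * (q / \<nu>)\<close> and \<open>\<nu> / q / d^2\<close>, and the choice of scale
  bounds both independently of \<nu> and \<open>k\<close>. What remains is a quadratic inequality
  for \<open>X\<close>.\<close>

lemma mode_resolvent:
  obtains c where "0 < c"
    "\<And>\<mu> \<nu> k F G z. mode_op \<mu> \<nu> u k F G \<Longrightarrow> 0 < \<nu> \<Longrightarrow> 0 \<le> \<mu> \<Longrightarrow> k \<noteq> 0 \<Longrightarrow> \<nu> / \<bar>of_int k\<bar> \<le> 1 / 2 \<Longrightarrow> 0 \<le> Re z \<Longrightarrow>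
      c * lambda_rate \<alpha> \<nu> k * nrm circ F \<le> nrm circ (\<lambda>y. G y - z * F y)"
proof -
  obtain K where "(2/3::real) ^ K < 1 / (36 * C\<^sub>0)"
    using real_arch_pow_inv[of "1 / (36 * C\<^sub>0)" "2/3"] C0 by auto
  then have K: "36 * C\<^sub>0 * (2/3) ^ K \<le> 1" using C0 by (simp add: field_simps)
  \<comment> \<open>The constant of \<open>interval_oscillation\<close> times the loss in replacing
    \<open>j + K\<close> by \<open>(4 + 2 * real K) * L\<close>, where \<alpha> < 2 allows the power
    -2 in place of -\<alpha>.\<close>
  define c1 where "c1 = 1 / (8 * pi * 3 ^ K) / (4 + 2 * real K)\<^sup>2"
  have c10: "0 < c1" by (simp add: c1_def)
  define B where "B = 20 * (18 * pi\<^sup>2 * c1) + 6 * (1 / (2 * pi\<^sup>2 * c1))"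
  have B0: "0 \<le> B" using c10 by (simp add: B_def)
  show thesis
  proof (rule that[of "c1 / (48 + B)"])
    show "0 < c1 / (48 + B)" using c10 B0 by simp
    fix \<mu> \<nu> :: real and k :: int and F G :: "real \<Rightarrow> complex" and z :: complex
    assume op: "mode_op \<mu> \<nu> u k F G" and \<nu>: "0 < \<nu>" and \<mu>: "0 \<le> \<mu>" and k: "k \<noteq> 0"
      and small: "\<nu> / \<bar>of_int k\<bar> \<le> 1 / 2" and z: "0 \<le> Re z"
    let ?k = "real_of_int k"
    define v where "v = \<nu> / \<bar>?k\<bar>"
    define L where "L = ln (1 / v)"
    have k0: "0 < \<bar>?k\<bar>" using k by simp
    have v0: "0 < v" using \<nu> k0 by (simp add: v_def)
    have vh: "v \<le> 1/2" using small by (simp add: v_def)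
    obtain j where L0: "0 < L" and jK: "real (j + K) \<le> (4 + 2 * real K) * L"
      and j1: "v * L powr \<alpha> / 2 \<le> (1/9) ^ j" and j2: "(1/9) ^ j < 9 * (v * L powr \<alpha> / 2)"
      using scale_choice[OF v0 vh, where K=K] unfolding L_def[symmetric] .
    define r where "r = c1 * L powr (- \<alpha>)"
    have r0: "0 < r" using c10 L0 by (simp add: r_def)
    have K1: "1 \<le> K" using K C0 by (cases K) auto
    have r1: "r \<le> \<bar>a (j + K)\<bar> / (8 * pi * 3 ^ K)"
    proof -
      have "(4 + 2 * real K) powr (- 2) * L powr (- \<alpha>) \<le> (4 + 2 * real K) powr (- \<alpha>) * L powr (- \<alpha>)"
        using \<alpha> by (intro mult_right_mono powr_mono) auto
      also have "\<dots> = ((4 + 2 * real K) * L) powr (- \<alpha>)" using L0 by (simp add: powr_mult)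
      also have "\<dots> \<le> real (j + K) powr (- \<alpha>)" using jK K1 \<alpha> by (intro powr_mono2') auto
      also have "\<dots> \<le> \<bar>a (j + K)\<bar>" using K1 by (intro a_lower) auto
      finally have "L powr (- \<alpha>) / (4 + 2 * real K)\<^sup>2 \<le> \<bar>a (j + K)\<bar>"
        by (simp add: powr_minus divide_inverse mult.commute)
      then have "L powr (- \<alpha>) / (4 + 2 * real K)\<^sup>2 / (8 * pi * 3 ^ K) \<le> \<bar>a (j + K)\<bar> / (8 * pi * 3 ^ K)"
        by (intro divide_right_mono) auto
      then show ?thesis by (simp add: r_def c1_def mult_ac)
    qed
    define d where "d = 2 * pi / 3 ^ j"
    define X where "X = nrm circ F"
    define e where "e = nrm circ (\<lambda>y. G y - z * F y)"
    have X0: "0 \<le> X" and e0: "0 \<le> e" by (simp_all add: X_def e_def)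
    have est: "X\<^sup>2 \<le> 48 / (?k * r)\<^sup>2 * e\<^sup>2 + (20 * d\<^sup>2 + 6 * \<nu>\<^sup>2 / (?k * d * r)\<^sup>2) * (e * X / \<nu>)"
      by (rule mode_estimate[OF K op \<nu> \<mu> k z r0 r1 d_def X_def e_def])
    define q where "q = \<bar>?k\<bar> * r"
    have q0: "0 < q" using k0 r0 by (simp add: q_def)
    define \<theta> where "\<theta> = v * L powr \<alpha>"
    have \<theta>0: "0 < \<theta>" using v0 L0 by (simp add: \<theta>_def)
    \<comment> \<open>Since \<open>d^2\<close> lies between \<open>2 * pi^2 * \<theta>\<close> and
      \<open>18 * pi^2 * \<theta>\<close>, the quantity \<theta> cancels in both products, which
      gives the two constants in \<open>B\<close>.\<close>
    have q\<nu>: "q / \<nu> = c1 / \<theta>"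
      using k0 \<nu> L0 by (simp add: q_def r_def \<theta>_def v_def powr_minus field_simps)
    have d2: "d\<^sup>2 = 4 * pi\<^sup>2 * (1/9) ^ j"
    proof -
      have "(3 ^ j)\<^sup>2 = (9::real) ^ j" by (simp add: power2_eq_square power_mult_distrib[symmetric])
      then show ?thesis unfolding d_def power_divide power_mult_distrib by simp
    qed
    have d20: "0 < d\<^sup>2" by (simp add: d_def)
    have A1: "d\<^sup>2 * (q / \<nu>) \<le> 18 * pi\<^sup>2 * c1"
    proof -
      have "d\<^sup>2 \<le> 4 * pi\<^sup>2 * (9 * (\<theta> / 2))" unfolding d2 using j2 by (intro mult_left_mono) (auto simp: \<theta>_def)
      then have "d\<^sup>2 * (c1 / \<theta>) \<le> 4 * pi\<^sup>2 * (9 * (\<theta> / 2)) * (c1 / \<theta>)"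
        using c10 \<theta>0 by (intro mult_right_mono) auto
      then show ?thesis unfolding q\<nu> using \<theta>0 by simp
    qed
    have A2: "\<nu> / q / d\<^sup>2 \<le> 1 / (2 * pi\<^sup>2 * c1)"
    proof -
      have "4 * pi\<^sup>2 * (\<theta> / 2) \<le> d\<^sup>2" unfolding d2 using j1 by (intro mult_left_mono) (auto simp: \<theta>_def)
      then have "\<theta> / c1 / d\<^sup>2 \<le> \<theta> / c1 / (4 * pi\<^sup>2 * (\<theta> / 2))"
        using c10 \<theta>0 by (intro divide_left_mono mult_pos_pos d20) auto
      also have "\<dots> = 1 / (2 * pi\<^sup>2 * c1)" using c10 \<theta>0 by (simp add: field_simps)
      finally have "\<theta> / c1 / d\<^sup>2 \<le> 1 / (2 * pi\<^sup>2 * c1)" .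
      moreover have "\<nu> / q = \<theta> / c1" using arg_cong[OF q\<nu>, of inverse] by simp
      ultimately show ?thesis by (simp only:)
    qed
    have t1: "48 / (?k * r)\<^sup>2 * e\<^sup>2 = 48 * (e / q)\<^sup>2"
      by (simp add: q_def power_divide power_mult_distrib)
    have t2: "(20 * d\<^sup>2 + 6 * \<nu>\<^sup>2 / (?k * d * r)\<^sup>2) * (e * X / \<nu>) = (20 * (d\<^sup>2 * (q / \<nu>)) + 6 * (\<nu> / q / d\<^sup>2)) * (e / q * X)"
    proof -
      have kdr: "(?k * d * r)\<^sup>2 = q\<^sup>2 * d\<^sup>2" by (simp add: q_def power_mult_distrib)
      have "(20 * D + 6 * \<nu>\<^sup>2 / (q\<^sup>2 * D)) * (e * X / \<nu>) = (20 * (D * (q / \<nu>)) + 6 * (\<nu> / q / D)) * (e / q * X)"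
        if "0 < D" for D
        using q0 \<nu> that by (simp add: field_simps power2_eq_square)
      from this[OF d20] show ?thesis unfolding kdr .
    qed
    have "X\<^sup>2 \<le> 48 * (e / q)\<^sup>2 + B * (e / q * X)"
    proof -
      have "(20 * (d\<^sup>2 * (q / \<nu>)) + 6 * (\<nu> / q / d\<^sup>2)) * (e / q * X) \<le> B * (e / q * X)"
        unfolding B_def using e0 X0 q0 by (intro mult_right_mono add_mono mult_left_mono A1 A2) auto
      then show ?thesis using est unfolding t1 t2 by linarith
    qed
    then have "X \<le> (48 + B) * (e / q)"
      using X0 e0 q0 B0 by (intro quadratic_absorb) auto
    then have main: "q / (48 + B) * X \<le> e" using q0 B0 by (simp add: field_simps)
    have "lambda_rate \<alpha> \<nu> k = \<bar>?k\<bar> * L powr (- \<alpha>)" by (simp add: lambda_rate_def L_def v_def)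
    then have "c1 / (48 + B) * lambda_rate \<alpha> \<nu> k = q / (48 + B)" by (simp add: q_def r_def)
    then show "c1 / (48 + B) * lambda_rate \<alpha> \<nu> k * nrm circ F \<le> nrm circ (\<lambda>y. G y - z * F y)"
      using main by (simp only: X_def e_def)
  qed
qed

end

section \<open>Functions on the torus\<close>

abbreviation tor :: "(real \<times> real) measure" where "tor \<equiv> circ \<Otimes>\<^sub>M circ"

lemma cis_borel [measurable]: "cis \<in> borel_measurable borel"
  by (intro borel_measurable_continuous_onI continuous_intros)

interpretation tor: pair_sigma_finite circ circ ..

text \<open>Links the product of two circles, on which Fubini is applied, with the planar Lebesgue
  measure on \<open>cell\<close> from the definitions.\<close>

lemma tor_eq: "tor = density lborel (\<lambda>z. ennreal (indicator cell z))"
proof -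
  have "tor = density (lborel \<Otimes>\<^sub>M lborel) (\<lambda>(x, y). ennreal (indicator {0..2*pi} x) * ennreal (indicator {0..2*pi} y))"
    unfolding ivl_def
    by (rule pair_measure_density) (use ivl.sigma_finite_measure_axioms[unfolded ivl_def] lborel.sigma_finite_measure_axioms in auto)
  also have "(\<lambda>(x, y). ennreal (indicator {0..2*pi} x) * ennreal (indicator {0..2*pi} y)) = (\<lambda>z. ennreal (indicator cell z))"
    by (auto simp: cell_def fun_eq_iff split: split_indicator)
  finally show ?thesis by (simp add: lborel_prod)
qed

lemma sets_tor: "sets tor = sets borel" unfolding tor_eq by simp

lemma meas_tor: "borel_measurable tor = borel_measurable borel"
  by (rule measurable_cong_sets[OF sets_tor refl])

lemma finite_measure_tor: "finite_measure tor"
  by (rule finite_measure_pair_measure) (rule finite_measure_ivl)+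

lemma cell_borel [measurable]: "cell \<in> sets borel"
  unfolding cell_def by (intro borel_closed closed_Times) auto

lemma integral_tor:
  fixes f :: "real \<times> real \<Rightarrow> 'b :: {banach, second_countable_topology}"
  assumes "f \<in> borel_measurable borel"
  shows "integral\<^sup>L tor f = (LINT z:cell|lborel. f z)"
  unfolding tor_eq set_lebesgue_integral_def using assms by (subst integral_density) auto

lemma integrable_tor:
  fixes f :: "real \<times> real \<Rightarrow> 'b :: {banach, second_countable_topology}"
  assumes "f \<in> borel_measurable borel"
  shows "integrable tor f \<longleftrightarrow> set_integrable lborel cell f"
  unfolding tor_eq set_integrable_def using assms by (subst integrable_density) auto

lemma AE_tor: "AE z in lborel. P z \<Longrightarrow> AE z in tor. P z"
  unfolding tor_eq by (subst AE_density) (auto elim: eventually_mono)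

lemma L2_T2_iff: "f \<in> L2_T2 \<longleftrightarrow> f \<in> sq tor \<and> periodic2 f"
  unfolding L2_T2_def sq_def meas_tor by (auto simp: integrable_tor)

lemma L2_T2_sq: "f \<in> L2_T2 \<Longrightarrow> f \<in> sq tor" and L2_T2_periodic: "f \<in> L2_T2 \<Longrightarrow> periodic2 f"
  and L2_T2_meas: "f \<in> L2_T2 \<Longrightarrow> f \<in> borel_measurable borel"
  unfolding L2_T2_iff sq_def meas_tor by auto

lemma L2_norm_eq: "f \<in> borel_measurable borel \<Longrightarrow> L2_norm f = nrm tor f"
  unfolding L2_norm_def nrm_def by (subst integral_tor) auto

lemma L2_T2_lincomb:
  assumes "f \<in> L2_T2" "g \<in> L2_T2" shows "(\<lambda>z. c * f z + d * g z) \<in> L2_T2"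
  using assms unfolding L2_T2_iff periodic2_def by auto

lemma sections:
  assumes [measurable]: "f \<in> borel_measurable tor"
  shows "(\<lambda>x. f (x, y)) \<in> borel_measurable borel" "(\<lambda>y. f (x, y)) \<in> borel_measurable borel"
  by measurable

lemma sq_tor_sections:
  assumes f: "f \<in> sq tor"
  shows "AE y in circ. (\<lambda>x. f (x, y)) \<in> sq circ"
    "integrable circ (\<lambda>y. \<integral>x. (cmod (f (x, y)))\<^sup>2 \<partial>circ)"
    "(\<integral>y. (\<integral>x. (cmod (f (x, y)))\<^sup>2 \<partial>circ) \<partial>circ) = (nrm tor f)\<^sup>2"
proof -
  have i: "integrable tor (\<lambda>(x, y). (cmod (f (x, y)))\<^sup>2)" using sq_integrable[OF f] by (simp add: split_beta')
  show "AE y in circ. (\<lambda>x. f (x, y)) \<in> sq circ"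
    using tor.AE_integrable_snd[OF i] by eventually_elim (use sections(1)[OF sq_meas[OF f]] in \<open>auto intro: sqI\<close>)
  show "integrable circ (\<lambda>y. \<integral>x. (cmod (f (x, y)))\<^sup>2 \<partial>circ)" by (rule tor.integrable_snd[OF i])
  show "(\<integral>y. (\<integral>x. (cmod (f (x, y)))\<^sup>2 \<partial>circ) \<partial>circ) = (nrm tor f)\<^sup>2"
    unfolding nrm_power2 using tor.integral_snd[OF i] by (simp add: split_beta')
qed

section \<open>Fourier coefficients in x as functions of y\<close>

definition coef :: "int \<Rightarrow> (real \<times> real \<Rightarrow> complex) \<Rightarrow> real \<Rightarrow> complex" where
  "coef k f y = (1 / (2 * pi)) * (\<integral>s. f (s, y) * cis (- (of_int k * s)) \<partial>circ)"

lemma cis_circ_sq: "(\<lambda>s. cis (c * s)) \<in> sq (ivl a b)" "(\<lambda>s. cis (- (c * s))) \<in> sq (ivl a b)"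
  by (intro sq_ivl_continuous continuous_intros)+

lemma nrm_cis: "nrm circ (\<lambda>s. cis (h s)) = sqrt (2 * pi)"
  using measure_ivl[of 0 "2 * pi"] by (simp add: nrm_def)

lemma fourier_proj_eq:
  assumes "f \<in> borel_measurable borel"
  shows "fourier_proj k f = (\<lambda>(x, y). coef k f y * cis (of_int k * x))"
proof -
  have "(\<integral>s. f (s, y) * cis (- (of_int k * s)) \<partial>circ) = (LINT s:{0..2 * pi}|lborel. f (s, y) * cis (- (of_int k * s)))" for y
  proof -
    have [measurable]: "(\<lambda>s. f (s, y)) \<in> borel_measurable borel" using sections(1)[of f y] assms by (simp add: meas_tor)
    show ?thesis by (rule integral_ivl) measurable
  qed
  then show ?thesis by (simp add: fourier_proj_def coef_def fun_eq_iff)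
qed

lemma coef_meas:
  assumes "f \<in> borel_measurable borel" shows "coef k f \<in> borel_measurable borel"
proof -
  have [measurable]: "f \<in> borel_measurable tor" using assms by (simp add: meas_tor)
  show ?thesis unfolding coef_def[abs_def] by measurable
qed

text \<open>Bessel's inequality for a single mode: Cauchy--Schwarz in x on almost every horizontal
  line, then integration in y.\<close>

lemma coef_sq:
  assumes f: "f \<in> sq tor"
  shows "coef k f \<in> sq circ" "2 * pi * (nrm circ (coef k f))\<^sup>2 \<le> (nrm tor f)\<^sup>2"
proof -
  have [measurable]: "coef k f \<in> borel_measurable borel" using coef_meas sq_meas[OF f] by (simp add: meas_tor)
  have bound: "AE y in circ. (cmod (coef k f y))\<^sup>2 \<le> 1 / (2 * pi) * (\<integral>x. (cmod (f (x, y)))\<^sup>2 \<partial>circ)"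
    using sq_tor_sections(1)[OF f]
  proof eventually_elim
    case (elim y)
    have "cmod (\<integral>s. f (s, y) * cis (- (of_int k * s)) \<partial>circ) \<le> nrm circ (\<lambda>x. f (x, y)) * sqrt (2 * pi)"
      using cmod_integral_mult_le[OF elim cis_circ_sq(2)] by (simp add: nrm_cis)
    then have "cmod (coef k f y) \<le> 1 / (2 * pi) * (nrm circ (\<lambda>x. f (x, y)) * sqrt (2 * pi))"
      unfolding coef_def norm_mult by (intro mult_mono) (auto simp: norm_divide)
    then have "(cmod (coef k f y))\<^sup>2 \<le> (1 / (2 * pi) * (nrm circ (\<lambda>x. f (x, y)) * sqrt (2 * pi)))\<^sup>2"
      by (intro power_mono) auto
    also have "\<dots> = 1 / (2 * pi) * (nrm circ (\<lambda>x. f (x, y)))\<^sup>2"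
      by (simp add: power_mult_distrib power_divide field_simps) (simp add: power2_eq_square)
    finally show ?case by (simp add: nrm_power2)
  qed
  have i: "integrable circ (\<lambda>y. 1 / (2 * pi) * (\<integral>x. (cmod (f (x, y)))\<^sup>2 \<partial>circ))"
    using sq_tor_sections(2)[OF f] by simp
  have i': "integrable circ (\<lambda>y. (cmod (coef k f y))\<^sup>2)"
    by (rule Bochner_Integration.integrable_bound[OF i]) (use bound in \<open>auto elim!: eventually_mono\<close>)
  then show "coef k f \<in> sq circ" by (intro sqI) auto
  have "(nrm circ (coef k f))\<^sup>2 \<le> (\<integral>y. 1 / (2 * pi) * (\<integral>x. (cmod (f (x, y)))\<^sup>2 \<partial>circ) \<partial>circ)"
    unfolding nrm_power2 by (intro integral_mono_AE i i' bound)
  also have "\<dots> = 1 / (2 * pi) * (nrm tor f)\<^sup>2" by (simp add: sq_tor_sections(3)[OF f])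
  finally show "2 * pi * (nrm circ (coef k f))\<^sup>2 \<le> (nrm tor f)\<^sup>2" by (simp add: field_simps)
qed

lemma coef_lincomb:
  assumes f: "f \<in> sq tor" and g: "g \<in> sq tor"
  shows "AE y in circ. coef k (\<lambda>z. c * f z + d * g z) y = c * coef k f y + d * coef k g y"
  using sq_tor_sections(1)[OF f] sq_tor_sections(1)[OF g]
proof eventually_elim
  case (elim y)
  have i: "integrable circ (\<lambda>s. f (s, y) * cis (- (of_int k * s)))" "integrable circ (\<lambda>s. g (s, y) * cis (- (of_int k * s)))"
    by (intro sq_prod_integrable elim cis_circ_sq)+
  have "(\<integral>s. (c * f (s, y) + d * g (s, y)) * cis (- (of_int k * s)) \<partial>circ)
    = (\<integral>s. c * (f (s, y) * cis (- (of_int k * s))) + d * (g (s, y) * cis (- (of_int k * s))) \<partial>circ)"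
    by (simp add: algebra_simps)
  also have "\<dots> = c * (\<integral>s. f (s, y) * cis (- (of_int k * s)) \<partial>circ) + d * (\<integral>s. g (s, y) * cis (- (of_int k * s)) \<partial>circ)"
    unfolding Bochner_Integration.integral_add[OF integrable_mult_right[OF i(1)] integrable_mult_right[OF i(2)]] integral_mult_right_zero ..
  finally show ?case by (simp add: coef_def distrib_left)
qed

text \<open>By Fubini a null set of the torus meets almost every horizontal line in a null set, and
  \<open>coef\<close> integrates along these lines.\<close>

lemma coef_cong_AE:
  assumes "f \<in> borel_measurable borel" "g \<in> borel_measurable borel" "AE z in tor. f z = g z"
  shows "AE y in circ. coef k f y = coef k g y"
proof -
  have m: "f \<in> borel_measurable tor" "g \<in> borel_measurable tor" using assms(1,2) by (simp_all add: meas_tor)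
  note [measurable] = m
  have "AE y in circ. AE x in circ. f (x, y) = g (x, y)"
  proof -
    have "{z \<in> space tor. f z = g z} \<in> sets tor" by measurable
    then show ?thesis
      using tor.AE_commute[of "\<lambda>x y. f (x, y) = g (x, y)"] tor.AE_pair[OF assms(3)]
      by (simp add: space_pair_measure) 
  qed
  then show ?thesis
  proof eventually_elim
    case (elim y)
    have [measurable]: "(\<lambda>x. f (x, y)) \<in> borel_measurable borel" "(\<lambda>x. g (x, y)) \<in> borel_measurable borel"
      using sections(1)[OF m(1)] sections(1)[OF m(2)] by auto
    have "(\<integral>s. f (s, y) * cis (- (of_int k * s)) \<partial>circ) = (\<integral>s. g (s, y) * cis (- (of_int k * s)) \<partial>circ)"
      by (rule integral_cong_AE) (use elim in auto)
    then show ?case by (simp add: coef_def)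
  qed
qed

lemma nrm_tor_mode:
  assumes "F \<in> sq circ"
  shows "(\<lambda>(x, y). F y * cis (of_int k * x)) \<in> sq tor" "nrm tor (\<lambda>(x, y). F y * cis (of_int k * x)) = sqrt (2 * pi) * nrm circ F"
proof -
  have [measurable]: "F \<in> borel_measurable borel" using sq_meas[OF assms] by simp
  have m: "(\<lambda>(x, y). F y * cis (of_int k * x)) \<in> borel_measurable tor" by measurable
  have i: "integrable tor (\<lambda>(x, y). (cmod (F y))\<^sup>2)"
  proof (rule tor.Fubini_integrable)
    show "(\<lambda>(x, y). (cmod (F y))\<^sup>2) \<in> borel_measurable tor" by measurable
  qed (use sq_integrable[OF assms] in auto)
  then show s: "(\<lambda>(x, y). F y * cis (of_int k * x)) \<in> sq tor"
    by (intro sqI m) (simp add: split_beta' norm_mult)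
  have "(nrm tor (\<lambda>(x, y). F y * cis (of_int k * x)))\<^sup>2 = 2 * pi * (nrm circ F)\<^sup>2"
    unfolding sq_tor_sections(3)[OF s, symmetric] using measure_ivl[of 0 "2 * pi"]
    by (simp add: norm_mult nrm_power2)
  also have "\<dots> = (sqrt (2 * pi) * nrm circ F)\<^sup>2" by (simp add: power_mult_distrib)
  finally show "nrm tor (\<lambda>(x, y). F y * cis (of_int k * x)) = sqrt (2 * pi) * nrm circ F"
    by (rule power2_eq_imp_eq) auto
qed

lemma integral_cis_circ: "(\<integral>y. cis (of_int m * y) \<partial>circ) = (if m = 0 then of_real (2 * pi) else 0)"
proof (cases "m = 0")
  case True
  then show ?thesis using measure_ivl[of 0 "2 * pi"] by (simp add: scaleR_conv_of_real)
next
  case False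
  have "(\<integral>y. (\<i> * of_real (of_int m)) * cis (of_int m * y) \<partial>circ) = 0"
    using integral_ivl_FTC[of 0 "2 * pi", OF _ cis_deriv[of "of_int m"]]
    by (simp add: cis_circ_end continuous_on_mult_left continuous_cis)
  then show ?thesis using False by simp
qed

text \<open>Parseval in x for a function with one mode: on almost every line the difference from
  that mode has only zero coefficients, so \<open>fourier_unique\<close> makes it vanish.\<close>

lemma single_mode_norm:
  assumes h: "h \<in> sq tor" and zero: "\<And>l. l \<noteq> k \<Longrightarrow> AE y in circ. coef l h y = 0"
  shows "nrm tor h = sqrt (2 * pi) * nrm circ (coef k h)"
proof -
  \<comment> \<open>There are countably many frequencies, so one exceptional null set serves them
    all.\<close>
  have "AE y in circ. \<forall>l\<in>-{k}. coef l h y = 0"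
    by (subst AE_ball_countable) (use zero in auto)
  moreover note sq_tor_sections(1)[OF h]
  ultimately have "AE y in circ. (\<integral>x. (cmod (h (x, y)))\<^sup>2 \<partial>circ) = 2 * pi * (cmod (coef k h y))\<^sup>2"
  proof eventually_elim
    case (elim y)
    let ?g = "\<lambda>x. h (x, y) - coef k h y * cis (of_int k * x)"
    have g: "?g \<in> sq circ" by (intro sq_diff sq_cmult elim cis_circ_sq)
    have "AE x in circ. ?g x = 0"
    proof (rule fourier_unique[OF g])
      fix m :: int
      have i: "integrable circ (\<lambda>x. h (x, y) * cis (of_int m * x))" by (intro sq_prod_integrable elim cis_circ_sq)
      have i2: "integrable circ (\<lambda>x. cis (of_int (k + m) * x))" by (intro sq_integrable1[OF finite_measure_ivl] cis_circ_sq)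
      have "(\<integral>x. ?g x * cis (of_int m * x) \<partial>circ) = (\<integral>x. h (x, y) * cis (of_int m * x) - coef k h y * cis (of_int (k + m) * x) \<partial>circ)"
        by (simp add: left_diff_distrib mult.assoc cis_mult distrib_right)
      also have "\<dots> = (\<integral>x. h (x, y) * cis (of_int m * x) \<partial>circ) - coef k h y * (\<integral>x. cis (of_int (k + m) * x) \<partial>circ)"
        unfolding Bochner_Integration.integral_diff[OF i integrable_mult_right[OF i2]] integral_mult_right_zero ..
      also have "(\<integral>x. h (x, y) * cis (of_int m * x) \<partial>circ) = 2 * pi * coef (- m) h y"
        by (simp add: coef_def)
      also have "2 * pi * coef (- m) h y - coef k h y * (\<integral>x. cis (of_int (k + m) * x) \<partial>circ) = 0"
        unfolding integral_cis_circ using elim(1) by (cases "m = - k") (auto simp: algebra_simps)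
      finally show "(\<integral>x. ?g x * cis (of_int m * x) \<partial>circ) = 0" .
    qed
    then have "AE x in circ. (cmod (h (x, y)))\<^sup>2 = (cmod (coef k h y))\<^sup>2"
      by eventually_elim (simp add: norm_mult)
    then have "(\<integral>x. (cmod (h (x, y)))\<^sup>2 \<partial>circ) = (\<integral>x. (cmod (coef k h y))\<^sup>2 \<partial>circ)"
      using sq_meas[OF elim(2)] by (intro integral_cong_AE) auto
    then show ?case using measure_ivl[of 0 "2 * pi"] by simp
  qed
  then have "(\<integral>y. (\<integral>x. (cmod (h (x, y)))\<^sup>2 \<partial>circ) \<partial>circ) = (\<integral>y. 2 * pi * (cmod (coef k h y))\<^sup>2 \<partial>circ)"
    using sq_tor_sections(2)[OF h] sq_meas[OF coef_sq(1)[OF h, of k]] by (intro integral_cong_AE) auto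
  then have "(nrm tor h)\<^sup>2 = (sqrt (2 * pi) * nrm circ (coef k h))\<^sup>2"
    unfolding sq_tor_sections(3)[OF h] by (simp add: power_mult_distrib nrm_power2)
  then show ?thesis by (rule power2_eq_imp_eq) auto
qed

lemma sq_tor_continuous:
  assumes h: "continuous_on UNIV h" shows "h \<in> sq tor"
proof -
  have hm [measurable]: "h \<in> borel_measurable borel" by (rule borel_measurable_continuous_onI[OF h])
  have "compact (h ` cell)" unfolding cell_def
    by (intro compact_continuous_image continuous_on_subset[OF h] compact_Times) auto
  then obtain B where B: "\<forall>z\<in>cell. cmod (h z) \<le> B" by (auto dest!: compact_imp_bounded simp: bounded_iff)
  have "(\<lambda>z. indicator cell z *\<^sub>R h z) \<in> sq tor"
    by (rule sq_bounded[OF finite_measure_tor, where B="\<bar>B\<bar>"])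
      (use B in \<open>auto simp: meas_tor split: split_indicator intro: order_trans\<close>)
  then show ?thesis
  proof (rule sq_cong_AE)
    show "h \<in> borel_measurable tor" by (simp add: meas_tor)
    show "AE z in tor. indicator cell z *\<^sub>R h z = h z"
    unfolding tor_eq by (subst AE_density) (auto intro!: AE_I2 split: split_indicator)
  qed
qed

section \<open>Exponentials as test functions\<close>

definition expo :: "int \<Rightarrow> int \<Rightarrow> real \<times> real \<Rightarrow> complex" where
  "expo k m z = cis (of_int k * fst z) * cis (of_int m * snd z)"

lemma expo_continuous: "continuous_on UNIV (expo k m)"
  unfolding expo_def[abs_def] by (intro continuous_intros)

lemma cis_int_periodic: "cis (of_int k * (x + 2 * pi)) = cis (of_int k * x)"
  using cis_circ_end[of k] by (simp add: distrib_left cis_mult[symmetric])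

lemma expo_periodic: "periodic2 (expo k m)"
  by (simp add: periodic2_def expo_def cis_int_periodic)

lemma dx_expo: "dx (\<lambda>z. c * expo k m z) = (\<lambda>z. c * (\<i> * of_int k) * expo k m z)"
proof -
  have "vector_derivative (\<lambda>s. c * expo k m (s, y)) (at x) = c * (\<i> * of_int k) * expo k m (x, y)" for x y
  proof (rule vector_derivative_at)
    have "((\<lambda>s. (c * cis (of_int m * y)) * cis (of_int k * s)) has_vector_derivative
        (c * cis (of_int m * y)) * ((\<i> * of_real (of_int k)) * cis (of_int k * x))) (at x)"
      by (intro has_vector_derivative_mult_right cis_deriv)
    then show "((\<lambda>s. c * expo k m (s, y)) has_vector_derivative c * (\<i> * of_int k) * expo k m (x, y)) (at x)"
      by (simp add: expo_def mult_ac)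
  qed
  then show ?thesis by (auto simp: dx_def fun_eq_iff)
qed

lemma dy_expo: "dy (\<lambda>z. c * expo k m z) = (\<lambda>z. c * (\<i> * of_int m) * expo k m z)"
proof -
  have "vector_derivative (\<lambda>s. c * expo k m (x, s)) (at y) = c * (\<i> * of_int m) * expo k m (x, y)" for x y
  proof (rule vector_derivative_at)
    have "((\<lambda>s. (c * cis (of_int k * x)) * cis (of_int m * s)) has_vector_derivative
        (c * cis (of_int k * x)) * ((\<i> * of_real (of_int m)) * cis (of_int m * y))) (at y)"
      by (intro has_vector_derivative_mult_right cis_deriv)
    then show "((\<lambda>s. c * expo k m (x, s)) has_vector_derivative c * (\<i> * of_int m) * expo k m (x, y)) (at y)"
      by (simp add: expo_def mult_ac)
  qed
  then show ?thesis by (auto simp: dy_def fun_eq_iff)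
qed

lemma dx_power_expo: "(dx ^^ i) (\<lambda>z. c * expo k m z) = (\<lambda>z. c * (\<i> * of_int k) ^ i * expo k m z)"
proof (induction i)
  case (Suc i)
  show ?case unfolding funpow.simps o_apply Suc dx_expo by (simp add: mult_ac)
qed simp

lemma dy_power_expo: "(dy ^^ i) (\<lambda>z. c * expo k m z) = (\<lambda>z. c * (\<i> * of_int m) ^ i * expo k m z)"
proof (induction i)
  case (Suc i)
  show ?case unfolding funpow.simps o_apply Suc dy_expo by (simp add: mult_ac)
qed simp

lemma cis_differentiable: "cis differentiable (at x)"
  using cis_deriv[of 1 x] unfolding has_vector_derivative_def differentiable_def by auto

lemma expo_differentiable: "(\<lambda>z. c * expo k m z) differentiable_on UNIV"
proof -
  have "(\<lambda>z. cis (h z)) differentiable (at z)" if "h differentiable (at z)" for h :: "real \<times> real \<Rightarrow> real" and z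
    using differentiable_chain_at[OF that cis_differentiable] by (simp add: o_def)
  moreover have "(\<lambda>z::real \<times> real. of_int k * fst z) differentiable (at z)" "(\<lambda>z::real \<times> real. of_int m * snd z) differentiable (at z)" for z k m
    by (auto intro!: linear_imp_differentiable linear_compose[where g="\<lambda>x. r * x" for r :: real, unfolded o_def] linear_fst linear_snd simp: linear_iff algebra_simps)
  ultimately show ?thesis
    unfolding differentiable_on_def expo_def by (intro ballI differentiable_mult differentiable_const) auto
qed

lemma expo_test: "test_function (expo k m)"
proof -
  have "(dx ^^ i) ((dy ^^ j) (expo k m)) = (\<lambda>z. (1 * (\<i> * of_int m) ^ j) * (\<i> * of_int k) ^ i * expo k m z)" for i j
    using dy_power_expo[of j 1 k m] dx_power_expo[of i "1 * (\<i> * of_int m) ^ j" k m] by simp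
  then show ?thesis
    unfolding test_function_def by (simp only: expo_periodic expo_differentiable) simp
qed

lemma integral_coef:
  assumes f: "f \<in> sq tor" and w: "continuous_on UNIV w"
  shows "(\<integral>z. f z * (cis (of_int (- k) * fst z) * w (snd z)) \<partial>tor) = 2 * pi * (\<integral>y. coef k f y * w y \<partial>circ)"
proof -
  have "(\<lambda>z. cis (of_int (- k) * fst z) * w (snd z)) \<in> sq tor"
    by (intro sq_tor_continuous continuous_intros continuous_on_compose2[OF w]) auto
  then have i: "integrable tor (\<lambda>(x, y). f (x, y) * (cis (of_int (- k) * x) * w y))"
    using sq_prod_integrable[OF f] by (simp add: split_beta')
  have "(\<integral>z. f z * (cis (of_int (- k) * fst z) * w (snd z)) \<partial>tor) = (\<integral>y. (\<integral>x. f (x, y) * (cis (of_int (- k) * x) * w y) \<partial>circ) \<partial>circ)"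
    using tor.integral_snd[OF i] by (simp add: split_beta')
  also have "\<dots> = (\<integral>y. 2 * pi * (coef k f y * w y) \<partial>circ)"
  proof (intro Bochner_Integration.integral_cong refl)
    fix y
    have "(\<integral>x. f (x, y) * (cis (of_int (- k) * x) * w y) \<partial>circ) = (\<integral>x. f (x, y) * cis (- (of_int k * x)) \<partial>circ) * w y"
      by (subst integral_mult_left_zero[symmetric]) (simp add: mult.assoc)
    then show "(\<integral>x. f (x, y) * (cis (of_int (- k) * x) * w y) \<partial>circ) = 2 * pi * (coef k f y * w y)"
      by (simp add: coef_def)
  qed
  finally show ?thesis by (simp only: integral_mult_right_zero)
qed

text \<open>The pairing with test functions is bilinear without conjugation, so mode
  \<open>k\<close> is extracted by \<open>expo (- k) m\<close>. Its x-derivative produces the factor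
  \<open>- \<i> * k\<close> in front of \<open>u\<close>.\<close>

lemma drift_diffusion_mode_op:
  assumes op: "drift_diffusion_op \<mu> \<nu> u f g" and u: "continuous_on UNIV u"
  shows "mode_op \<mu> \<nu> u k (coef k f) (coef k g)"
  unfolding mode_op_def
proof (intro conjI allI)
  have f: "f \<in> sq tor" and g: "g \<in> sq tor" using op L2_T2_sq by (auto simp: drift_diffusion_op_def)
  have fm [measurable]: "f \<in> borel_measurable borel" "g \<in> borel_measurable borel"
    using sq_meas[OF f] sq_meas[OF g] by (simp_all add: meas_tor)
  show "coef k f \<in> sq circ" "coef k g \<in> sq circ" by (intro coef_sq f g)+
  fix m :: int
  let ?e = "expo (- k) m"
  let ?w = "\<lambda>y. (- complex_of_real (\<mu> * (of_int k)\<^sup>2) - of_real (\<nu> * (of_int m)\<^sup>2) - \<i> * of_real (of_int k * u y)) * cis (of_int m * y)"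
  have em [measurable]: "?e \<in> borel_measurable borel" by (rule borel_measurable_continuous_onI[OF expo_continuous])
  have "(LINT z:cell|lborel. g z * ?e z) =
        (LINT z:cell|lborel. f z * (of_real \<mu> * dx (dx ?e) z + of_real \<nu> * dy (dy ?e) z + of_real (u (snd z)) * dx ?e z))"
    using op expo_test[of "- k" m] by (simp add: drift_diffusion_op_def)
  also have "(\<lambda>z. f z * (of_real \<mu> * dx (dx ?e) z + of_real \<nu> * dy (dy ?e) z + of_real (u (snd z)) * dx ?e z))
     = (\<lambda>z. f z * (cis (of_int (- k) * fst z) * ?w (snd z)))"
  proof -
    have 1: "dx ?e = (\<lambda>z. - (\<i> * of_int k) * ?e z)" using dx_expo[of 1 "- k" m] by simp
    have 2: "dx (dx ?e) = (\<lambda>z. - (of_int k)\<^sup>2 * ?e z)"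
      unfolding 1 dx_expo by (auto simp: power2_eq_square algebra_simps)
    have 3: "dy ?e = (\<lambda>z. (\<i> * of_int m) * ?e z)" using dy_expo[of 1 "- k" m] by simp
    have 4: "dy (dy ?e) = (\<lambda>z. - (of_int m)\<^sup>2 * ?e z)"
      unfolding 3 dy_expo by (auto simp: power2_eq_square algebra_simps)
    show ?thesis unfolding 2 4 unfolding 1 by (auto simp: expo_def fun_eq_iff algebra_simps)
  qed
  also have "(LINT z:cell|lborel. g z * ?e z) = (\<integral>z. g z * ?e z \<partial>tor)"
    by (rule integral_tor[symmetric]) measurable
  also have "\<dots> = 2 * pi * (\<integral>y. coef k g y * cis (of_int m * y) \<partial>circ)"
    unfolding expo_def by (rule integral_coef[OF g continuous_cis])
  also have "(LINT z:cell|lborel. f z * (cis (of_int (- k) * fst z) * ?w (snd z))) = (\<integral>z. f z * (cis (of_int (- k) * fst z) * ?w (snd z)) \<partial>tor)"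
    by (intro integral_tor[symmetric] borel_measurable_times fm borel_measurable_continuous_onI continuous_intros continuous_on_compose2[OF u]) auto
  also have "\<dots> = 2 * pi * (\<integral>y. coef k f y * ?w y \<partial>circ)"
    by (rule integral_coef[OF f]) (intro continuous_intros u)
  finally show "(\<integral>y. coef k g y * cis (of_int m * y) \<partial>circ) = (\<integral>y. coef k f y * ?w y \<partial>circ)" by simp
qed

section \<open>Exponentials in the domain of the generator\<close>

lemma differentiable_on_UNIV_continuous: "h differentiable_on UNIV \<Longrightarrow> continuous_on UNIV h"
  by (rule differentiable_imp_continuous_on)

lemma dx_works:
  assumes "h differentiable_on UNIV"
  shows "((\<lambda>s. h (s, y)) has_vector_derivative dx h (x, y)) (at x)"
proof -
  have "h differentiable (at (x, y))" using assms by (simp add: differentiable_on_def)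
  moreover have "(\<lambda>s. (s, y)) differentiable (at x)"
    unfolding differentiable_def by (rule exI[of _ "\<lambda>s. (s, 0)"]) (auto intro!: derivative_eq_intros)
  ultimately have "(h \<circ> (\<lambda>s. (s, y))) differentiable (at x)" by (intro differentiable_chain_at) auto
  then show ?thesis by (simp add: dx_def o_def vector_derivative_works)
qed

lemma dy_works:
  assumes "h differentiable_on UNIV"
  shows "((\<lambda>s. h (x, s)) has_vector_derivative dy h (x, y)) (at y)"
proof -
  have "h differentiable (at (x, y))" using assms by (simp add: differentiable_on_def)
  moreover have "(\<lambda>s. (x, s)) differentiable (at y)"
    unfolding differentiable_def by (rule exI[of _ "\<lambda>s. (0, s)"]) (auto intro!: derivative_eq_intros)
  ultimately have "(h \<circ> (\<lambda>s. (x, s))) differentiable (at y)" by (intro differentiable_chain_at) auto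
  then show ?thesis by (simp add: dy_def o_def vector_derivative_works)
qed

text \<open>\<open>vector_derivative\<close> is a choice among admissible values, so it suffices
  that exactly the same values qualify at both points.\<close>

lemma vector_derivative_periodic:
  fixes h :: "real \<Rightarrow> complex"
  assumes "\<And>s. h (s + p) = h s"
  shows "vector_derivative h (at (x + p)) = vector_derivative h (at x)"
proof -
  have "(h has_vector_derivative D) (at (x + p)) \<longleftrightarrow> (h has_vector_derivative D) (at x)" for D
  proof
    assume "(h has_vector_derivative D) (at (x + p))"
    then have "(h \<circ> (\<lambda>s. s + p) has_vector_derivative 1 *\<^sub>R D) (at x)"
      by (intro vector_diff_chain_at) (auto intro!: derivative_eq_intros)
    then show "(h has_vector_derivative D) (at x)" by (simp add: o_def assms)
  next
    assume "(h has_vector_derivative D) (at x)"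
    moreover have "h (s - p) = h s" for s using assms[of "s - p"] by simp
    ultimately have "(h \<circ> (\<lambda>s. s - p) has_vector_derivative 1 *\<^sub>R D) (at (x + p))"
      by (intro vector_diff_chain_at) (auto intro!: derivative_eq_intros)
    then show "(h has_vector_derivative D) (at (x + p))" using \<open>\<And>s. h (s - p) = h s\<close> by (simp add: o_def)
  qed
  then show ?thesis by (simp add: vector_derivative_def)
qed

lemma dx_periodic: "periodic2 h \<Longrightarrow> periodic2 (dx h)"
  using vector_derivative_periodic[of "\<lambda>s. h (s, y)" "2 * pi" for y] by (simp add: periodic2_def dx_def)

lemma dy_periodic: "periodic2 h \<Longrightarrow> periodic2 (dy h)"
  using vector_derivative_periodic[of "\<lambda>s. h (x, s)" "2 * pi" for x] by (simp add: periodic2_def dy_def)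

lemma integral_circ_by_parts:
  assumes h: "\<And>x. (h has_vector_derivative h' x) (at x)" and h': "continuous_on UNIV h'" and per: "h (2 * pi) = h 0"
  shows "(\<integral>x. cis (of_int k * x) * h' x \<partial>circ) = - (\<i> * of_int k) * (\<integral>x. cis (of_int k * x) * h x \<partial>circ)"
proof -
  have hc: "continuous_on UNIV h"
    using h by (auto simp: continuous_on_eq_continuous_at intro: has_vector_derivative_continuous)
  have i: "integrable circ (\<lambda>x. cis (of_int k * x) * h' x)" "integrable circ (\<lambda>x. cis (of_int k * x) * h x)"
    by (intro integrable_ivl_continuous continuous_intros h' hc)+
  have "(\<integral>x. cis (of_int k * x) * h' x + \<i> * of_real (of_int k) * cis (of_int k * x) * h x \<partial>circ)
     = cis (of_int k * (2 * pi)) * h (2 * pi) - cis (of_int k * 0) * h 0"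
    by (rule integral_ivl_FTC[where F="\<lambda>x. cis (of_int k * x) * h x"])
      (auto intro!: has_vector_derivative_mult cis_deriv[of "of_int k", unfolded of_real_of_int_eq] h continuous_intros h' hc)
  also have "\<dots> = 0" by (simp add: cis_circ_end per)
  also have "(\<integral>x. cis (of_int k * x) * h' x + \<i> * of_real (of_int k) * cis (of_int k * x) * h x \<partial>circ)
     = (\<integral>x. cis (of_int k * x) * h' x \<partial>circ) + \<i> * of_real (of_int k) * (\<integral>x. cis (of_int k * x) * h x \<partial>circ)"
    unfolding mult.assoc[of "\<i> * _"] Bochner_Integration.integral_add[OF i(1) integrable_mult_right[OF i(2)]] integral_mult_right_zero ..
  finally show ?thesis by (simp add: eq_neg_iff_add_eq_0)
qed

lemma integral_tor_parts_x:
  assumes h: "h differentiable_on UNIV" "dx h differentiable_on UNIV" "periodic2 h" and w: "continuous_on UNIV w"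
  shows "(\<integral>z. cis (of_int k * fst z) * w (snd z) * dx h z \<partial>tor) = - (\<i> * of_int k) * (\<integral>z. cis (of_int k * fst z) * w (snd z) * h z \<partial>tor)"
proof -
  have c: "continuous_on UNIV h" "continuous_on UNIV (dx h)" by (intro differentiable_on_UNIV_continuous h)+
  have i: "integrable tor (\<lambda>(x, y). cis (of_int k * x) * w y * f (x, y))" if "continuous_on UNIV f" for f
  proof -
    have "(\<lambda>z. cis (of_int k * fst z) * w (snd z) * f z) \<in> sq tor"
      by (intro sq_tor_continuous continuous_intros continuous_on_compose2[OF w] that) auto
    then show ?thesis using sq_integrable1[OF finite_measure_tor] by (simp add: split_beta')
  qed
  have 1: "(\<integral>z. cis (of_int k * fst z) * w (snd z) * f z \<partial>tor) = (\<integral>y. w y * (\<integral>x. cis (of_int k * x) * f (x, y) \<partial>circ) \<partial>circ)"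
    if f: "continuous_on UNIV f" for f
  proof -
    have "(\<integral>z. cis (of_int k * fst z) * w (snd z) * f z \<partial>tor) = (\<integral>y. (\<integral>x. cis (of_int k * x) * w y * f (x, y) \<partial>circ) \<partial>circ)"
      using tor.integral_snd[OF i[OF f]] by (simp add: split_beta')
    also have "\<dots> = (\<integral>y. w y * (\<integral>x. cis (of_int k * x) * f (x, y) \<partial>circ) \<partial>circ)"
      by (subst integral_mult_right_zero[symmetric]) (simp add: mult_ac)
    finally show ?thesis .
  qed
  have 2: "(\<integral>x. cis (of_int k * x) * dx h (x, y) \<partial>circ) = - (\<i> * of_int k) * (\<integral>x. cis (of_int k * x) * h (x, y) \<partial>circ)" for y
  proof -
    have "h (2 * pi, y) = h (0, y)" using h(3) unfolding periodic2_def by (metis add_0)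
    then show ?thesis
      by (intro integral_circ_by_parts dx_works h continuous_on_compose2[OF c(2)] continuous_intros) auto
  qed
  have "(\<integral>z. cis (of_int k * fst z) * w (snd z) * dx h z \<partial>tor) = (\<integral>y. - (\<i> * of_int k) * (w y * (\<integral>x. cis (of_int k * x) * h (x, y) \<partial>circ)) \<partial>circ)"
    unfolding 1[OF c(2)] 2 by (simp only: mult.left_commute)
  also have "\<dots> = - (\<i> * of_int k) * (\<integral>z. cis (of_int k * fst z) * w (snd z) * h z \<partial>tor)"
    unfolding 1[OF c(1)] by (rule integral_mult_right_zero)
  finally show ?thesis .
qed

lemma integral_tor_parts_y:
  assumes h: "h differentiable_on UNIV" "dy h differentiable_on UNIV" "periodic2 h" and w: "continuous_on UNIV w"
  shows "(\<integral>z. w (fst z) * cis (of_int k * snd z) * dy h z \<partial>tor) = - (\<i> * of_int k) * (\<integral>z. w (fst z) * cis (of_int k * snd z) * h z \<partial>tor)"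
proof -
  have c: "continuous_on UNIV h" "continuous_on UNIV (dy h)" by (intro differentiable_on_UNIV_continuous h)+
  have i: "integrable tor (\<lambda>z. w (fst z) * cis (of_int k * snd z) * f z)" if "continuous_on UNIV f" for f
  proof -
    have "(\<lambda>z. w (fst z) * cis (of_int k * snd z) * f z) \<in> sq tor"
      by (intro sq_tor_continuous continuous_intros continuous_on_compose2[OF w] that) auto
    then show ?thesis using sq_integrable1[OF finite_measure_tor] by simp
  qed
  have 1: "(\<integral>z. w (fst z) * cis (of_int k * snd z) * f z \<partial>tor) = (\<integral>x. w x * (\<integral>y. cis (of_int k * y) * f (x, y) \<partial>circ) \<partial>circ)"
    if f: "continuous_on UNIV f" for f
  proof -
    have "(\<integral>z. w (fst z) * cis (of_int k * snd z) * f z \<partial>tor) = (\<integral>x. (\<integral>y. w x * cis (of_int k * y) * f (x, y) \<partial>circ) \<partial>circ)"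
      using tor.integral_fst'[OF i[OF f]] by simp
    also have "\<dots> = (\<integral>x. w x * (\<integral>y. cis (of_int k * y) * f (x, y) \<partial>circ) \<partial>circ)"
      by (subst integral_mult_right_zero[symmetric]) (simp add: mult_ac)
    finally show ?thesis .
  qed
  have 2: "(\<integral>y. cis (of_int k * y) * dy h (x, y) \<partial>circ) = - (\<i> * of_int k) * (\<integral>y. cis (of_int k * y) * h (x, y) \<partial>circ)" for x
  proof -
    have "h (x, 2 * pi) = h (x, 0)" using h(3) unfolding periodic2_def by (metis add_0)
    then show ?thesis
      by (intro integral_circ_by_parts dy_works h continuous_on_compose2[OF c(2)] continuous_intros) auto
  qed
  have "(\<integral>z. w (fst z) * cis (of_int k * snd z) * dy h z \<partial>tor) = (\<integral>x. - (\<i> * of_int k) * (w x * (\<integral>y. cis (of_int k * y) * h (x, y) \<partial>circ)) \<partial>circ)"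
    unfolding 1[OF c(2)] 2 by (simp only: mult.left_commute)
  also have "\<dots> = - (\<i> * of_int k) * (\<integral>z. w (fst z) * cis (of_int k * snd z) * h z \<partial>tor)"
    unfolding 1[OF c(1)] by (rule integral_mult_right_zero)
  finally show ?thesis .
qed

text \<open>Membership in the maximal domain is shown by moving the derivatives back from the test
  function to the exponential; periodicity removes the boundary terms. The x-derivative passes over
  \<open>u\<close>, which depends on y alone, so \<open>u\<close> is never differentiated.\<close>

lemma expo_domain:
  assumes u: "continuous_on UNIV u" and uper: "\<And>y. u (y + 2 * pi) = u y"
  shows "drift_diffusion_op \<mu> \<nu> u (expo k m)
    (\<lambda>z. (- of_real (\<mu> * (of_int k)\<^sup>2) - of_real (\<nu> * (of_int m)\<^sup>2) - \<i> * of_real (of_int k * u (snd z))) * expo k m z)"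
    (is "drift_diffusion_op \<mu> \<nu> u _ ?g")
  unfolding drift_diffusion_op_def
proof (intro conjI allI impI)
  have uc: "continuous_on UNIV (\<lambda>z::real \<times> real. u (snd z))" by (intro continuous_on_compose2[OF u] continuous_intros) auto
  have gc: "continuous_on UNIV ?g" by (intro continuous_intros uc expo_continuous)
  show "expo k m \<in> L2_T2" by (simp add: L2_T2_iff sq_tor_continuous expo_continuous expo_periodic)
  show "?g \<in> L2_T2"
    unfolding L2_T2_iff
  proof
    show "?g \<in> sq tor" by (rule sq_tor_continuous[OF gc])
    show "periodic2 ?g" using expo_periodic[of k m] by (simp add: periodic2_def uper)
  qed
  fix \<phi> assume \<phi>: "test_function \<phi>"
  have per: "periodic2 \<phi>" using \<phi> by (simp add: test_function_def)
  have diff: "(dx ^^ i) ((dy ^^ j) \<phi>) differentiable_on UNIV" for i j using \<phi> by (simp add: test_function_def)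
  have d: "\<phi> differentiable_on UNIV" "dx \<phi> differentiable_on UNIV" "dx (dx \<phi>) differentiable_on UNIV"
    "dy \<phi> differentiable_on UNIV" "dy (dy \<phi>) differentiable_on UNIV"
    using diff[of 0 0] diff[of 1 0] diff[of 2 0] diff[of 0 1] diff[of 0 2] by (simp_all add: numeral_2_eq_2)
  note c = d[THEN differentiable_on_UNIV_continuous]
  let ?e = "expo k m"
  have sq: "?e \<in> sq tor" "\<phi> \<in> sq tor" by (intro sq_tor_continuous expo_continuous c)+
  have e1: "?e = (\<lambda>z. cis (of_int k * fst z) * cis (of_int m * snd z))" by (simp add: expo_def fun_eq_iff)
  have I: "integrable tor f" if "continuous_on UNIV f" for f :: "real \<times> real \<Rightarrow> complex"
    by (rule sq_integrable1[OF finite_measure_tor sq_tor_continuous[OF that]])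
  have xx: "(\<integral>z. ?e z * dx (dx \<phi>) z \<partial>tor) = - (of_int k)\<^sup>2 * (\<integral>z. ?e z * \<phi> z \<partial>tor)"
    unfolding e1
    using integral_tor_parts_x[OF d(2,3) dx_periodic[OF per] continuous_cis[of "of_int m"], of k]
      integral_tor_parts_x[OF d(1,2) per continuous_cis[of "of_int m"], of k]
    by (simp add: power2_eq_square algebra_simps)
  have yy: "(\<integral>z. ?e z * dy (dy \<phi>) z \<partial>tor) = - (of_int m)\<^sup>2 * (\<integral>z. ?e z * \<phi> z \<partial>tor)"
    unfolding e1
    using integral_tor_parts_y[OF d(4,5) dy_periodic[OF per] continuous_cis[of "of_int k"], of m]
      integral_tor_parts_y[OF d(1,4) per continuous_cis[of "of_int k"], of m]
    by (simp add: power2_eq_square algebra_simps)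
  have ux: "(\<integral>z. ?e z * of_real (u (snd z)) * dx \<phi> z \<partial>tor) = - (\<i> * of_int k) * (\<integral>z. ?e z * of_real (u (snd z)) * \<phi> z \<partial>tor)"
    unfolding e1
    using integral_tor_parts_x[OF d(1,2) per, of "\<lambda>y. cis (of_int m * y) * of_real (u y)" k]
    by (simp add: mult.assoc continuous_on_mult continuous_cis continuous_on_of_real u)
  let ?r = "\<lambda>z. ?e z * (of_real \<mu> * dx (dx \<phi>) z + of_real \<nu> * dy (dy \<phi>) z + of_real (u (snd z)) * dx \<phi> z)"
  have i: "integrable tor (\<lambda>z. ?e z * dx (dx \<phi>) z)" "integrable tor (\<lambda>z. ?e z * dy (dy \<phi>) z)"
    "integrable tor (\<lambda>z. ?e z * of_real (u (snd z)) * dx \<phi> z)" "integrable tor (\<lambda>z. ?e z * \<phi> z)"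
    "integrable tor (\<lambda>z. ?e z * of_real (u (snd z)) * \<phi> z)"
    by (intro I continuous_intros expo_continuous c uc)+
  have "(LINT z:cell|lborel. ?g z * \<phi> z) = (\<integral>z. ?g z * \<phi> z \<partial>tor)"
    by (intro integral_tor[symmetric] borel_measurable_continuous_onI continuous_intros gc c)
  also have "\<dots> = (\<integral>z. (- of_real (\<mu> * (of_int k)\<^sup>2) - of_real (\<nu> * (of_int m)\<^sup>2)) * (?e z * \<phi> z)
      + (- (\<i> * of_int k)) * (?e z * of_real (u (snd z)) * \<phi> z) \<partial>tor)"
    by (intro Bochner_Integration.integral_cong refl) (simp add: algebra_simps)
  also have "\<dots> = (- of_real (\<mu> * (of_int k)\<^sup>2) - of_real (\<nu> * (of_int m)\<^sup>2)) * (\<integral>z. ?e z * \<phi> z \<partial>tor)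
      + (- (\<i> * of_int k)) * (\<integral>z. ?e z * of_real (u (snd z)) * \<phi> z \<partial>tor)"
    unfolding Bochner_Integration.integral_add[OF integrable_mult_right[OF i(4)] integrable_mult_right[OF i(5)]] integral_mult_right_zero ..
  also have "\<dots> = of_real \<mu> * (\<integral>z. ?e z * dx (dx \<phi>) z \<partial>tor) + of_real \<nu> * (\<integral>z. ?e z * dy (dy \<phi>) z \<partial>tor)
      + (\<integral>z. ?e z * of_real (u (snd z)) * dx \<phi> z \<partial>tor)"
    unfolding xx yy ux by (simp add: algebra_simps)
  also have "\<dots> = (\<integral>z. of_real \<mu> * (?e z * dx (dx \<phi>) z) + of_real \<nu> * (?e z * dy (dy \<phi>) z) + ?e z * of_real (u (snd z)) * dx \<phi> z \<partial>tor)"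
    unfolding Bochner_Integration.integral_add[OF Bochner_Integration.integrable_add[OF integrable_mult_right[OF i(1)] integrable_mult_right[OF i(2)]] i(3)]
      Bochner_Integration.integral_add[OF integrable_mult_right[OF i(1)] integrable_mult_right[OF i(2)]] integral_mult_right_zero ..
  also have "\<dots> = (\<integral>z. ?r z \<partial>tor)" by (simp add: algebra_simps)
  also have "\<dots> = (LINT z:cell|lborel. ?r z)"
    by (intro integral_tor borel_measurable_continuous_onI continuous_intros expo_continuous c uc)
  finally show "(LINT z:cell|lborel. ?g z * \<phi> z) = (LINT z:cell|lborel. ?r z)" .
qed

section \<open>Uniform boundedness\<close>

lemma bounded_L2_opD:
  assumes "bounded_L2_op T"
  shows "f \<in> L2_T2 \<Longrightarrow> T f \<in> L2_T2"
    and "f \<in> L2_T2 \<Longrightarrow> g \<in> L2_T2 \<Longrightarrow> AE z in tor. T (\<lambda>z. c * f z + d * g z) z = c * T f z + d * T g z"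
    and "\<exists>M. \<forall>f\<in>L2_T2. nrm tor (T f) \<le> M * nrm tor f"
proof -
  show 1: "f \<in> L2_T2 \<Longrightarrow> T f \<in> L2_T2" for f using assms by (simp add: bounded_L2_op_def)
  show "f \<in> L2_T2 \<Longrightarrow> g \<in> L2_T2 \<Longrightarrow> AE z in tor. T (\<lambda>z. c * f z + d * g z) z = c * T f z + d * T g z"
    using assms by (intro AE_tor) (simp add: bounded_L2_op_def ae_eq_def)
  show "\<exists>M. \<forall>f\<in>L2_T2. nrm tor (T f) \<le> M * nrm tor f"
    using assms 1 by (simp add: bounded_L2_op_def L2_norm_eq[OF L2_T2_meas])
qed

lemma L2_T2_zero: "(\<lambda>z. 0) \<in> L2_T2"
  by (simp add: L2_T2_iff periodic2_def)

lemma L2_T2_cmult: "f \<in> L2_T2 \<Longrightarrow> (\<lambda>z. c * f z) \<in> L2_T2"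
  using L2_T2_lincomb[of f f c 0] by simp

lemma L2_T2_add: "f \<in> L2_T2 \<Longrightarrow> g \<in> L2_T2 \<Longrightarrow> (\<lambda>z. f z + g z) \<in> L2_T2"
  using L2_T2_lincomb[of f g 1 1] by simp

lemma L2_T2_diff: "f \<in> L2_T2 \<Longrightarrow> g \<in> L2_T2 \<Longrightarrow> (\<lambda>z. f z - g z) \<in> L2_T2"
  using L2_T2_lincomb[of f g 1 "-1"] by simp

lemma nrm_tor_cong:
  assumes "f \<in> L2_T2" "g \<in> L2_T2" "AE z in tor. f z = g z" shows "nrm tor f = nrm tor g"
  by (rule nrm_cong_AE) (use assms L2_T2_sq sq_meas in auto)

lemma op_lincomb_nrm:
  assumes T: "bounded_L2_op T" and f: "f \<in> L2_T2" "g \<in> L2_T2"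
  shows "nrm tor (T (\<lambda>z. c * f z + d * g z)) = nrm tor (\<lambda>z. c * T f z + d * T g z)"
  by (intro nrm_tor_cong bounded_L2_opD[OF T] L2_T2_lincomb f)

lemma op_diff_nrm:
  assumes T: "bounded_L2_op T" and f: "f \<in> L2_T2" "g \<in> L2_T2"
  shows "nrm tor (\<lambda>z. T f z - T g z) = nrm tor (T (\<lambda>z. f z - g z))"
  using op_lincomb_nrm[OF T f, of 1 "-1"] by simp

text \<open>\<open>K\<close> is the operator norm, taken as a supremum. The witness
  \<open>f0\<close> makes it exceed \<open>C > 0\<close>, so \<open>9/10 * K\<close> is strictly
  below the supremum and is surpassed by some vector of the unit ball.\<close>

lemma near_optimal:
  assumes T: "bounded_L2_op T" and f0: "f0 \<in> L2_T2" "C * nrm tor f0 < nrm tor (T f0)" and C: "0 < C"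
  obtains K f where "C \<le> K" "f \<in> L2_T2" "nrm tor f \<le> 1" "9/10 * K \<le> nrm tor (T f)"
    "\<And>g. g \<in> L2_T2 \<Longrightarrow> nrm tor (T g) \<le> K * nrm tor g"
proof -
  obtain M where M: "\<And>f. f \<in> L2_T2 \<Longrightarrow> nrm tor (T f) \<le> M * nrm tor f" using bounded_L2_opD(3)[OF T] by blast
  define Q where "Q = {nrm tor (T f) | f. f \<in> L2_T2 \<and> nrm tor f \<le> 1}"
  define K where "K = Sup Q"
  have bdd: "bdd_above Q"
  proof (rule bdd_aboveI[of _ "\<bar>M\<bar>"])
    fix x assume "x \<in> Q"
    then obtain f where f: "x = nrm tor (T f)" "f \<in> L2_T2" "nrm tor f \<le> 1" by (auto simp: Q_def)
    have "x \<le> M * nrm tor f" using M f by simp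
    also have "\<dots> \<le> \<bar>M\<bar> * 1" using f(3) by (intro mult_mono) auto
    finally show "x \<le> \<bar>M\<bar>" by simp
  qed
  have up: "nrm tor (T f) \<le> K" if "f \<in> L2_T2" "nrm tor f \<le> 1" for f
    unfolding K_def by (rule cSup_upper[OF _ bdd]) (use that in \<open>auto simp: Q_def\<close>)
  \<comment> \<open>The summand \<open>0 * g z\<close> casts a multiple of \<open>g\<close> into the
    two-term combination for which linearity is stated.\<close>
  have scale: "nrm tor (T g) = nrm tor g * nrm tor (T (\<lambda>z. (1 / of_real (nrm tor g)) * g z + 0 * g z))"
    if "g \<in> L2_T2" "nrm tor g \<noteq> 0" for g
    unfolding op_lincomb_nrm[OF T that(1) that(1)] using that(2)
    by (simp add: nrm_cmult[of _ "1 / complex_of_real (nrm tor g)", simplified] norm_divide)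
  have unit: "(\<lambda>z. (1 / of_real (nrm tor g)) * g z + 0 * g z) \<in> L2_T2"
    "nrm tor (\<lambda>z. (1 / of_real (nrm tor g)) * g z + 0 * g z) = 1"
    if "g \<in> L2_T2" "nrm tor g \<noteq> 0" for g
    using that L2_T2_lincomb[OF that(1) that(1), of "1 / of_real (nrm tor g)" 0]
    by (auto simp: nrm_cmult[of _ "1 / complex_of_real (nrm tor g)", simplified] norm_divide)
  have bound: "nrm tor (T g) \<le> K * nrm tor g" if g: "g \<in> L2_T2" for g
  proof (cases "nrm tor g = 0")
    case True
    then show ?thesis using M[OF g] by simp
  next
    case False
    have "nrm tor g * nrm tor (T (\<lambda>z. (1 / of_real (nrm tor g)) * g z + 0 * g z)) \<le> nrm tor g * K"
      by (intro mult_left_mono up unit(1) g False order_eq_refl[OF unit(2)]) simp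
    then show ?thesis using scale[OF g False] by (simp add: mult.commute)
  qed
  have "nrm tor f0 \<noteq> 0" using M[OF f0(1)] f0(2) by auto
  then have n0: "0 < nrm tor f0" using nrm_nonneg[of tor f0] by linarith
  have "C * nrm tor f0 < K * nrm tor f0" using f0 bound[OF f0(1)] by linarith
  then have CK: "C < K" using n0 by simp
  then have "9/10 * K < K" using C by simp
  moreover have "Q \<noteq> {}" unfolding Q_def using L2_T2_zero by (auto simp: nrm_def intro!: exI[of _ "\<lambda>z. 0"])
  ultimately obtain x where "x \<in> Q" "9/10 * K < x"
    unfolding K_def using less_cSup_iff[OF _ bdd] by blast
  then show thesis using that[of K] CK bound by (force simp: Q_def)
qed

text \<open>Gliding hump: the signs of the increments are chosen so that the \<open>n\<close>-th operator is large on the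
  \<open>n\<close>-th partial sum.\<close>

lemma gliding_hump:
  assumes T: "\<And>n. bounded_L2_op (T n)"
    and large: "\<And>n. \<exists>f\<in>L2_T2. 4 ^ n * nrm tor f < nrm tor (T n f)"
  obtains x where "x \<in> L2_T2" "\<And>n. 2/5 * (4/3) ^ n \<le> nrm tor (T n x)"
proof -
  have "\<exists>K f. 4 ^ n \<le> K \<and> f \<in> L2_T2 \<and> nrm tor f \<le> 1 \<and> 9/10 * K \<le> nrm tor (T n f)
    \<and> (\<forall>g\<in>L2_T2. nrm tor (T n g) \<le> K * nrm tor g)" for n
  proof -
    obtain f0 where "f0 \<in> L2_T2" "4 ^ n * nrm tor f0 < nrm tor (T n f0)" using large by blast
    from near_optimal[OF T this] show ?thesis by (metis zero_less_numeral zero_less_power)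
  qed
  then obtain K f where K: "\<And>n. 4 ^ n \<le> K n" and f: "\<And>n. f n \<in> L2_T2" and f1: "\<And>n. nrm tor (f n) \<le> 1"
    and opt: "\<And>n. 9/10 * K n \<le> nrm tor (T n (f n))"
    and Kb: "\<And>n g. g \<in> L2_T2 \<Longrightarrow> nrm tor (T n g) \<le> K n * nrm tor g"
    by metis
  define X where "X = rec_nat (\<lambda>z. 0) (\<lambda>n X z. X z +
    (if nrm tor (T n (\<lambda>z. 1 * X z + of_real ((1/3) ^ n) * f n z)) \<ge> 9/10 * (1/3) ^ n * K n then of_real ((1/3) ^ n) else - of_real ((1/3) ^ n)) * f n z)"
  define s where "s n z = X (Suc n) z - X n z" for n z
  have X0: "X 0 = (\<lambda>z. 0)" by (simp add: X_def)
  have XS: "X (Suc n) = (\<lambda>z. X n z +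
    (if nrm tor (T n (\<lambda>z. 1 * X n z + of_real ((1/3) ^ n) * f n z)) \<ge> 9/10 * (1/3) ^ n * K n then of_real ((1/3) ^ n) else - of_real ((1/3) ^ n)) * f n z)" for n
    by (simp add: X_def)
  have XL: "X n \<in> L2_T2" for n
  proof (induction n)
    case (Suc n)
    show ?case unfolding XS by (intro L2_T2_add L2_T2_cmult Suc f)
  qed (simp add: X0 L2_T2_zero)
  have sL: "s n \<in> L2_T2" for n unfolding s_def[abs_def] by (intro L2_T2_diff XL)
  have sb: "nrm tor (s n) \<le> (1/3) ^ n" for n
  proof -
    have "s n = (\<lambda>z. (if nrm tor (T n (\<lambda>z. 1 * X n z + of_real ((1/3) ^ n) * f n z)) \<ge> 9/10 * (1/3) ^ n * K n then of_real ((1/3) ^ n) else - of_real ((1/3) ^ n)) * f n z)"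
      by (simp add: s_def[abs_def] XS)
    then have "nrm tor (s n) = (1/3) ^ n * nrm tor (f n)"
      by (simp add: nrm_cmult norm_power norm_divide nrm_uminus del: of_real_power)
    then show ?thesis using f1[of n] by (simp add: mult_left_le)
  qed
  have sumX: "(\<Sum>i<n. s i z) = X n z" for n z
    by (induction n) (simp_all add: X0 s_def)
  \<comment> \<open>If the plus sign fails, the minus sign works: the images of the two candidates
    differ by \<open>2 * (1/3) ^ n\<close> times \<open>T n (f n)\<close>, so they cannot both be
    small.\<close>
  have big: "9/10 * (1/3) ^ n * K n \<le> nrm tor (T n (X (Suc n)))" for n
  proof (cases "nrm tor (T n (\<lambda>z. 1 * X n z + of_real ((1/3) ^ n) * f n z)) \<ge> 9/10 * (1/3) ^ n * K n")
    case True
    then show ?thesis by (simp add: XS)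
  next
    case False
    let ?c = "complex_of_real ((1/3) ^ n)"
    note TL = bounded_L2_opD(1)[OF T]
    have a: "(\<lambda>z. 1 * T n (X n) z + ?c * T n (f n) z) \<in> sq tor" "(\<lambda>z. 1 * T n (X n) z + (- ?c) * T n (f n) z) \<in> sq tor"
      by (intro L2_T2_sq L2_T2_lincomb TL XL f)+
    have "2 * ((1/3) ^ n * nrm tor (T n (f n))) = nrm tor (\<lambda>z. (2 * ?c) * T n (f n) z)"
      by (simp add: nrm_cmult norm_mult norm_power norm_divide)
    also have "(\<lambda>z. (2 * ?c) * T n (f n) z) = (\<lambda>z. (1 * T n (X n) z + ?c * T n (f n) z) - (1 * T n (X n) z + (- ?c) * T n (f n) z))"
      by (simp add: algebra_simps)
    also have "nrm tor \<dots> \<le> nrm tor (\<lambda>z. 1 * T n (X n) z + ?c * T n (f n) z) + nrm tor (\<lambda>z. 1 * T n (X n) z + (- ?c) * T n (f n) z)"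
      by (rule nrm_triangle_diff[OF a])
    also have "\<dots> = nrm tor (T n (\<lambda>z. 1 * X n z + ?c * f n z)) + nrm tor (T n (\<lambda>z. 1 * X n z + (- ?c) * f n z))"
      by (simp only: op_lincomb_nrm[OF T XL f])
    also have "\<dots> \<le> 9/10 * (1/3) ^ n * K n + nrm tor (T n (X (Suc n)))"
      using False by (simp add: XS)
    finally have "2 * ((1/3) ^ n * nrm tor (T n (f n))) \<le> 9/10 * (1/3) ^ n * K n + nrm tor (T n (X (Suc n)))" .
    moreover have "(1/3) ^ n * (9/10 * K n) \<le> (1/3) ^ n * nrm tor (T n (f n))" by (intro mult_left_mono opt) simp
    moreover have "(1/3) ^ n * (9/10 * K n) = 9/10 * (1/3) ^ n * K n" by simp
    ultimately show ?thesis by linarith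
  qed
  define x where "x z = (\<Sum>i. s i z)" for z
  have xs: "x \<in> sq tor" unfolding x_def[abs_def] by (rule sq_series(1)) (use sL L2_T2_sq sb in auto)
  \<comment> \<open>Periodicity holds even where the series diverges, because the value of
    \<open>suminf\<close> depends only on the sequence of terms.\<close>
  have xL: "x \<in> L2_T2"
    unfolding L2_T2_iff using xs L2_T2_periodic[OF sL] by (simp add: periodic2_def x_def)
  have tail: "nrm tor (\<lambda>z. x z - X (Suc n) z) \<le> 1/2 * (1/3) ^ n" for n
    using sq_series(2)[of s tor "Suc n"] sL L2_T2_sq sb by (simp add: x_def sumX)
  \<comment> \<open>The hump contributes 9/10 and the tail costs at most 1/2, both in units of
    \<open>(1/3) ^ n * K n\<close>, which is at least \<open>(4/3) ^ n\<close>.\<close>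
  have "2/5 * (4/3) ^ n \<le> nrm tor (T n x)" for n
  proof -
    have K0: "0 \<le> K n" using K[of n] by (meson order_trans zero_le_numeral zero_le_power)
    have "nrm tor (T n (X (Suc n))) \<le> nrm tor (T n x) + nrm tor (\<lambda>z. T n (X (Suc n)) z - T n x z)"
      by (intro nrm_le_add_diff L2_T2_sq bounded_L2_opD(1)[OF T] XL xL)
    also have "nrm tor (\<lambda>z. T n (X (Suc n)) z - T n x z) = nrm tor (\<lambda>z. T n x z - T n (X (Suc n)) z)"
      by (rule nrm_minus_commute)
    also have "\<dots> = nrm tor (T n (\<lambda>z. x z - X (Suc n) z))"
      by (rule op_diff_nrm[OF T xL XL])
    also have "\<dots> \<le> K n * nrm tor (\<lambda>z. x z - X (Suc n) z)"
      by (intro Kb L2_T2_diff xL XL)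
    also have "\<dots> \<le> K n * (1/2 * (1/3) ^ n)" by (intro mult_left_mono tail K0)
    finally have "9/10 * (1/3) ^ n * K n \<le> nrm tor (T n x) + K n * (1/2 * (1/3) ^ n)" using big[of n] by linarith
    then have "2/5 * ((1/3) ^ n * K n) \<le> nrm tor (T n x)" by (simp add: algebra_simps)
    moreover have "(1/3) ^ n * 4 ^ n \<le> (1/3) ^ n * K n" by (intro mult_left_mono K) simp
    moreover have "(1/3) ^ n * 4 ^ n = (4/3 :: real) ^ n" by (simp add: power_mult_distrib[symmetric])
    ultimately show ?thesis by linarith
  qed
  with xL show thesis by (rule that)
qed

section \<open>Semigroups generated by the drift-diffusion operator\<close>

lemma op_quot:
  assumes T: "bounded_L2_op T" and L: "a \<in> L2_T2" "b \<in> L2_T2" "c \<in> L2_T2"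
  shows "AE z in tor. T (\<lambda>z. (a z - b z) / of_real h - c z) z = (T a z - T b z) / of_real h - T c z"
proof -
  let ?w = "\<lambda>z. (1 / of_real h) * a z + (- 1 / of_real h) * b z"
  have w: "?w \<in> L2_T2" by (intro L2_T2_lincomb L)
  have eq: "(\<lambda>z. (a z - b z) / of_real h - c z) = (\<lambda>z. 1 * ?w z + (-1) * c z)"
    by (auto simp: diff_divide_distrib)
  show ?thesis
    unfolding eq using bounded_L2_opD(2)[OF T w L(3), of 1 "-1"] bounded_L2_opD(2)[OF T L(1,2), of "1 / of_real h" "- 1 / of_real h"]
    by eventually_elim (simp add: diff_divide_distrib)
qed

lemma L2_T2_quot:
  assumes "a \<in> L2_T2" "b \<in> L2_T2" "c \<in> L2_T2"
  shows "(\<lambda>z. (a z - b z) / of_real h - c z) \<in> L2_T2"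
  using L2_T2_diff[OF L2_T2_cmult[OF L2_T2_diff[OF assms(1,2)], of "1 / of_real h"] assms(3)] by simp

lemma coef_quot:
  assumes L: "a \<in> sq tor" "b \<in> sq tor" "c \<in> sq tor"
  shows "AE y in circ. coef k (\<lambda>z. c z - (a z - b z) / of_real h) y = coef k c y - (coef k a y - coef k b y) / of_real h"
proof -
  let ?w = "\<lambda>z. (1 / of_real h) * a z + (- 1 / of_real h) * b z"
  have w: "?w \<in> sq tor" by (intro sq_add sq_cmult L)
  have eq: "(\<lambda>z. c z - (a z - b z) / of_real h) = (\<lambda>z. 1 * c z + (-1) * ?w z)"
    by (auto simp: diff_divide_distrib)
  show ?thesis
    unfolding eq using coef_lincomb[OF L(3) w, of k 1 "-1"] coef_lincomb[OF L(1,2), of k "1 / of_real h" "- 1 / of_real h"]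
    by eventually_elim (simp add: diff_divide_distrib)
qed

lemma nrm_coef_le:
  assumes "f \<in> sq tor" shows "nrm circ (coef k f) \<le> nrm tor f"
proof -
  have "1 * (nrm circ (coef k f))\<^sup>2 \<le> 2 * pi * (nrm circ (coef k f))\<^sup>2"
    using pi_gt3 by (intro mult_right_mono) auto
  also have "\<dots> \<le> (nrm tor f)\<^sup>2" by (rule coef_sq(2)[OF assms])
  finally have "(nrm circ (coef k f))\<^sup>2 \<le> (nrm tor f)\<^sup>2" by simp
  then show ?thesis by (rule power2_le_imp_le) simp
qed

lemma nrm_coef_cong:
  assumes "f \<in> L2_T2" "g \<in> L2_T2" "AE z in tor. f z = g z"
  shows "nrm circ (coef k f) = nrm circ (coef k g)"
proof (rule nrm_cong_AE)
  show "coef k f \<in> borel_measurable circ" "coef k g \<in> borel_measurable circ"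
    using coef_meas[OF L2_T2_meas[OF assms(1)]] coef_meas[OF L2_T2_meas[OF assms(2)]] by simp_all
  show "AE y in circ. coef k f y = coef k g y"
    by (rule coef_cong_AE[OF L2_T2_meas[OF assms(1)] L2_T2_meas[OF assms(2)] assms(3)])
qed

locale drift_semigroup =
  fixes S :: "real \<Rightarrow> L2_op" and \<mu> \<nu> :: real and u :: "real \<Rightarrow> real"
  assumes generated: "semigroup_generated_by S (drift_diffusion_op \<mu> \<nu> u)"
    and \<nu>: "0 < \<nu>" and \<mu>: "0 \<le> \<mu>" and u_cont: "continuous_on UNIV u"
begin

lemma C0: "C0_semigroup S" and gen_iff: "semigroup_generator S f g \<longleftrightarrow> drift_diffusion_op \<mu> \<nu> u f g"
  using generated by (auto simp: semigroup_generated_by_def)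

lemma S_op: "0 \<le> t \<Longrightarrow> bounded_L2_op (S t)"
  using C0 by (simp add: C0_semigroup_def)

lemma S_L2: "0 \<le> t \<Longrightarrow> f \<in> L2_T2 \<Longrightarrow> S t f \<in> L2_T2"
  by (rule bounded_L2_opD(1)[OF S_op])

lemma S_zero: "f \<in> L2_T2 \<Longrightarrow> AE z in tor. S 0 f z = f z"
  using C0 by (intro AE_tor) (simp add: C0_semigroup_def ae_eq_def)

lemma S_add: "0 \<le> s \<Longrightarrow> 0 \<le> t \<Longrightarrow> f \<in> L2_T2 \<Longrightarrow> AE z in tor. S (s + t) f z = S s (S t f) z"
  using C0 by (intro AE_tor) (simp add: C0_semigroup_def ae_eq_def)

lemma S_cont:
  assumes f: "f \<in> L2_T2"
  shows "((\<lambda>t. nrm tor (\<lambda>z. S t f z - f z)) \<longlongrightarrow> 0) (at_right 0)"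
proof -
  have 1: "((\<lambda>t. L2_norm (\<lambda>z. S t f z - f z)) \<longlongrightarrow> 0) (at_right 0)"
    using C0 f by (simp add: C0_semigroup_def)
  have 2: "\<forall>\<^sub>F t in at_right 0. L2_norm (\<lambda>z. S t f z - f z) = nrm tor (\<lambda>z. S t f z - f z)"
    using eventually_at_right_less
  proof eventually_elim
    case (elim t)
    then show ?case by (intro L2_norm_eq L2_T2_meas L2_T2_diff S_L2 f) simp
  qed
  show ?thesis by (rule iffD1[OF tendsto_cong[OF 2] 1])
qed

lemma generator_iff:
  "semigroup_generator S f g \<longleftrightarrow> f \<in> L2_T2 \<and> g \<in> L2_T2 \<and>
    ((\<lambda>h. nrm tor (\<lambda>z. (S h f z - f z) / of_real h - g z)) \<longlongrightarrow> 0) (at_right 0)"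
proof -
  have "((\<lambda>h. L2_norm (\<lambda>z. (S h f z - f z) / of_real h - g z)) \<longlongrightarrow> 0) (at_right 0) \<longleftrightarrow>
    ((\<lambda>h. nrm tor (\<lambda>z. (S h f z - f z) / of_real h - g z)) \<longlongrightarrow> 0) (at_right 0)"
    if f: "f \<in> L2_T2" and g: "g \<in> L2_T2"
  proof (rule tendsto_cong)
    show "\<forall>\<^sub>F h in at_right 0. L2_norm (\<lambda>z. (S h f z - f z) / of_real h - g z) = nrm tor (\<lambda>z. (S h f z - f z) / of_real h - g z)"
      using eventually_at_right_less
    proof eventually_elim
      case (elim t)
      then show ?case by (intro L2_norm_eq L2_T2_meas L2_T2_quot S_L2 f g) simp
    qed
  qed
  then show ?thesis unfolding semigroup_generator_def by auto
qed

text \<open>Otherwise there are times \<open>t n\<close> tending to 0 at which the norm of the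
  operator exceeds \<open>4 ^ n\<close>. The gliding hump yields one vector whose images at these
  times are unbounded, against strong continuity at 0.\<close>

lemma local_bound:
  obtains M h where "1 \<le> M" "0 < h" "\<And>t f. 0 \<le> t \<Longrightarrow> t \<le> h \<Longrightarrow> f \<in> L2_T2 \<Longrightarrow> nrm tor (S t f) \<le> M * nrm tor f"
proof -
  have "\<exists>M h. 1 \<le> M \<and> 0 < h \<and> (\<forall>t f. 0 \<le> t \<longrightarrow> t \<le> h \<longrightarrow> f \<in> L2_T2 \<longrightarrow> nrm tor (S t f) \<le> M * nrm tor f)"
  proof (rule ccontr)
    assume contr: "\<not> ?thesis"
    have neg: "\<not> (\<forall>t f. 0 \<le> t \<longrightarrow> t \<le> h \<longrightarrow> f \<in> L2_T2 \<longrightarrow> nrm tor (S t f) \<le> M * nrm tor f)"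
      if "1 \<le> M" "0 < h" for M h using contr that by blast
    have "\<exists>t. 0 \<le> t \<and> t \<le> 1 / real (Suc n) \<and> (\<exists>f\<in>L2_T2. 4 ^ n * nrm tor f < nrm tor (S t f))" for n
      using neg[of "4 ^ n" "1 / real (Suc n)"] by (auto simp: not_le)
    then obtain t where t0: "\<And>n. 0 \<le> t n" and t1: "\<And>n. t n \<le> 1 / real (Suc n)"
      and large: "\<And>n. \<exists>f\<in>L2_T2. 4 ^ n * nrm tor f < nrm tor (S (t n) f)"
      by metis
    \<comment> \<open>The filter \<open>at_right 0\<close> excludes time 0 itself; there the
      operator is the identity up to null sets and cannot be large.\<close>
    have tpos: "0 < t n" for n
    proof (rule ccontr)
      assume "\<not> 0 < t n"
      then have "t n = 0" using t0[of n] by simp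
      obtain f where f: "f \<in> L2_T2" "4 ^ n * nrm tor f < nrm tor (S (t n) f)" using large by blast
      have "nrm tor (S (t n) f) = nrm tor f"
        unfolding \<open>t n = 0\<close> by (intro nrm_tor_cong S_L2 S_zero f) simp
      moreover have "1 * nrm tor f \<le> 4 ^ n * nrm tor f" by (intro mult_right_mono) auto
      ultimately show False using f(2) by simp
    qed
    obtain x where x: "x \<in> L2_T2" and big: "\<And>n. 2/5 * (4/3) ^ n \<le> nrm tor (S (t n) x)"
      using gliding_hump[of "\<lambda>n. S (t n)", OF S_op[OF t0] large] by blast
    have "t \<longlonglongrightarrow> 0"
      by (rule tendsto_sandwich[OF _ _ tendsto_const LIMSEQ_inverse_real_of_nat])
        (use t0 t1 in \<open>auto simp: inverse_eq_divide\<close>)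
    moreover have "t n \<noteq> 0" for n using tpos[of n] by simp
    ultimately have "filterlim t (at_right 0) sequentially"
      using tpos by (simp add: filterlim_at)
    then have "(\<lambda>n. nrm tor (\<lambda>z. S (t n) x z - x z)) \<longlonglongrightarrow> 0"
      by (rule filterlim_compose[OF S_cont[OF x]])
    then have "\<forall>\<^sub>F n in sequentially. nrm tor (\<lambda>z. S (t n) x z - x z) < 1"
      by (intro order_tendstoD(2)) auto
    then obtain n0 where n0: "\<And>n. n \<ge> n0 \<Longrightarrow> nrm tor (\<lambda>z. S (t n) x z - x z) < 1"
      by (auto simp: eventually_sequentially)
    obtain n1 where n1: "(nrm tor x + 1) * (5/2) < (4/3 :: real) ^ n1" using real_arch_pow[of "4/3" "(nrm tor x + 1) * (5/2)"] by auto
    define n where "n = max n0 n1"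
    have contra: False if "Q \<le> P" "s \<le> y + e" "e < 1" "2/5 * P \<le> s" "(y + 1) * (5/2) < Q" for P Q s y e :: real
    proof -
      have "2 * P \<le> 5 * s" "5 * y + 5 < 2 * Q" using that(4,5) by simp_all
      then show False using that(1-3) by linarith
    qed
    have "(4/3 :: real) ^ n1 \<le> (4/3) ^ n" by (intro power_increasing) (auto simp: n_def)
    moreover have "nrm tor (S (t n) x) \<le> nrm tor x + nrm tor (\<lambda>z. S (t n) x z - x z)"
      by (intro nrm_le_add_diff L2_T2_sq S_L2 t0 x)
    moreover have "nrm tor (\<lambda>z. S (t n) x z - x z) < 1" by (rule n0) (simp add: n_def)
    ultimately show False using big[of n] n1 by (rule contra)
  qed
  then show thesis using that by blast
qed

lemma bound_upto:
  obtains M where "0 \<le> M" "\<And>t f. 0 \<le> t \<Longrightarrow> t \<le> T \<Longrightarrow> f \<in> L2_T2 \<Longrightarrow> nrm tor (S t f) \<le> M * nrm tor f"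
proof -
  obtain M h where M: "1 \<le> M" and h: "0 < h"
    and b: "\<And>t f. 0 \<le> t \<Longrightarrow> t \<le> h \<Longrightarrow> f \<in> L2_T2 \<Longrightarrow> nrm tor (S t f) \<le> M * nrm tor f"
    using local_bound by blast
  have *: "nrm tor (S t f) \<le> M ^ Suc n * nrm tor f" if "0 \<le> t" "t \<le> real (Suc n) * h" "f \<in> L2_T2" for n t f
    using that
  proof (induction n arbitrary: t)
    case 0
    then show ?case using b by simp
  next
    case (Suc n)
    show ?case
    proof (cases "t \<le> h")
      case True
      have "nrm tor (S t f) \<le> M ^ 1 * nrm tor f" using b Suc.prems True by simp
      also have "\<dots> \<le> M ^ Suc (Suc n) * nrm tor f" using M by (intro mult_right_mono power_increasing) auto
      finally show ?thesis .
    next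
      case False
      have th: "0 \<le> t - h" "t - h \<le> real (Suc n) * h" using False Suc.prems by (auto simp: algebra_simps)
      have "nrm tor (S t f) = nrm tor (S h (S (t - h) f))"
        using S_add[of h "t - h" f] h th Suc.prems by (intro nrm_tor_cong S_L2) auto
      also have "\<dots> \<le> M * nrm tor (S (t - h) f)" using h th Suc.prems by (intro b S_L2) auto
      also have "\<dots> \<le> M * (M ^ Suc n * nrm tor f)" using M Suc th by (intro mult_left_mono) auto
      finally show ?thesis by (simp add: mult.assoc)
    qed
  qed
  obtain n where "T / h \<le> real n" using real_arch_simple by blast
  then have "T \<le> real n * h" using h by (simp add: field_simps)
  also have "\<dots> \<le> real (Suc n) * h" using h by simp
  finally show thesis using *[of _ n] that[of "M ^ Suc n"] M by (meson order_trans zero_le_one zero_le_power)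
qed

text \<open>\<open>S t\<close> commutes with the difference quotients at 0 and is bounded, so
  convergence of these quotients is preserved along the orbit.\<close>

lemma generator_shift:
  assumes fg: "semigroup_generator S f g" and t: "0 \<le> t"
  shows "semigroup_generator S (S t f) (S t g)"
  unfolding generator_iff
proof (intro conjI)
  have f: "f \<in> L2_T2" and g: "g \<in> L2_T2"
    and lim: "((\<lambda>h. nrm tor (\<lambda>z. (S h f z - f z) / of_real h - g z)) \<longlongrightarrow> 0) (at_right 0)"
    using fg by (auto simp: generator_iff)
  show "S t f \<in> L2_T2" "S t g \<in> L2_T2" by (intro S_L2 t f g)+
  obtain M where M: "\<And>w. w \<in> L2_T2 \<Longrightarrow> nrm tor (S t w) \<le> M * nrm tor w"
    using bounded_L2_opD(3)[OF S_op[OF t]] by blast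
  show "((\<lambda>h. nrm tor (\<lambda>z. (S h (S t f) z - S t f z) / of_real h - S t g z)) \<longlongrightarrow> 0) (at_right 0)"
  proof (rule Lim_null_comparison)
    show "((\<lambda>h. M * nrm tor (\<lambda>z. (S h f z - f z) / of_real h - g z)) \<longlongrightarrow> 0) (at_right 0)"
      using tendsto_mult_right_zero[OF lim] .
    show "\<forall>\<^sub>F h in at_right 0. norm (nrm tor (\<lambda>z. (S h (S t f) z - S t f z) / of_real h - S t g z))
        \<le> M * nrm tor (\<lambda>z. (S h f z - f z) / of_real h - g z)"
      using eventually_at_right_less
    proof eventually_elim
      case (elim h)
      then have h: "0 \<le> h" by simp
      have "AE z in tor. S (h + t) f z = S h (S t f) z" "AE z in tor. S (t + h) f z = S t (S h f) z"
        by (intro S_add h t f)+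
      then have "AE z in tor. (S h (S t f) z - S t f z) / of_real h - S t g z = S t (\<lambda>z. (S h f z - f z) / of_real h - g z) z"
        using op_quot[OF S_op[OF t] S_L2[OF h f] f g, of h]
        by eventually_elim (simp add: add.commute)
      then have "nrm tor (\<lambda>z. (S h (S t f) z - S t f z) / of_real h - S t g z) = nrm tor (S t (\<lambda>z. (S h f z - f z) / of_real h - g z))"
        by (intro nrm_tor_cong L2_T2_quot S_L2 h t f g)
      also have "\<dots> \<le> M * nrm tor (\<lambda>z. (S h f z - f z) / of_real h - g z)"
        by (intro M L2_T2_quot S_L2 h f g)
      finally show ?case by simp
    qed
  qed
qed

text \<open>The local error of the first implicit Euler step: the difference quotient is compared
  with the generator at the end of the step, hence \<open>S \<tau> g\<close> in place of
  \<open>g\<close>.\<close>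

definition defect :: "(real \<times> real \<Rightarrow> complex) \<Rightarrow> (real \<times> real \<Rightarrow> complex) \<Rightarrow> real \<Rightarrow> real" where
  "defect f g \<tau> = nrm tor (\<lambda>z. (S \<tau> f z - f z) / of_real \<tau> - S \<tau> g z)"

lemma defect_lim:
  assumes fg: "semigroup_generator S f g"
  shows "(defect f g \<longlongrightarrow> 0) (at_right 0)"
proof (rule Lim_null_comparison)
  have f: "f \<in> L2_T2" and g: "g \<in> L2_T2"
    and lim: "((\<lambda>h. nrm tor (\<lambda>z. (S h f z - f z) / of_real h - g z)) \<longlongrightarrow> 0) (at_right 0)"
    using fg by (auto simp: generator_iff)
  show "((\<lambda>h. nrm tor (\<lambda>z. (S h f z - f z) / of_real h - g z) + nrm tor (\<lambda>z. S h g z - g z)) \<longlongrightarrow> 0) (at_right 0)"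
    using tendsto_add[OF lim S_cont[OF g]] by simp
  show "\<forall>\<^sub>F h in at_right 0. norm (defect f g h) \<le> nrm tor (\<lambda>z. (S h f z - f z) / of_real h - g z) + nrm tor (\<lambda>z. S h g z - g z)"
    using eventually_at_right_less
  proof eventually_elim
    case (elim h)
    then have h: "0 \<le> h" by simp
    have "defect f g h = nrm tor (\<lambda>z. ((S h f z - f z) / of_real h - g z) - (S h g z - g z))"
      by (simp add: defect_def)
    also have "\<dots> \<le> nrm tor (\<lambda>z. (S h f z - f z) / of_real h - g z) + nrm tor (\<lambda>z. S h g z - g z)"
      by (intro nrm_triangle_diff L2_T2_sq L2_T2_quot L2_T2_diff S_L2 h f g)
    finally show ?case by (simp add: defect_def)
  qed
qed

text \<open>The local error of step \<open>j\<close> is \<open>S ((j - 1) * \<tau>)\<close> applied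
  to that of the first step, so a bound \<open>M\<close> up to time \<open>T\<close> controls all of
  them at once. Passing to the coefficient does not increase the norm.\<close>

lemma orbit:
  assumes fg: "semigroup_generator S f g" and T: "0 < T" and N: "0 < N" and \<tau>: "\<tau> = T / real N"
    and M: "0 \<le> M" "\<And>t f. 0 \<le> t \<Longrightarrow> t \<le> T \<Longrightarrow> f \<in> L2_T2 \<Longrightarrow> nrm tor (S t f) \<le> M * nrm tor f"
  shows "discrete_orbit circ (mode_op \<mu> \<nu> u k) (\<lambda>j. coef k (S (real j * \<tau>) f)) (\<lambda>j. coef k (S (real j * \<tau>) g))
    N \<tau> (M * defect f g \<tau>)"
proof
  have f: "f \<in> L2_T2" and g: "g \<in> L2_T2" using fg by (auto simp: generator_iff)
  show \<tau>0: "0 < \<tau>" using T N by (simp add: \<tau>)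
  show "0 < N" by fact
  show "F \<in> sq circ \<and> G \<in> sq circ" if "mode_op \<mu> \<nu> u k F G" for F G
    using mode_opD(1,2)[OF that] by simp
  show "mode_op \<mu> \<nu> u k (\<lambda>x. \<Sum>j\<in>J. c j * fs j x) (\<lambda>x. \<Sum>j\<in>J. c j * gs j x)"
    if "\<And>j. j \<in> J \<Longrightarrow> mode_op \<mu> \<nu> u k (fs j) (gs j)" for J :: "nat set" and c fs gs
    by (rule mode_op_sum[OF u_cont that])
  show "nrm circ F \<le> nrm circ (\<lambda>x. F x - of_real s * G x)" if "mode_op \<mu> \<nu> u k F G" "0 \<le> s" for F G s
    by (rule mode_op_dissipative[OF that(1) \<nu> \<mu> u_cont that(2)])
  show "mode_op \<mu> \<nu> u k (coef k (S (real j * \<tau>) f)) (coef k (S (real j * \<tau>) g))" for j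
    using generator_shift[OF fg, of "real j * \<tau>"] \<tau>0 by (intro drift_diffusion_mode_op u_cont) (simp add: gen_iff)
  fix j assume j: "1 \<le> j" "j \<le> N"
  define s where "s = real (j - 1) * \<tau>"
  have s0: "0 \<le> s" using \<tau>0 by (simp add: s_def)
  have js: "real j * \<tau> = s + \<tau>" using j by (simp add: s_def of_nat_diff algebra_simps)
  have sT: "s \<le> T"
  proof -
    have "s \<le> real N * \<tau>" unfolding s_def using j \<tau>0 by (intro mult_right_mono) auto
    then show ?thesis using N by (simp add: \<tau>)
  qed
  have t0: "0 \<le> \<tau>" "0 \<le> s + \<tau>" using \<tau>0 s0 by auto
  let ?w = "\<lambda>z. S (s + \<tau>) g z - (S (s + \<tau>) f z - S s f z) / of_real \<tau>"
  have L: "S (s + \<tau>) f \<in> L2_T2" "S s f \<in> L2_T2" "S (s + \<tau>) g \<in> L2_T2" by (intro S_L2 t0 s0 f g)+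
  have wL: "?w \<in> L2_T2"
    using L2_T2_cmult[OF L2_T2_quot[OF L, of \<tau>], of "-1"] by simp
  have "nrm circ (\<lambda>x. coef k (S (s + \<tau>) g) x - (coef k (S (s + \<tau>) f) x - coef k (S s f) x) / of_real \<tau>) = nrm circ (coef k ?w)"
  proof (rule nrm_cong_AE)
    show "AE y in circ. coef k (S (s + \<tau>) g) y - (coef k (S (s + \<tau>) f) y - coef k (S s f) y) / of_real \<tau> = coef k ?w y"
      using coef_quot[OF L[THEN L2_T2_sq], of k \<tau>] by eventually_elim simp
    have [measurable]: "coef k (S (s + \<tau>) g) \<in> borel_measurable borel" "coef k (S (s + \<tau>) f) \<in> borel_measurable borel"
      "coef k (S s f) \<in> borel_measurable borel" "coef k ?w \<in> borel_measurable borel"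
      by (intro coef_meas L2_T2_meas L wL)+
    show "(\<lambda>y. coef k (S (s + \<tau>) g) y - (coef k (S (s + \<tau>) f) y - coef k (S s f) y) / of_real \<tau>) \<in> borel_measurable circ"
      "coef k ?w \<in> borel_measurable circ" by measurable
  qed
  also have "\<dots> \<le> nrm tor ?w" by (intro nrm_coef_le L2_T2_sq wL)
  also have "\<dots> = nrm tor (\<lambda>z. (S (s + \<tau>) f z - S s f z) / of_real \<tau> - S (s + \<tau>) g z)"
    by (rule nrm_minus_commute)
  also have "\<dots> = nrm tor (S s (\<lambda>z. (S \<tau> f z - f z) / of_real \<tau> - S \<tau> g z))"
  proof (rule nrm_tor_cong)
    show "AE z in tor. (S (s + \<tau>) f z - S s f z) / of_real \<tau> - S (s + \<tau>) g z = S s (\<lambda>z. (S \<tau> f z - f z) / of_real \<tau> - S \<tau> g z) z"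
      using op_quot[OF S_op[OF s0] S_L2[OF t0(1) f] f S_L2[OF t0(1) g], of \<tau>] S_add[OF s0 t0(1) f] S_add[OF s0 t0(1) g]
      by eventually_elim simp
  qed (intro L2_T2_quot L S_L2 s0 t0 f g)+
  also have "\<dots> \<le> M * defect f g \<tau>"
    unfolding defect_def by (intro M s0 sT L2_T2_quot S_L2 t0 f g)
  finally show "nrm circ (\<lambda>x. coef k (S (real j * \<tau>) g) x - (coef k (S (real j * \<tau>) f) x - coef k (S (real (j - 1) * \<tau>) f) x) / of_real \<tau>)
      \<le> M * defect f g \<tau>"
    by (simp only: js s_def[symmetric])
qed

text \<open>The interval is divided into \<open>4 * Suc n\<close> steps because the tent window asks
  for a multiple of 4.\<close>

lemma defect_seq:
  assumes fg: "semigroup_generator S f g" and T: "0 < T"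
  shows "(\<lambda>n. T * (M * defect f g (T / real (4 * Suc n)))) \<longlonglongrightarrow> 0"
proof -
  have eq: "T / real (4 * Suc n) = (T / 4) * inverse (real (Suc n))" for n
    unfolding of_nat_mult of_nat_numeral divide_inverse inverse_mult_distrib mult.assoc ..
  have "(\<lambda>n. T / real (4 * Suc n)) \<longlonglongrightarrow> (T / 4) * 0"
    unfolding eq by (rule tendsto_mult_left[OF LIMSEQ_inverse_real_of_nat])
  moreover have "0 < T / real (4 * Suc n)" for n using T by simp
  then have "T / real (4 * Suc n) \<in> {0<..} \<and> T / real (4 * Suc n) \<noteq> 0" for n by (metis greaterThan_iff less_irrefl)
  ultimately have "filterlim (\<lambda>n. T / real (4 * Suc n)) (at_right 0) sequentially"
    by (simp only: filterlim_at mult_zero_right eventually_True simp_thms)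
  then have "(\<lambda>n. defect f g (T / real (4 * Suc n))) \<longlonglongrightarrow> 0"
    by (rule filterlim_compose[OF defect_lim[OF fg]])
  then have "(\<lambda>n. T * (M * defect f g (T / real (4 * Suc n)))) \<longlonglongrightarrow> T * (M * 0)"
    by (intro tendsto_intros)
  then show ?thesis by simp
qed

section \<open>Contraction, halving and exponential decay of a coefficient\<close>

lemma coef_S_zero: "f \<in> L2_T2 \<Longrightarrow> nrm circ (coef k (S 0 f)) = nrm circ (coef k f)"
  by (intro nrm_coef_cong S_L2 S_zero) auto

text \<open>The discrete contraction estimate in the limit of small steps. It holds for every
  frequency separately, so it also shows that a mode that vanishes initially stays zero.\<close>

lemma coef_contraction:
  assumes fg: "semigroup_generator S f g" and T: "0 \<le> T"
  shows "nrm circ (coef k (S T f)) \<le> nrm circ (coef k f)"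
proof (cases "T = 0")
  case True
  then show ?thesis using coef_S_zero fg by (auto simp: generator_iff)
next
  case False
  then have T: "0 < T" using T by simp
  have f: "f \<in> L2_T2" using fg by (simp add: generator_iff)
  obtain M where M: "0 \<le> M" "\<And>t f. 0 \<le> t \<Longrightarrow> t \<le> T \<Longrightarrow> f \<in> L2_T2 \<Longrightarrow> nrm tor (S t f) \<le> M * nrm tor f"
    using bound_upto[of T] by blast
  let ?e = "\<lambda>n. T * (M * defect f g (T / real (4 * Suc n)))"
  have "nrm circ (coef k (S T f)) \<le> nrm circ (coef k f) + ?e n" for n
  proof -
    let ?N = "4 * Suc n" and ?\<tau> = "T / real (4 * Suc n)"
    have N: "0 < ?N" by simp
    interpret o: discrete_orbit circ "mode_op \<mu> \<nu> u k" "\<lambda>j. coef k (S (real j * ?\<tau>) f)" "\<lambda>j. coef k (S (real j * ?\<tau>) g)"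
      ?N ?\<tau> "M * defect f g ?\<tau>"
      by (rule orbit[OF fg T N refl M])
    have NT: "real ?N * ?\<tau> = T" by simp
    have "nrm circ (coef k (S (real ?N * ?\<tau>) f)) \<le> nrm circ (coef k (S (real 0 * ?\<tau>) f)) + (real ?N - real 0) * ?\<tau> * (M * defect f g ?\<tau>)"
      by (rule o.contraction) auto
    then show ?thesis unfolding NT using coef_S_zero[OF f, of k] by (simp add: NT[simplified])
  qed
  moreover have "(\<lambda>n. nrm circ (coef k f) + ?e n) \<longlonglongrightarrow> nrm circ (coef k f) + 0"
    by (intro tendsto_add tendsto_const defect_seq[OF fg T])
  ultimately show ?thesis by (intro LIMSEQ_le_const[of _ "nrm circ (coef k f)"]) auto
qed

text \<open>The time 16 / \<Psi> is chosen to beat the factor 8 of the window estimate: in the limit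
  of small steps that estimate reads (16 x)^2 \<le> 64 y^2 for the final norm \<open>x\<close> and
  the initial norm \<open>y\<close>.\<close>

lemma coef_halving:
  assumes fg: "semigroup_generator S f g" and \<Psi>: "0 < \<Psi>"
    and resolvent: "\<And>F G z. mode_op \<mu> \<nu> u k F G \<Longrightarrow> 0 \<le> Re z \<Longrightarrow> \<Psi> * nrm circ F \<le> nrm circ (\<lambda>y. G y - z * F y)"
  shows "nrm circ (coef k (S (16 / \<Psi>) f)) \<le> 1/2 * nrm circ (coef k f)"
proof -
  define T where "T = 16 / \<Psi>"
  have T: "0 < T" using \<Psi> by (simp add: T_def)
  have f: "f \<in> L2_T2" using fg by (simp add: generator_iff)
  obtain M where M: "0 \<le> M" "\<And>t f. 0 \<le> t \<Longrightarrow> t \<le> T \<Longrightarrow> f \<in> L2_T2 \<Longrightarrow> nrm tor (S t f) \<le> M * nrm tor f"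
    using bound_upto[of T] by blast
  define e where "e n = T * (M * defect f g (T / real (4 * Suc n)))" for n
  define x where "x = nrm circ (coef k (S T f))"
  define y where "y = nrm circ (coef k f)"
  have e0: "e \<longlonglongrightarrow> 0" unfolding e_def by (rule defect_seq[OF fg T])
  have "x \<le> 1/2 * y"
  proof (cases "x = 0")
    case False
    then have x0: "0 < x" using nrm_nonneg[of circ "coef k (S T f)"] unfolding x_def by linarith
    \<comment> \<open>The window estimate asks for a nonnegative lower bound \<open>x - e n\<close>,
      which is available eventually since \<open>x\<close> is positive.\<close>
    have ev: "\<forall>\<^sub>F n in sequentially. (\<Psi> * T * (x - e n))\<^sup>2 \<le> 64 * ((y + e n)\<^sup>2 + (e n)\<^sup>2)"
      using order_tendstoD(2)[OF e0 x0]
    proof eventually_elim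
      case (elim n)
      let ?N = "4 * Suc n" and ?\<tau> = "T / real (4 * Suc n)"
      have N: "0 < ?N" by simp
      interpret o: discrete_orbit circ "mode_op \<mu> \<nu> u k" "\<lambda>j. coef k (S (real j * ?\<tau>) f)" "\<lambda>j. coef k (S (real j * ?\<tau>) g)"
        ?N ?\<tau> "M * defect f g ?\<tau>"
        by (rule orbit[OF fg T N refl M])
      have NT: "T = real ?N * ?\<tau>" by simp
      have "(\<Psi> * T * (x - e n))\<^sup>2 \<le> 64 * ((nrm circ (coef k (S (real 0 * ?\<tau>) f)) + T * (M * defect f g ?\<tau>))\<^sup>2 + (T * (M * defect f g ?\<tau>))\<^sup>2)"
        by (rule o.window[OF resolvent less_imp_le[OF \<Psi>] refl NT])
          (use elim NT in \<open>auto simp: x_def e_def simp flip: NT\<close>)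
      then show ?case using coef_S_zero[OF f, of k] by (simp add: y_def e_def)
    qed
    have l1: "(\<lambda>n. (\<Psi> * T * (x - e n))\<^sup>2) \<longlonglongrightarrow> (\<Psi> * T * (x - 0))\<^sup>2"
      and l2: "(\<lambda>n. 64 * ((y + e n)\<^sup>2 + (e n)\<^sup>2)) \<longlonglongrightarrow> 64 * ((y + 0)\<^sup>2 + 0\<^sup>2)"
      by (intro tendsto_intros e0)+
    have "(\<Psi> * T * (x - 0))\<^sup>2 \<le> 64 * ((y + 0)\<^sup>2 + 0\<^sup>2)"
      by (rule tendsto_le[OF sequentially_bot l2 l1 ev])
    then have "(16 * x)\<^sup>2 \<le> (8 * y)\<^sup>2" using \<Psi> by (simp add: T_def power_mult_distrib)
    then have "16 * x \<le> 8 * y" by (rule power2_le_imp_le) (simp add: y_def)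
    then show ?thesis by simp
  qed (simp add: y_def)
  then show ?thesis by (simp add: x_def y_def T_def)
qed

text \<open>Halving is iterated at the multiples of 16 / \<Psi>, and the contraction property covers
  the remaining time. Rounding the number of halvings down costs the factor 2.\<close>

lemma coef_decay:
  assumes fg: "semigroup_generator S f g" and \<Psi>: "0 < \<Psi>" and t: "0 \<le> t"
    and resolvent: "\<And>F G z. mode_op \<mu> \<nu> u k F G \<Longrightarrow> 0 \<le> Re z \<Longrightarrow> \<Psi> * nrm circ F \<le> nrm circ (\<lambda>y. G y - z * F y)"
  shows "nrm circ (coef k (S t f)) \<le> 2 * exp (- (ln 2 / 16) * \<Psi> * t) * nrm circ (coef k f)"
proof -
  define T where "T = 16 / \<Psi>"
  have T: "0 < T" using \<Psi> by (simp add: T_def)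
  have f: "f \<in> L2_T2" using fg by (simp add: generator_iff)
  have iter: "nrm circ (coef k (S (real n * T) f)) \<le> (1/2) ^ n * nrm circ (coef k f)" for n
  proof (induction n)
    case 0
    then show ?case using coef_S_zero[OF f] by simp
  next
    case (Suc n)
    have nT: "0 \<le> real n * T" using T by simp
    have "nrm circ (coef k (S (real (Suc n) * T) f)) = nrm circ (coef k (S T (S (real n * T) f)))"
      using S_add[of T "real n * T" f] T nT f by (intro nrm_coef_cong S_L2) (auto simp: algebra_simps)
    also have "\<dots> \<le> 1/2 * nrm circ (coef k (S (real n * T) f))"
      unfolding T_def by (rule coef_halving[OF generator_shift[OF fg] \<Psi> resolvent]) (use nT T_def in auto)
    also have "\<dots> \<le> 1/2 * ((1/2) ^ n * nrm circ (coef k f))" by (intro mult_left_mono Suc) simp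
    finally show ?case by simp
  qed
  define n where "n = nat \<lfloor>t / T\<rfloor>"
  have nb: "real n \<le> t / T" "t / T < real n + 1" using t T by (auto simp: n_def)
  then have nT: "real n * T \<le> t" using T by (simp add: field_simps)
  have n0: "0 \<le> real n * T" "0 \<le> t - real n * T" using T nT by auto
  have "nrm circ (coef k (S t f)) = nrm circ (coef k (S (t - real n * T) (S (real n * T) f)))"
    using S_add[of "t - real n * T" "real n * T" f] n0 f t by (intro nrm_coef_cong S_L2) auto
  also have "\<dots> \<le> nrm circ (coef k (S (real n * T) f))"
    by (rule coef_contraction[OF generator_shift[OF fg n0(1)] n0(2)])
  also have "\<dots> \<le> (1/2) ^ n * nrm circ (coef k f)" by (rule iter)
  also have "\<dots> \<le> 2 * exp (- (ln 2 / 16) * \<Psi> * t) * nrm circ (coef k f)"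
  proof (rule mult_right_mono)
    have "(1/2 :: real) ^ n = exp (- (ln 2 * real n))"
      by (simp add: exp_minus exp_of_nat2_mult power_one_over inverse_eq_divide)
    also have "\<dots> \<le> exp (ln 2 - ln 2 * (t / T))"
    proof -
      have "ln 2 * (t / T) \<le> ln 2 * (real n + 1)" using nb by (intro mult_left_mono) auto
      then show ?thesis by (simp add: algebra_simps)
    qed
    also have "ln 2 - ln 2 * (t / T) = ln 2 + (- (ln 2 / 16) * \<Psi> * t)" by (simp add: T_def)
    also have "exp \<dots> = 2 * exp (- (ln 2 / 16) * \<Psi> * t)" unfolding exp_add by simp
    finally show "(1/2) ^ n \<le> 2 * exp (- (ln 2 / 16) * \<Psi> * t)" .
  qed simp
  finally show ?thesis .
qed

end

section \<open>Decay on a Fourier mode\<close>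

lemma drift_diffusion_op_add:
  assumes 1: "drift_diffusion_op \<mu> \<nu> u f1 g1" and 2: "drift_diffusion_op \<mu> \<nu> u f2 g2" and u: "continuous_on UNIV u"
  shows "drift_diffusion_op \<mu> \<nu> u (\<lambda>z. a * f1 z + b * f2 z) (\<lambda>z. a * g1 z + b * g2 z)"
  unfolding drift_diffusion_op_def
proof (intro conjI allI impI)
  have L: "f1 \<in> L2_T2" "f2 \<in> L2_T2" "g1 \<in> L2_T2" "g2 \<in> L2_T2" using 1 2 by (auto simp: drift_diffusion_op_def)
  then show "(\<lambda>z. a * f1 z + b * f2 z) \<in> L2_T2" "(\<lambda>z. a * g1 z + b * g2 z) \<in> L2_T2"
    by (intro L2_T2_lincomb; simp)+
  fix \<phi> assume \<phi>: "test_function \<phi>"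
  have diff: "(dx ^^ i) ((dy ^^ j) \<phi>) differentiable_on UNIV" for i j using \<phi> by (simp add: test_function_def)
  have d: "\<phi> differentiable_on UNIV" "dx \<phi> differentiable_on UNIV" "dx (dx \<phi>) differentiable_on UNIV"
    "dy (dy \<phi>) differentiable_on UNIV"
    using diff[of 0 0] diff[of 1 0] diff[of 2 0] diff[of 0 2] by (simp_all add: numeral_2_eq_2)
  note c = d[THEN differentiable_on_UNIV_continuous]
  let ?w = "\<lambda>z. of_real \<mu> * dx (dx \<phi>) z + of_real \<nu> * dy (dy \<phi>) z + of_real (u (snd z)) * dx \<phi> z"
  have wc: "continuous_on UNIV ?w"
    by (intro continuous_intros c continuous_on_compose2[OF u]) auto
  have lin: "(LINT z:cell|lborel. (a * h1 z + b * h2 z) * w z) = a * (LINT z:cell|lborel. h1 z * w z) + b * (LINT z:cell|lborel. h2 z * w z)"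
    if h: "h1 \<in> L2_T2" "h2 \<in> L2_T2" and w: "continuous_on UNIV w" for h1 h2 w
  proof -
    have ws: "w \<in> sq tor" by (rule sq_tor_continuous[OF w])
    have i: "integrable tor (\<lambda>z. h1 z * w z)" "integrable tor (\<lambda>z. h2 z * w z)"
      by (intro sq_prod_integrable L2_T2_sq h ws)+
    have [measurable]: "h1 \<in> borel_measurable borel" "h2 \<in> borel_measurable borel" "w \<in> borel_measurable borel"
      using h by (auto intro: L2_T2_meas borel_measurable_continuous_onI w)
    have "(LINT z:cell|lborel. (a * h1 z + b * h2 z) * w z) = (\<integral>z. (a * h1 z + b * h2 z) * w z \<partial>tor)"
      by (rule integral_tor[symmetric]) measurable
    also have "\<dots> = (\<integral>z. a * (h1 z * w z) + b * (h2 z * w z) \<partial>tor)" by (simp add: distrib_right mult.assoc)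
    also have "\<dots> = a * (\<integral>z. h1 z * w z \<partial>tor) + b * (\<integral>z. h2 z * w z \<partial>tor)"
      unfolding Bochner_Integration.integral_add[OF integrable_mult_right[OF i(1)] integrable_mult_right[OF i(2)]] integral_mult_right_zero ..
    also have "(\<integral>z. h1 z * w z \<partial>tor) = (LINT z:cell|lborel. h1 z * w z)" by (rule integral_tor) measurable
    also have "(\<integral>z. h2 z * w z \<partial>tor) = (LINT z:cell|lborel. h2 z * w z)" by (rule integral_tor) measurable
    finally show ?thesis .
  qed
  have e: "(LINT z:cell|lborel. g1 z * \<phi> z) = (LINT z:cell|lborel. f1 z * ?w z)"
    "(LINT z:cell|lborel. g2 z * \<phi> z) = (LINT z:cell|lborel. f2 z * ?w z)"
    using 1 2 \<phi> by (simp_all add: drift_diffusion_op_def)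
  show "(LINT z:cell|lborel. (a * g1 z + b * g2 z) * \<phi> z) = (LINT z:cell|lborel. (a * f1 z + b * f2 z) * ?w z)"
    unfolding lin[OF L(3,4) c(1)] lin[OF L(1,2) wc] e ..
qed

text \<open>Provides a dense set of domain elements inside a single mode.\<close>

lemma trig_mode_domain:
  assumes u: "continuous_on UNIV u" and uper: "\<And>y. u (y + 2 * pi) = u y" and p: "trig p"
  shows "\<exists>g. drift_diffusion_op \<mu> \<nu> u (\<lambda>(x, y). p y * cis (of_int k * x)) g"
  using p
proof induction
  case (mono c m)
  have eq: "(\<lambda>(x, y). c * cis (of_int m * y) * cis (of_int k * x)) = (\<lambda>z. c * expo k m z + 0 * expo k m z)"
    by (auto simp: expo_def)
  show ?case
    unfolding eq by (rule exI, rule drift_diffusion_op_add[OF expo_domain[OF u uper] expo_domain[OF u uper] u])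
next
  case (add p q)
  then obtain g1 g2 where "drift_diffusion_op \<mu> \<nu> u (\<lambda>(x, y). p y * cis (of_int k * x)) g1"
    "drift_diffusion_op \<mu> \<nu> u (\<lambda>(x, y). q y * cis (of_int k * x)) g2" by blast
  from drift_diffusion_op_add[OF this u, of 1 1]
  have "drift_diffusion_op \<mu> \<nu> u (\<lambda>z. 1 * (case z of (x, y) \<Rightarrow> p y * cis (of_int k * x)) + 1 * (case z of (x, y) \<Rightarrow> q y * cis (of_int k * x)))
    (\<lambda>z. 1 * g1 z + 1 * g2 z)" .
  also have "(\<lambda>z. 1 * (case z of (x, y) \<Rightarrow> p y * cis (of_int k * x)) + 1 * (case z of (x, y) \<Rightarrow> q y * cis (of_int k * x)))
    = (\<lambda>(x, y). (p y + q y) * cis (of_int k * x))"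
    by (auto simp: distrib_right)
  finally show ?case by blast
qed

lemma coef_mode:
  "coef l (\<lambda>(x, y). F y * cis (of_int k * x)) y = (if l = k then F y else 0)"
proof -
  have "(\<integral>s. F y * cis (of_int k * s) * cis (- (of_int l * s)) \<partial>circ) = (\<integral>s. F y * cis (of_int (k - l) * s) \<partial>circ)"
    by (simp add: mult.assoc cis_mult left_diff_distrib)
  also have "\<dots> = F y * (\<integral>s. cis (of_int (k - l) * s) \<partial>circ)" by (rule integral_mult_right_zero)
  finally show ?thesis unfolding integral_cis_circ by (simp add: coef_def)
qed

lemma fourier_proj_L2:
  assumes f: "f \<in> L2_T2" shows "fourier_proj k f \<in> L2_T2"
proof -
  have "coef k f (y + 2 * pi) = coef k f y" for y
    using L2_T2_periodic[OF f] by (simp add: coef_def periodic2_def)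
  then have "periodic2 (\<lambda>(x, y). coef k f y * cis (of_int k * x))"
    by (simp add: periodic2_def cis_int_periodic)
  then show ?thesis
    unfolding fourier_proj_eq[OF L2_T2_meas[OF f]] L2_T2_iff
    using nrm_tor_mode(1)[OF coef_sq(1)[OF L2_T2_sq[OF f]]] by blast
qed

context drift_semigroup
begin

text \<open>\<open>coef_decay\<close> concerns data in the domain and one coefficient at a time. The
  projection of \<open>f\<close> is approximated by a trigonometric polynomial in y times the k-th
  exponential in x, whose orbit has no other modes, so its norm on the torus is a multiple of that
  of the coefficient. The crude bound \<open>M\<close> multiplies only the approximation error and
  disappears in the limit.\<close>

lemma mode_decay:
  assumes uper: "\<And>y. u (y + 2 * pi) = u y" and \<Psi>: "0 < \<Psi>" and t: "0 \<le> t"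
    and resolvent: "\<And>F G z. mode_op \<mu> \<nu> u k F G \<Longrightarrow> 0 \<le> Re z \<Longrightarrow> \<Psi> * nrm circ F \<le> nrm circ (\<lambda>y. G y - z * F y)"
  shows "L2_opnorm (S t \<circ> fourier_proj k) \<le> ereal (2 * exp (- (ln 2 / 16) * \<Psi> * t))"
  unfolding L2_opnorm_def
proof (rule SUP_least)
  fix f assume "f \<in> {f \<in> L2_T2. L2_norm f \<le> 1}"
  then have f: "f \<in> L2_T2" and f1: "nrm tor f \<le> 1" by (auto simp: L2_norm_eq[OF L2_T2_meas])
  let ?D = "2 * exp (- (ln 2 / 16) * \<Psi> * t)"
  let ?r = "sqrt (2 * pi)"
  define P where "P = fourier_proj k f"
  have PL: "P \<in> L2_T2" unfolding P_def by (rule fourier_proj_L2[OF f])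
  have Peq: "P = (\<lambda>(x, y). coef k f y * cis (of_int k * x))"
    unfolding P_def by (rule fourier_proj_eq[OF L2_T2_meas[OF f]])
  note cs = coef_sq[OF L2_T2_sq[OF f], of k]
  have cf: "?r * nrm circ (coef k f) \<le> 1"
  proof -
    have "(?r * nrm circ (coef k f))\<^sup>2 \<le> (nrm tor f)\<^sup>2" using cs(2) by (simp add: power_mult_distrib)
    then have "?r * nrm circ (coef k f) \<le> nrm tor f" by (rule power2_le_imp_le) simp
    then show ?thesis using f1 by simp
  qed
  obtain M where M: "0 \<le> M" "\<And>w. w \<in> L2_T2 \<Longrightarrow> nrm tor (S t w) \<le> M * nrm tor w"
    using bound_upto[of t] t by (metis order_refl)
  have D0: "0 < ?D" by simp
  have "nrm tor (S t P) \<le> ?D + (?D * ?r + M * ?r) * e" if e: "0 < e" for e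
  proof -
    obtain p where p: "trig p" "nrm circ (\<lambda>y. coef k f y - p y) < e"
      using trig_dense[OF cs(1) e] .
    have ps: "p \<in> sq circ" by (intro sq_ivl_continuous trig_continuous p)
    define h where "h = (\<lambda>(x, y). p y * cis (of_int k * x))"
    obtain g where g: "semigroup_generator S h g"
      using trig_mode_domain[OF u_cont uper p(1)] unfolding gen_iff h_def by blast
    have hL: "h \<in> L2_T2" using g by (simp add: generator_iff)
    have StL: "S t h \<in> L2_T2" "S t P \<in> L2_T2" by (intro S_L2 t hL PL)+
    \<comment> \<open>Invariance of the mode: every other coefficient starts at zero and
      contracts.\<close>
    have zero: "AE y in circ. coef l (S t h) y = 0" if "l \<noteq> k" for l
    proof -
      have "coef l h = (\<lambda>y. 0)" using that by (simp add: h_def coef_mode fun_eq_iff)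
      then have "nrm circ (coef l (S t h)) \<le> 0"
        using coef_contraction[OF g t, of l] by (simp add: nrm_def)
      then show ?thesis
        using nrm_nonneg[of circ "coef l (S t h)"] by (intro nrm_eq_0 coef_sq L2_T2_sq StL) linarith
    qed
    have "nrm tor (S t h) = ?r * nrm circ (coef k (S t h))"
      by (rule single_mode_norm[OF L2_T2_sq[OF StL(1)] zero])
    also have "\<dots> \<le> ?r * (?D * nrm circ (coef k h))"
      by (intro mult_left_mono coef_decay[OF g \<Psi> t resolvent]) auto
    also have "coef k h = p" by (simp add: h_def coef_mode fun_eq_iff)
    finally have 1: "nrm tor (S t h) \<le> ?D * (?r * nrm circ p)" by (simp add: mult_ac)
    have "nrm circ p \<le> nrm circ (coef k f) + nrm circ (\<lambda>y. p y - coef k f y)"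
      by (rule nrm_le_add_diff[OF ps cs(1)])
    also have "nrm circ (\<lambda>y. p y - coef k f y) \<le> e"
      using p(2) by (subst nrm_minus_commute) simp
    finally have "?r * nrm circ p \<le> ?r * (nrm circ (coef k f) + e)" by (intro mult_left_mono) auto
    also have "\<dots> \<le> 1 + ?r * e" using cf by (simp add: distrib_left)
    finally have 2: "?D * (?r * nrm circ p) \<le> ?D * (1 + ?r * e)" using D0 by (intro mult_left_mono) auto
    have 3: "nrm tor (\<lambda>z. S t P z - S t h z) \<le> M * (?r * e)"
    proof -
      have "(\<lambda>z. P z - h z) = (\<lambda>(x, y). (coef k f y - p y) * cis (of_int k * x))"
        by (auto simp: Peq h_def left_diff_distrib)
      then have "nrm tor (\<lambda>z. P z - h z) = ?r * nrm circ (\<lambda>y. coef k f y - p y)"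
        using nrm_tor_mode(2)[OF sq_diff[OF cs(1) ps], of k] by simp
      also have "\<dots> \<le> ?r * e" using p(2) by (intro mult_left_mono) auto
      finally have "M * nrm tor (\<lambda>z. P z - h z) \<le> M * (?r * e)" using M(1) by (intro mult_left_mono) auto
      moreover have "nrm tor (\<lambda>z. S t P z - S t h z) \<le> M * nrm tor (\<lambda>z. P z - h z)"
        unfolding op_diff_nrm[OF S_op[OF t] PL hL] by (intro M(2) L2_T2_diff PL hL)
      ultimately show ?thesis by simp
    qed
    have "nrm tor (S t P) \<le> nrm tor (S t h) + nrm tor (\<lambda>z. S t P z - S t h z)"
      by (intro nrm_le_add_diff L2_T2_sq StL)
    also have "\<dots> \<le> ?D * (1 + ?r * e) + M * (?r * e)" using 1 2 3 by linarith
    also have "\<dots> = ?D + (?D * ?r + M * ?r) * e" by (simp add: algebra_simps)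
    finally show ?thesis .
  qed
  note est = this
  define B where "B = ?D * ?r + M * ?r"
  have B0: "0 < B" unfolding B_def using D0 M(1) by (intro add_pos_nonneg mult_pos_pos mult_nonneg_nonneg) auto
  have "nrm tor (S t P) \<le> ?D"
  proof (rule field_le_epsilon)
    fix e :: real assume "0 < e"
    then have "nrm tor (S t P) \<le> ?D + B * (e / B)" using est[of "e / B"] B0 by (simp add: B_def)
    then show "nrm tor (S t P) \<le> ?D + e" using B0 by simp
  qed
  then show "ereal (L2_norm ((S t \<circ> fourier_proj k) f)) \<le> ereal ?D"
    using L2_norm_eq[OF L2_T2_meas[OF S_L2[OF t PL]]] by (simp add: P_def)
qed

end

context lacunary
begin

lemma u_periodic: "u (y + 2 * pi) = u y"
proof -
  have "sin (3 ^ Suc n * (y + 2 * pi)) = sin (3 ^ Suc n * y)" for n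
  proof -
    have c: "cis (2 * pi * real (3 ^ Suc n)) = 1" by (rule cis_multiple_2pi) auto
    have "3 ^ Suc n * (y + 2 * pi) = 3 ^ Suc n * y + 2 * pi * real (3 ^ Suc n)" by (simp add: algebra_simps)
    then have "sin (3 ^ Suc n * (y + 2 * pi)) = sin (3 ^ Suc n * y) * Re (cis (2 * pi * real (3 ^ Suc n)))
        + cos (3 ^ Suc n * y) * Im (cis (2 * pi * real (3 ^ Suc n)))"
      by (simp only: sin_add cis.sel)
    then show ?thesis unfolding c by simp
  qed
  then show ?thesis by (simp only: u_eq)
qed

text \<open>The rate constant is fixed before the semigroup, \<mu>, \<nu> and \<open>k\<close> are
  chosen, so \<mu> = \<nu> and \<mu> = 0 share it. The smallness of \<nu> / |k| keeps the logarithm,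
  and with it the rate, positive.\<close>

lemma uniform_decay:
  obtains \<epsilon> where "0 < \<epsilon>"
    "\<And>S \<mu> \<nu> k t. semigroup_generated_by S (drift_diffusion_op \<mu> \<nu> u) \<Longrightarrow> 0 < \<nu> \<Longrightarrow> 0 \<le> \<mu> \<Longrightarrow> k \<noteq> 0 \<Longrightarrow>
      \<nu> / \<bar>of_int k\<bar> \<le> 1 / 2 \<Longrightarrow> 0 \<le> t \<Longrightarrow>
      L2_opnorm (S t \<circ> fourier_proj k) \<le> ereal (2 * exp (- \<epsilon> * lambda_rate \<alpha> \<nu> k * t))"
proof -
  obtain c where c: "0 < c" and res: "\<And>\<mu> \<nu> k F G z. mode_op \<mu> \<nu> u k F G \<Longrightarrow> 0 < \<nu> \<Longrightarrow> 0 \<le> \<mu> \<Longrightarrow> k \<noteq> 0 \<Longrightarrow>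
      \<nu> / \<bar>of_int k\<bar> \<le> 1 / 2 \<Longrightarrow> 0 \<le> Re z \<Longrightarrow> c * lambda_rate \<alpha> \<nu> k * nrm circ F \<le> nrm circ (\<lambda>y. G y - z * F y)"
    using mode_resolvent by blast
  show thesis
  proof (rule that[of "ln 2 / 16 * c"])
    show "0 < ln 2 / 16 * c" using c by simp
    fix S :: "real \<Rightarrow> L2_op" and \<mu> \<nu> t :: real and k :: int
    assume S: "semigroup_generated_by S (drift_diffusion_op \<mu> \<nu> u)" and \<nu>: "0 < \<nu>" and \<mu>: "0 \<le> \<mu>" and k: "k \<noteq> 0"
      and small: "\<nu> / \<bar>of_int k\<bar> \<le> 1 / 2" and t: "0 \<le> t"
    interpret drift_semigroup S \<mu> \<nu> u
      by unfold_locales (fact S \<nu> \<mu> u_continuous)+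
    have k0: "0 < \<bar>real_of_int k\<bar>" using k by simp
    then have "2 * \<nu> \<le> \<bar>real_of_int k\<bar>" using small by (simp add: field_simps)
    then have "1 < \<bar>real_of_int k\<bar> / \<nu>" using \<nu> by (simp add: field_simps)
    then have "0 < ln (\<bar>real_of_int k\<bar> / \<nu>)" by simp
    then have rate: "0 < c * lambda_rate \<alpha> \<nu> k" using c k0 unfolding lambda_rate_def by (intro mult_pos_pos) auto
    have "L2_opnorm (S t \<circ> fourier_proj k) \<le> ereal (2 * exp (- (ln 2 / 16) * (c * lambda_rate \<alpha> \<nu> k) * t))"
      by (rule mode_decay[OF u_periodic rate t res[OF _ \<nu> \<mu> k small]])
    then show "L2_opnorm (S t \<circ> fourier_proj k) \<le> ereal (2 * exp (- (ln 2 / 16 * c) * lambda_rate \<alpha> \<nu> k * t))"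
      by (simp add: mult.assoc)
  qed
qed

end

theorem lemma5p4:
  fixes a :: "nat \<Rightarrow> real" and \<alpha> C\<^sub>0 :: real and u :: "real \<Rightarrow> real"
    and S R :: "real \<Rightarrow> real \<Rightarrow> L2_op"
  assumes "1 < \<alpha>" and "\<alpha> < 2" and "1 < C\<^sub>0"
    and "\<And>n. n \<ge> 1 \<Longrightarrow> real n powr (- \<alpha>) \<le> \<bar>a n\<bar> \<and> \<bar>a n\<bar> \<le> C\<^sub>0 * real n powr (- \<alpha>)"
    and "\<And>n. n \<ge> 1 \<Longrightarrow> 1 \<le> \<bar>a n\<bar> / \<bar>a (n + 1)\<bar> \<and> \<bar>a n\<bar> / \<bar>a (n + 1)\<bar> \<le> 3"
    and "\<And>y. u y = (\<Sum>n. a (Suc n) * sin (3 ^ Suc n * y))"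
    and "\<And>\<nu>. \<nu> > 0 \<Longrightarrow> is_S_semigroup u \<nu> (S \<nu>)"
    and "\<And>\<nu>. \<nu> > 0 \<Longrightarrow> is_R_semigroup u \<nu> (R \<nu>)"
  shows "\<exists>\<epsilon>>0. \<exists>C>0. \<forall>\<nu>>0. \<forall>k::int. k \<noteq> 0 \<longrightarrow> \<nu> / \<bar>of_int k\<bar> \<le> 1 / 2 \<longrightarrow>
    (\<forall>t\<ge>0.
       L2_opnorm (S \<nu> t \<circ> fourier_proj k) \<le> ereal (C * exp (- \<epsilon> * lambda_rate \<alpha> \<nu> k * t)) \<and>
       L2_opnorm (R \<nu> t \<circ> fourier_proj k) \<le> ereal (C * exp (- \<epsilon> * lambda_rate \<alpha> \<nu> k * t)))"
proof -
  interpret lacunary a \<alpha> C\<^sub>0 u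
    by unfold_locales (use assms in auto)
  obtain \<epsilon> where "0 < \<epsilon>" and decay: "\<And>S \<mu> \<nu> k t. semigroup_generated_by S (drift_diffusion_op \<mu> \<nu> u) \<Longrightarrow> 0 < \<nu> \<Longrightarrow> 0 \<le> \<mu> \<Longrightarrow>
      k \<noteq> 0 \<Longrightarrow> \<nu> / \<bar>of_int k\<bar> \<le> 1 / 2 \<Longrightarrow> 0 \<le> t \<Longrightarrow>
      L2_opnorm (S t \<circ> fourier_proj k) \<le> ereal (2 * exp (- \<epsilon> * lambda_rate \<alpha> \<nu> k * t))"
    using uniform_decay by blast
  show ?thesis
  proof (rule exI[of _ \<epsilon>], rule conjI[OF \<open>0 < \<epsilon>\<close>], rule exI[of _ 2], rule conjI, simp, intro allI impI conjI)
    fix \<nu> t :: real and k :: int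
    assume h: "0 < \<nu>" "k \<noteq> 0" "\<nu> / \<bar>of_int k\<bar> \<le> 1 / 2" "0 \<le> t"
    show "L2_opnorm (S \<nu> t \<circ> fourier_proj k) \<le> ereal (2 * exp (- \<epsilon> * lambda_rate \<alpha> \<nu> k * t))"
      using assms(7)[OF h(1)] h unfolding is_S_semigroup_def by (intro decay[of "S \<nu>" \<nu> \<nu>]) auto
    show "L2_opnorm (R \<nu> t \<circ> fourier_proj k) \<le> ereal (2 * exp (- \<epsilon> * lambda_rate \<alpha> \<nu> k * t))"
      using assms(8)[OF h(1)] h unfolding is_R_semigroup_def by (intro decay[of "R \<nu>" 0 \<nu>]) auto
  qed
qed

end
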